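(* Let $f\in C^2(\mathbb{R})$ be such that $f$ is odd, $f(\pm1)=0$, and $f$ is strictly concave in $(0,1)$. Let $\gamma\in(0,1)$, $0<\lambda\le\Lambda$, and let $K_1:\mathbb{R}\setminus\{0\}\to(0,+\infty)$ be a symmetric kernel, $K_1(-\tau)=K_1(\tau)$, satisfying $$\lambda\frac{c_{1,\gamma}}{|\tau|^{1+2\gamma}}\le K_1(\tau)\le\Lambda\frac{c_{1,\gamma}}{|\tau|^{1+2\gamma}},$$ and assume that it is decreasing in $(0,+\infty)$. Let $u_0$ be the layer solution associated to the kernel $K_1$, that is, $u_0:\mathbb{R}\to\mathbb{R}$ solving $$\begin{cases}L_{K_1}u_0=f(u_0)&\text{in }\mathbb{R},\\ \dot u_0>0&\text{in }\mathbb{R},\\ u_0(x)=-u_0(-x)&\text{in }\mathbb{R},\\ \displaystyle\lim_{x\to\pm\infty}u_0(x)=\pm1.\end{cases}$$ Then: (i) $\ddot u_0(x)\to0$ as $x\to\pm\infty$. (ii) $\ddot u_0(x)<0$ in $(0,+\infty)$.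
   Context: $L_{K_1}w(x)=\int_{\mathbb{R}}(w(x)-w(y))K_1(x-y)\,dy$ (principal value sense), and $c_{1,\gamma}=\gamma\,\frac{2^{2\gamma}\Gamma(\frac12+\gamma)}{\pi^{1/2}\Gamma(1-\gamma)}$. Dots denote derivatives. The layer solution is known to exist and be unique. Solutions are understood in the classical (pointwise) sense. *)

theory Defs
  imports "HOL-Analysis.Analysis"
begin

definition C2_real :: "(real \<Rightarrow> real) \<Rightarrow> bool" where
  "C2_real f \<longleftrightarrow>
     (\<forall>x. f differentiable (at x)) \<and>
     (\<forall>x. deriv f differentiable (at x)) \<and>
     continuous_on UNIV (deriv (deriv f))"

definition strictly_concave_on :: "real set \<Rightarrow> (real \<Rightarrow> real) \<Rightarrow> bool" where
  "strictly_concave_on S f \<longleftrightarrow>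
     convex S \<and>
     (\<forall>x\<in>S. \<forall>y\<in>S. \<forall>t. x \<noteq> y \<longrightarrow> 0 < t \<longrightarrow> t < 1 \<longrightarrow>
        f ((1 - t) * x + t * y) > (1 - t) * f x + t * f y)"

text \<open>The constant for which \<open>\<tau> \<mapsto> c1 \<gamma> / \<bar>\<tau>\<bar> powr (1 + 2 * \<gamma>)\<close> is the kernel of
  the one-dimensional fractional Laplacian of order \<open>2 * \<gamma>\<close>.\<close>

definition c1 :: "real \<Rightarrow> real" where
  "c1 \<gamma> = \<gamma> * (2 powr (2 * \<gamma>) * Gamma (1 / 2 + \<gamma>)) / (sqrt pi * Gamma (1 - \<gamma>))"

text \<open>A kernel is a function on the punctured line; the value of \<open>K\<close> at \<open>0\<close> is unconstrained
  here and is never used below. Measurability of \<open>K\<close> away from \<open>0\<close> follows from symmetry and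
  monotonicity. ``Decreasing'' is read in the weak sense. The parameters \<open>lam \<le> Lam\<close> are the ellipticity constants.\<close>

definition layer_kernel :: "real \<Rightarrow> real \<Rightarrow> real \<Rightarrow> (real \<Rightarrow> real) \<Rightarrow> bool" where
  "layer_kernel \<gamma> lam Lam K \<longleftrightarrow>
     (\<forall>\<tau>. \<tau> \<noteq> 0 \<longrightarrow> K \<tau> > 0) \<and>
     (\<forall>\<tau>. \<tau> \<noteq> 0 \<longrightarrow> K (- \<tau>) = K \<tau>) \<and>
     (\<forall>\<tau>. \<tau> \<noteq> 0 \<longrightarrow>
        lam * (c1 \<gamma> / \<bar>\<tau>\<bar> powr (1 + 2 * \<gamma>)) \<le> K \<tau> \<and>
        K \<tau> \<le> Lam * (c1 \<gamma> / \<bar>\<tau>\<bar> powr (1 + 2 * \<gamma>))) \<and>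
     antimono_on {0<..} K"

text \<open>\<open>has_L K w x l\<close> says that the principal value integral defining \<open>L\<^sub>K w (x)\<close> exists and
  equals \<open>l\<close>. Since the Bochner integral of a non-integrable function is \<open>0\<close>, integrability of
  the truncated integrands is required explicitly.\<close>

definition has_L :: "(real \<Rightarrow> real) \<Rightarrow> (real \<Rightarrow> real) \<Rightarrow> real \<Rightarrow> real \<Rightarrow> bool" where
  "has_L K w x l \<longleftrightarrow>
     (\<forall>\<epsilon>>0. set_integrable lborel {y. \<epsilon> < \<bar>x - y\<bar>} (\<lambda>y. (w x - w y) * K (x - y))) \<and>
     ((\<lambda>\<epsilon>. set_lebesgue_integral lborel {y. \<epsilon> < \<bar>x - y\<bar>} (\<lambda>y. (w x - w y) * K (x - y)))
        \<longlongrightarrow> l) (at_right 0)"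

definition layer_solution :: "(real \<Rightarrow> real) \<Rightarrow> (real \<Rightarrow> real) \<Rightarrow> (real \<Rightarrow> real) \<Rightarrow> bool" where
  "layer_solution K f u \<longleftrightarrow>
     (\<forall>x. has_L K u x (f (u x))) \<and>
     (\<forall>x. u differentiable (at x) \<and> deriv u x > 0) \<and>
     (\<forall>x. u x = - u (- x)) \<and>
     (u \<longlongrightarrow> 1) at_top \<and>
     (u \<longlongrightarrow> - 1) at_bot"

end

theory Submission
  imports Defs "HOL-Probability.Helly_Selection"
begin

text \<open>
  The idea is to trade the pointwise principal-value equation for a convolution identity. With
  \<open>\<mu> > sup \<bar>f'\<bar>\<close> and \<open>F s = f s + \<mu> s\<close>, the equation says \<open>u = G * F(u)\<close>, where \<open>G\<close> is the Green
  function of \<open>L + \<mu>\<close>. It is obtained from the kernels \<open>K (max \<bar>x\<bar> \<epsilon>)\<close>, whose resolvents are Neumann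
  series of unimodal functions, by Helly selection; a comparison argument at maxima identifies the
  limit, since \<open>u\<close> is only known to solve the equation pointwise. Monotonicity of \<open>K\<close> makes \<open>G\<close> even and
  decreasing on \<open>(0, \<infinity>)\<close>.

  Splitting off the mass of \<open>G\<close> near \<open>0\<close>, which is small, leaves a bounded unimodal kernel, so one
  difference quotient of \<open>u\<close> or \<open>u'\<close> is controlled by a contraction. This gives two derivatives without any rate,
  and \<open>u', u'' \<rightarrow> 0\<close> by uniform continuity.

  Since \<open>G\<close> is unimodal, convolution with \<open>G\<close> is positive on odd functions that are nonnegative on \<open>(0, \<infinity>)\<close>. The positive
  part of a second difference of \<open>u\<close> is a subsolution of \<open>z \<le> G * (F'(u) z)\<close> there, while \<open>u\<close> is a strict
  supersolution by concavity of \<open>f\<close>; pairing the two with each other shows that \<open>u\<close> is concave on \<open>(0, \<infinity>)\<close>. A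
  zero of \<open>u''\<close> would make \<open>f''\<close> vanish on an interval.
\<close>

section \<open>Convolution on the line\<close>

text \<open>The obstacle is that the equation holds only pointwise, as a principal value, for a
  function known to be differentiable once; it can neither be differentiated nor tested against
  another function. \<open>K\<close> enters the second half only through
  \<open>u = G * F(u)\<close>: everything there rests on \<open>G\<close> being nonnegative,
  integrable and decreasing in the distance to 0. The upper bound on \<open>K\<close> makes the
  truncations and the second moment near 0 integrable; the lower bound makes \<open>r * K r\<close>
  unbounded near 0, which excludes an atom at 0 in the limit of the resolvents. The choice of \<mu>
  makes F strictly increasing on [-1, 1], so that p = F'(u) lies strictly between 0 and 2\<mu>. The
  upper bound turns a piece of \<open>G\<close> of mass 1/(4\<mu>) into a contraction with factor
  1/2; positivity lets p act as a weight in the final pairing. There u = G * (p u) + G * r with r =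
  F(u) - p u, and the symmetry of \<open>G\<close> balances a nonnegative gap against a nonnegative
  loss, so that both integrals vanish.\<close>

definition conv :: "(real \<Rightarrow> real) \<Rightarrow> (real \<Rightarrow> real) \<Rightarrow> real \<Rightarrow> real" where
  "conv g \<phi> x = (LBINT y. g y * \<phi> (x - y))"

lemma integral_reflect: "(LBINT y. f (c - y)) = (LBINT y. f y)" for f :: "real \<Rightarrow> real"
  using lborel_integral_real_affine[of "-1" f c] by simp

lemma integrable_reflect: "integrable lborel (\<lambda>y. f (c - y)) \<longleftrightarrow> integrable lborel f"
  for f :: "real \<Rightarrow> real"
  using lborel_integrable_real_affine_iff[of "-1" f c] by simp

lemma integral_translate: "(LBINT y. f (y + c)) = (LBINT y. f y)" for f :: "real \<Rightarrow> real"
  using lborel_integral_real_affine[of 1 f c] by (simp add: add.commute)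

lemma integrable_translate: "integrable lborel (\<lambda>y. f (y + c)) \<longleftrightarrow> integrable lborel f"
  for f :: "real \<Rightarrow> real"
  using lborel_integrable_real_affine_iff[of 1 f c] by (simp add: add.commute)

lemma integrable_mult_bounded:
  fixes g \<phi> :: "'a \<Rightarrow> real"
  assumes "integrable M g" "\<phi> \<in> borel_measurable M" "\<And>x. \<bar>\<phi> x\<bar> \<le> B"
  shows "integrable M (\<lambda>y. g y * \<phi> y)"
proof (rule Bochner_Integration.integrable_bound[where f="\<lambda>y. B * g y"])
  show "AE x in M. norm (g x * \<phi> x) \<le> norm (B * g x)"
  proof (rule AE_I2)
    fix x
    have "\<bar>g x\<bar> * \<bar>\<phi> x\<bar> \<le> \<bar>g x\<bar> * \<bar>B\<bar>"
      using assms(3)[of x] by (intro mult_left_mono) auto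
    then show "norm (g x * \<phi> x) \<le> norm (B * g x)" by (simp add: abs_mult mult.commute)
  qed
qed (use assms in auto)

lemma conv_integrable_integrand:
  fixes g \<phi> :: "real \<Rightarrow> real"
  assumes g: "integrable lborel g" and m: "\<phi> \<in> borel_measurable borel" and b: "\<And>x. \<bar>\<phi> x\<bar> \<le> B"
  shows "integrable lborel (\<lambda>y. g y * \<phi> (x - y))"
  by (rule integrable_mult_bounded[OF g, where B=B]) (use m b in auto)

lemma conv_commute: "conv g \<phi> x = (LBINT y. g (x - y) * \<phi> y)"
  unfolding conv_def using integral_reflect[of "\<lambda>y. g y * \<phi> (x - y)" x] by simp

lemma conv_measurable [measurable]:
  assumes [measurable]: "g \<in> borel_measurable borel" "\<phi> \<in> borel_measurable borel"
  shows "conv g \<phi> \<in> borel_measurable borel"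
  unfolding conv_def by measurable

lemma conv_le:
  assumes g: "integrable lborel g" and g0: "\<And>x. 0 \<le> g x" and m: "\<phi> \<in> borel_measurable borel"
    and b: "\<And>x. \<bar>\<phi> x\<bar> \<le> B"
  shows "\<bar>conv g \<phi> x\<bar> \<le> B * (LBINT y. g y)"
proof -
  have "\<bar>conv g \<phi> x\<bar> \<le> (LBINT y. \<bar>g y * \<phi> (x - y)\<bar>)"
    unfolding conv_def by (rule integral_abs_bound)
  also have "\<dots> \<le> (LBINT y. B * g y)"
  proof (rule integral_mono)
    show "integrable lborel (\<lambda>y. \<bar>g y * \<phi> (x - y)\<bar>)"
      using conv_integrable_integrand[OF g m b] by (rule integrable_abs)
    show "\<bar>g y * \<phi> (x - y)\<bar> \<le> B * g y" for y
      using mult_right_mono[OF b g0, of "x - y" y] g0[of y] by (simp add: abs_mult mult.commute)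
  qed (use g in auto)
  finally show ?thesis by simp
qed

lemma conv_diff:
  assumes g: "integrable lborel g" and m: "\<phi> \<in> borel_measurable borel" "\<psi> \<in> borel_measurable borel"
    and b: "\<And>x. \<bar>\<phi> x\<bar> \<le> B" "\<And>x. \<bar>\<psi> x\<bar> \<le> C"
  shows "conv g (\<lambda>x. \<phi> x - \<psi> x) x = conv g \<phi> x - conv g \<psi> x"
  unfolding conv_def right_diff_distrib
  by (rule Bochner_Integration.integral_diff; rule conv_integrable_integrand) (use assms in auto)

lemma conv_add:
  assumes g: "integrable lborel g" and m: "\<phi> \<in> borel_measurable borel" "\<psi> \<in> borel_measurable borel"
    and b: "\<And>x. \<bar>\<phi> x\<bar> \<le> B" "\<And>x. \<bar>\<psi> x\<bar> \<le> C"
  shows "conv g (\<lambda>x. \<phi> x + \<psi> x) x = conv g \<phi> x + conv g \<psi> x"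
  unfolding conv_def distrib_left
  by (rule Bochner_Integration.integral_add; rule conv_integrable_integrand) (use assms in auto)

lemma conv_cmult: "conv g (\<lambda>x. c * \<phi> x) x = c * conv g \<phi> x"
  unfolding conv_def by (simp add: mult.left_commute flip: integral_mult_right_zero)

lemma conv_uminus: "conv g (\<lambda>x. - \<phi> x) x = - conv g \<phi> x"
  unfolding conv_def by simp

lemma conv_translate: "conv g (\<lambda>t. \<phi> (t + h)) x = conv g \<phi> (x + h)"
  unfolding conv_def by (simp add: algebra_simps)

lemma conv_even:
  assumes "\<And>x. g (- x) = g x" "\<And>x. \<phi> (- x) = \<phi> x"
  shows "conv g \<phi> (- x) = conv g \<phi> x"
proof -
  have "conv g \<phi> (- x) = (LBINT y. g (0 - y) * \<phi> (- x - (0 - y)))"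
    unfolding conv_def by (rule integral_reflect[symmetric])
  also have "\<dots> = (LBINT y. g y * \<phi> (x - y))"
    using assms(1) assms(2)[of "x - y" for y] by simp
  finally show ?thesis by (simp add: conv_def)
qed

lemma conv_odd:
  assumes "\<And>x. g (- x) = g x" "\<And>x. \<phi> (- x) = - \<phi> x"
  shows "conv g \<phi> (- x) = - conv g \<phi> x"
proof -
  have "conv g \<phi> (- x) = (LBINT y. g (0 - y) * \<phi> (- x - (0 - y)))"
    unfolding conv_def by (rule integral_reflect[symmetric])
  also have "\<dots> = (LBINT y. - (g y * \<phi> (x - y)))"
    using assms(1) assms(2)[of "x - y" for y] by simp
  finally show ?thesis by (simp add: conv_def)
qed

text \<open>The inner integral of the absolute value is \<open>\<bar>k y\<bar>\<close> times the L1
  norm of \<open>g\<close>, by translation invariance. The exchanges of integrals in convolution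
  identities rest on this check.\<close>

lemma integrable_conv_pair:
  assumes k: "integrable lborel k" and g: "integrable lborel g"
  shows "integrable (lborel \<Otimes>\<^sub>M lborel) (\<lambda>(y, t). k y * g (t - y :: real) :: real)"
proof (rule lborel_pair.Fubini_integrable)
  note [measurable] = borel_measurable_integrable[OF k, simplified] borel_measurable_integrable[OF g, simplified]
  have gi: "integrable lborel (\<lambda>t. g (t - y))" for y
    using integrable_translate[of g "- y"] g by simp
  show "(\<lambda>(y, t). k y * g (t - y)) \<in> borel_measurable (lborel \<Otimes>\<^sub>M lborel)" by measurable
  have "(LBINT t. norm (k y * g (t - y))) = \<bar>k y\<bar> * (LBINT t. \<bar>g t\<bar>)" for y
    using integral_translate[of "\<lambda>t. \<bar>g t\<bar>" "- y"] by (simp add: abs_mult)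
  then show "integrable lborel (\<lambda>y. LBINT t. norm (case (y, t) of (y, t) \<Rightarrow> k y * g (t - y)))"
    using k by simp
  show "AE y in lborel. integrable lborel (\<lambda>t. case (y, t) of (y, t) \<Rightarrow> k y * g (t - y))"
    using gi by simp
qed

lemma conv_integrable:
  assumes k: "integrable lborel k" and g: "integrable lborel g"
  shows "integrable lborel (conv k g)" "integral\<^sup>L lborel (conv k g) = integral\<^sup>L lborel k * integral\<^sup>L lborel g"
proof -
  note P = integrable_conv_pair[OF k g]
  show "integrable lborel (conv k g)"
    unfolding conv_def using lborel_pair.integrable_snd[OF P] by simp
  have "integral\<^sup>L lborel (conv k g) = (LBINT t. (LBINT y. k y * g (t - y)))"
    by (simp add: conv_def[abs_def])
  also have "\<dots> = (LBINT y. (LBINT t. k y * g (t - y)))"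
    by (rule lborel_pair.Fubini_integral[OF P])
  also have "\<dots> = (LBINT y. k y * integral\<^sup>L lborel g)"
    using integral_translate[of g "- y" for y] by simp
  finally show "integral\<^sup>L lborel (conv k g) = integral\<^sup>L lborel k * integral\<^sup>L lborel g" by simp
qed

text \<open>Fubini against a bounded test function, in a form of which both the associativity of
  convolution and its symmetry are instances.\<close>

lemma conv_pairing:
  assumes k: "integrable lborel k" and g: "integrable lborel g"
    and m: "\<phi> \<in> borel_measurable borel" and b: "\<And>x. \<bar>\<phi> x\<bar> \<le> B"
  shows "(LBINT y. k y * (LBINT t. g (t - y) * \<phi> t)) = (LBINT t. conv k g t * \<phi> t)"
proof -
  have "integrable (lborel \<Otimes>\<^sub>M lborel) (\<lambda>z. (case z of (y, t) \<Rightarrow> k y * g (t - y)) * \<phi> (snd z))"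
    by (rule integrable_mult_bounded[OF integrable_conv_pair[OF k g]]) (use m b in auto)
  then have P: "integrable (lborel \<Otimes>\<^sub>M lborel) (\<lambda>(y, t). k y * g (t - y) * \<phi> t)"
    by (simp add: case_prod_beta')
  have "(LBINT t. conv k g t * \<phi> t) = (LBINT t. (LBINT y. k y * g (t - y) * \<phi> t))"
    by (simp add: conv_def)
  also have "\<dots> = (LBINT y. (LBINT t. k y * g (t - y) * \<phi> t))"
    by (rule lborel_pair.Fubini_integral[OF P])
  finally show ?thesis by (simp add: mult.assoc)
qed

lemma conv_assoc:
  assumes k: "integrable lborel k" and g: "integrable lborel g"
    and m: "\<phi> \<in> borel_measurable borel" and b: "\<And>x. \<bar>\<phi> x\<bar> \<le> B"
  shows "conv k (conv g \<phi>) x = conv (conv k g) \<phi> x"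
proof -
  have "conv (conv k g) \<phi> x = (LBINT y. k y * (LBINT t. g (t - y) * \<phi> (x - t)))"
    unfolding conv_def[of "conv k g" \<phi>]
    by (rule conv_pairing[symmetric, OF k g, where B=B]) (use m b in auto)
  moreover have "(LBINT t. g (t - y) * \<phi> (x - t)) = conv g \<phi> (x - y)" for y
    unfolding conv_def using integral_translate[of "\<lambda>t. g t * \<phi> (x - y - t)" "- y"] by (simp add: algebra_simps)
  ultimately show ?thesis by (simp add: conv_def[of k])
qed

text \<open>Self-adjointness of convolution with an even kernel, for one integrable and one bounded
  function. The final pairing has exactly this shape: the second difference is integrable, the layer
  only bounded.\<close>

lemma conv_symmetric:
  assumes k: "integrable lborel k" and g: "integrable lborel g" "\<And>x. g (- x) = g x"
    and m: "\<phi> \<in> borel_measurable borel" and b: "\<And>x. \<bar>\<phi> x\<bar> \<le> B"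
  shows "(LBINT x. \<phi> x * conv g k x) = (LBINT x. k x * conv g \<phi> x)"
proof -
  have "(LBINT t. g (t - y) * \<phi> t) = conv g \<phi> y" for y
    unfolding conv_commute using g(2)[of "y - t" for t] by simp
  moreover have "conv k g = conv g k"
    by (rule ext) (simp only: conv_commute[of g k] conv_def[of k g] mult.commute)
  ultimately show ?thesis
    using conv_pairing[OF k g(1) m b] by (simp add: mult.commute)
qed

section \<open>Unimodal functions and the resolvent of a jump generator\<close>

text \<open>One inequality encodes evenness and decrease in \<open>\<bar>x\<bar>\<close> together,
  and makes \<open>g 0\<close> a global upper bound.\<close>

definition unimodal :: "(real \<Rightarrow> real) \<Rightarrow> bool" where
  "unimodal g \<longleftrightarrow> (\<forall>x y. \<bar>x\<bar> \<le> \<bar>y\<bar> \<longrightarrow> g y \<le> g x)"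

lemma unimodalD: "unimodal g \<Longrightarrow> \<bar>x\<bar> \<le> \<bar>y\<bar> \<Longrightarrow> g y \<le> g x"
  by (simp add: unimodal_def)

lemma unimodal_even: "unimodal g \<Longrightarrow> g (- x) = g x"
  by (intro antisym; rule unimodalD) auto

lemma unimodal_measurable:
  assumes "unimodal g" shows "g \<in> borel_measurable borel"
proof -
  have "mono (\<lambda>t. - g (max 0 t))"
    by (intro monoI) (auto intro!: unimodalD[OF assms])
  then have [measurable]: "(\<lambda>t. - g (max 0 t)) \<in> borel_measurable borel"
    by (rule borel_measurable_mono)
  have "g x = - (- g (max 0 \<bar>x\<bar>))" for x
    using unimodal_even[OF assms, of x] by (auto simp: abs_if)
  then have "g = (\<lambda>x. - (\<lambda>t. - g (max 0 t)) \<bar>x\<bar>)" by auto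
  also have "\<dots> \<in> borel_measurable borel" by measurable
  finally show ?thesis .
qed

text \<open>Wintner's theorem on the line. Reflecting the integration variable in the midpoint of
  \<open>x\<close> and \<open>x'\<close> interchanges the distances to \<open>x\<close> and
  \<open>x'\<close>; averaging the two forms of the difference leaves the integral of a product of
  two differences, one of \<open>k\<close> and one of \<open>g\<close>, which always have the same
  sign.\<close>

lemma conv_unimodal:
  assumes k: "unimodal k" "integrable lborel k" and g: "unimodal g" "\<And>x. 0 \<le> g x"
  shows "unimodal (conv k g)"
  unfolding unimodal_def
proof (intro allI impI)
  fix x x' :: real assume le: "\<bar>x\<bar> \<le> \<bar>x'\<bar>"
  have ke: "k (- x) = k x" and ge: "g (- x) = g x" for x
    using k g by (auto intro: unimodal_even)
  show "conv k g x' \<le> conv k g x"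
  proof (cases "x = x' \<or> x = - x'")
    case True
    then show ?thesis using conv_even[of k g, OF ke ge] by auto
  next
    case False
    have pos: "0 < (x' - x) * (x' + x)"
    proof -
      have "x\<^sup>2 \<le> x'\<^sup>2" using le by (simp add: abs_le_square_iff)
      moreover have "x\<^sup>2 \<noteq> x'\<^sup>2" using False by (simp add: power2_eq_iff)
      ultimately show ?thesis by (simp add: power2_eq_square algebra_simps)
    qed
    have gm: "g \<in> borel_measurable borel" using unimodal_measurable[OF g(1)] .
    have gb: "\<bar>g x\<bar> \<le> g 0" for x using unimodalD[OF g(1), of 0 x] g(2)[of x] by auto
    have i1: "integrable lborel (\<lambda>y. k (z - y) * g (c - y))"
      and i2: "integrable lborel (\<lambda>y. k (z - y) * g y)" for z c
    proof -
      have ki: "integrable lborel (\<lambda>y. k (z - y))" using k(2) by (simp add: integrable_reflect)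
      show "integrable lborel (\<lambda>y. k (z - y) * g (c - y))" "integrable lborel (\<lambda>y. k (z - y) * g y)"
        by (rule integrable_mult_bounded[OF ki, where B="g 0"]; use gm gb in simp)+
    qed
    have D1: "conv k g x - conv k g x' = (LBINT y. (k (x - y) - k (x' - y)) * g y)"
      unfolding conv_commute left_diff_distrib
      by (rule Bochner_Integration.integral_diff[symmetric]; rule i2)
    also have "\<dots> = (LBINT y. (k (x - (x + x' - y)) - k (x' - (x + x' - y))) * g (x + x' - y))"
      by (rule integral_reflect[symmetric])
    also have "\<dots> = (LBINT y. (k (x' - y) - k (x - y)) * g (x + x' - y))"
    proof -
      have "k (x - (x + x' - y)) = k (x' - y)" "k (x' - (x + x' - y)) = k (x - y)" for y
        using ke[of "x' - y"] ke[of "x - y"] by simp_all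
      then show ?thesis by simp
    qed
    finally have D2: "conv k g x - conv k g x' = \<dots>" .
    have "2 * (conv k g x - conv k g x') = (LBINT y. (k (x - y) - k (x' - y)) * g y) +
          (LBINT y. (k (x' - y) - k (x - y)) * g (x + x' - y))"
      using D1 D2 by simp
    also have "\<dots> = (LBINT y. (k (x - y) - k (x' - y)) * g y + (k (x' - y) - k (x - y)) * g (x + x' - y))"
      by (rule Bochner_Integration.integral_add[symmetric]) (simp_all add: left_diff_distrib i1 i2)
    also have "\<dots> = (LBINT y. (k (x - y) - k (x' - y)) * (g y - g (x + x' - y)))"
      by (simp add: algebra_simps)
    also have "\<dots> \<ge> 0"
    proof (rule integral_nonneg_AE, rule AE_I2)
      fix y
      \<comment> \<open>The two differences of squares share the factor
        \<open>x' + x - 2 * y\<close>, and the remaining factors have equal sign by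
        \<open>pos\<close>. Hence the two comparisons of absolute values go the same way.\<close>
      have e1: "(x' - y)\<^sup>2 - (x - y)\<^sup>2 = (x' - x) * (x' + x - 2 * y)"
        and e2: "(x + x' - y)\<^sup>2 - y\<^sup>2 = (x' + x) * (x' + x - 2 * y)"
        by (simp_all add: power2_eq_square algebra_simps)
      have "\<bar>x - y\<bar> \<le> \<bar>x' - y\<bar> \<and> \<bar>y\<bar> \<le> \<bar>x + x' - y\<bar> \<or> \<bar>x' - y\<bar> \<le> \<bar>x - y\<bar> \<and> \<bar>x + x' - y\<bar> \<le> \<bar>y\<bar>"
        unfolding abs_le_square_iff using e1 e2 pos
        by (smt (verit) mult_nonneg_nonneg mult_nonpos_nonneg mult_nonneg_nonpos mult_nonpos_nonpos zero_less_mult_iff)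
      then show "0 \<le> (k (x - y) - k (x' - y)) * (g y - g (x + x' - y))"
        using unimodalD[OF k(1)] unimodalD[OF g(1)]
        by (auto intro: mult_nonneg_nonneg mult_nonpos_nonpos)
    qed
    finally show ?thesis by simp
  qed
qed

lemma conv_mono:
  assumes k: "integrable lborel k" "\<And>x. 0 \<le> k x"
    and m: "\<phi> \<in> borel_measurable borel" "\<psi> \<in> borel_measurable borel"
    and b: "\<And>x. \<bar>\<phi> x\<bar> \<le> B" "\<And>x. \<bar>\<psi> x\<bar> \<le> C" and le: "\<And>x. \<phi> x \<le> \<psi> x"
  shows "conv k \<phi> x \<le> conv k \<psi> x"
  unfolding conv_def
  by (intro integral_mono conv_integrable_integrand[OF k(1) m(1) b(1)] conv_integrable_integrand[OF k(1) m(2) b(2)]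
      mult_left_mono le k)

text \<open>For the generator \<open>L = m - conv k\<close>, the resolvent \<open>(L + \<mu>)\<^sup>-\<^sup>1\<close> is convolution with
  \<open>a\<cdot>\<delta>\<^sub>0 + g\<close>, where \<open>g\<close> is the sum of the Neumann series.\<close>

definition jump_resolvent :: "(real \<Rightarrow> real) \<Rightarrow> real \<Rightarrow> (real \<Rightarrow> real) \<Rightarrow> real \<Rightarrow> bool" where
  "jump_resolvent k \<mu> g a \<longleftrightarrow> unimodal g \<and> (\<forall>x. 0 \<le> g x) \<and> integrable lborel g \<and>
     a = 1 / (integral\<^sup>L lborel k + \<mu>) \<and>
     integral\<^sup>L lborel g = 1 / \<mu> - a \<and> (\<forall>x. g x = a\<^sup>2 * k x + a * conv k g x)"

text \<open>The iterates from 0 of \<open>g \<mapsto> a\<^sup>2 * k + a * conv k g\<close> are the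
  partial sums of the Neumann series. They stay unimodal, increase, and obey a sup bound and a mass
  bound that are fixed points of the corresponding scalar recursions, so monotone convergence gives
  the sum.\<close>

lemma jump_resolvent_exists:
  assumes k: "unimodal k" "\<And>x. 0 \<le> k x" "integrable lborel k" and mu: "0 < \<mu>"
  shows "\<exists>g a. jump_resolvent k \<mu> g a"
proof -
  define m where "m = integral\<^sup>L lborel k"
  define a where "a = 1 / (m + \<mu>)"
  have m0: "0 \<le> m" unfolding m_def using k(2) by simp
  have a0: "0 < a" unfolding a_def using m0 mu by simp
  have am: "a * (m + \<mu>) = 1" unfolding a_def using m0 mu by simp
  have km: "k \<in> borel_measurable borel" using unimodal_measurable[OF k(1)] .
  \<comment> \<open>The fixed point of the recursion for the sup bound, as \<open>Beq\<close>
    verifies.\<close>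
  define B where "B = a * k 0 / \<mu>"
  have B0: "0 \<le> B" unfolding B_def using a0 k(2) mu by simp
  have Beq: "a\<^sup>2 * k 0 + a * (B * m) = B"
  proof -
    have "a\<^sup>2 * k 0 + a * (B * m) = a * k 0 / \<mu> * (a * (m + \<mu>))"
      unfolding B_def power2_eq_square using mu by (simp add: field_simps)
    then show ?thesis unfolding am by (simp add: B_def)
  qed
  define r where "r = rec_nat (\<lambda>_. 0) (\<lambda>_ g x. a\<^sup>2 * k x + a * conv k g x)"
  have r0: "r 0 = (\<lambda>_. 0)" and rS: "r (Suc j) = (\<lambda>x. a\<^sup>2 * k x + a * conv k (r j) x)" for j
    by (simp_all add: r_def)
  have inv: "unimodal (r j) \<and> (\<forall>x. 0 \<le> r j x \<and> r j x \<le> B) \<and> integrable lborel (r j) \<and>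
     integral\<^sup>L lborel (r j) \<le> a * m / \<mu>" for j
  proof (induction j)
    case 0
    then show ?case using B0 a0 m0 mu by (simp add: r0 unimodal_def)
  next
    case (Suc j)
    then have u: "unimodal (r j)" and b: "\<And>x. 0 \<le> r j x" "\<And>x. \<bar>r j x\<bar> \<le> B" and i: "integrable lborel (r j)"
      and il: "integral\<^sup>L lborel (r j) \<le> a * m / \<mu>" by auto
    have c: "\<bar>conv k (r j) x\<bar> \<le> B * m" for x
      unfolding m_def by (rule conv_le) (use k b unimodal_measurable[OF u] in auto)
    have c0: "0 \<le> conv k (r j) x" for x
      unfolding conv_def using k(2) b(1) by simp
    have cu: "unimodal (conv k (r j))"
      by (rule conv_unimodal) (use k u b in auto)
    have u': "unimodal (r (Suc j))"
      unfolding rS using cu k(1) a0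
      by (auto simp: unimodal_def intro!: add_mono mult_left_mono)
    have "r (Suc j) x \<le> B" for x
    proof -
      have "r (Suc j) x \<le> a\<^sup>2 * k 0 + a * (B * m)"
        unfolding rS using c[of x] unimodalD[OF k(1), of 0 x] a0 by (intro add_mono mult_left_mono) auto
      then show ?thesis using Beq by simp
    qed
    moreover have "0 \<le> r (Suc j) x" for x
      unfolding rS using c0 a0 k(2) by simp
    moreover have "integrable lborel (r (Suc j))"
      unfolding rS using conv_integrable(1)[OF k(3) i] k(3) by simp
    moreover have "integral\<^sup>L lborel (r (Suc j)) \<le> a * m / \<mu>"
    proof -
      have "integral\<^sup>L lborel (r (Suc j)) = a\<^sup>2 * m + a * (m * integral\<^sup>L lborel (r j))"
        unfolding rS using conv_integrable[OF k(3) i] k(3) by (simp add: m_def)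
      also have "\<dots> \<le> a\<^sup>2 * m + a * (m * (a * m / \<mu>))"
        using il a0 m0 by (intro add_mono mult_left_mono) auto
      also have "\<dots> = a * m / \<mu> * (a * (m + \<mu>))"
        unfolding power2_eq_square using mu by (simp add: field_simps)
      finally show ?thesis by (simp add: am)
    qed
    ultimately show ?case using u' by auto
  qed
  have ru: "unimodal (r j)" and rn: "0 \<le> r j x" and rB: "r j x \<le> B" and ri: "integrable lborel (r j)"
    and rl: "integral\<^sup>L lborel (r j) \<le> a * m / \<mu>" for j x
    using inv by auto
  have rm [measurable]: "r j \<in> borel_measurable borel" for j using unimodal_measurable[OF ru] .
  have rinc: "r j x \<le> r (Suc j) x" for j x
  proof (induction j arbitrary: x)
    case 0
    then show ?case using rn[of 1 x] by (simp add: r0)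
  next
    case (Suc j)
    have "conv k (r j) x \<le> conv k (r (Suc j)) x"
      by (rule conv_mono[where B=B and C=B]) (use k rn rB rm Suc in auto)
    then show ?case unfolding rS[of j] rS[of "Suc j"] using a0 by simp
  qed
  then have rinc': "incseq (\<lambda>j. r j x)" for x by (intro incseq_SucI)
  have conv: "convergent (\<lambda>j. r j x)" for x
    by (rule Bseq_mono_convergent) (use rn rB rinc' in \<open>auto intro!: BseqI'[of _ B] simp: incseq_def\<close>)
  define g where "g x = lim (\<lambda>j. r j x)" for x
  have rg: "(\<lambda>j. r j x) \<longlonglongrightarrow> g x" for x
    unfolding g_def using conv[of x] by (simp add: convergent_LIMSEQ_iff)
  have gu: "unimodal g"
    unfolding unimodal_def using unimodalD[OF ru] by (auto intro: LIMSEQ_le[OF rg rg])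
  have gm [measurable]: "g \<in> borel_measurable borel" using unimodal_measurable[OF gu] .
  have g0: "0 \<le> g x" for x by (rule LIMSEQ_le_const[OF rg]) (use rn in auto)
  have gi: "integrable lborel g"
  proof -
    have "incseq (\<lambda>j. integral\<^sup>L lborel (r j))"
      by (intro incseq_SucI integral_mono ri rinc)
    moreover have "\<bar>integral\<^sup>L lborel (r j)\<bar> \<le> a * m / \<mu>" for j
      using rl[of j] rn by simp
    ultimately have "convergent (\<lambda>j. integral\<^sup>L lborel (r j))"
      by (intro Bseq_mono_convergent) (auto intro!: BseqI' simp: incseq_def)
    then obtain l where l: "(\<lambda>j. integral\<^sup>L lborel (r j)) \<longlonglongrightarrow> l" by (auto simp: convergent_def)
    show ?thesis
      by (rule integrable_monotone_convergence[OF ri _ _ l]) (use rinc' rg gm in \<open>auto simp: incseq_def mono_def\<close>)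
  qed
  have geq: "g x = a\<^sup>2 * k x + a * conv k g x" for x
  proof -
    have "(\<lambda>j. conv k (r j) x) \<longlonglongrightarrow> conv k g x"
      unfolding conv_def
    proof (rule integral_dominated_convergence[where w="\<lambda>y. k y * B"])
      show "AE y in lborel. norm (k y * r j (x - y)) \<le> k y * B" for j
        using k(2) rn rB by (auto simp: abs_mult intro!: AE_I2 mult_left_mono)
      show "AE y in lborel. (\<lambda>j. k y * r j (x - y)) \<longlonglongrightarrow> k y * g (x - y)"
        by (auto intro!: AE_I2 tendsto_intros rg)
    qed (use k(3) km in auto)
    then have "(\<lambda>j. r (Suc j) x) \<longlonglongrightarrow> a\<^sup>2 * k x + a * conv k g x"
      unfolding rS by (intro tendsto_intros)
    with LIMSEQ_Suc[OF rg[of x]] show ?thesis by (rule LIMSEQ_unique)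
  qed
  \<comment> \<open>Integrating the fixed-point equation gives a linear equation for the mass of
    \<open>g\<close>; its solution says that the atom and the density together have mass
    \<open>1 / \<mu>\<close>.\<close>
  have "integral\<^sup>L lborel g = (LBINT x. a\<^sup>2 * k x + a * conv k g x)"
    using geq by (intro Bochner_Integration.integral_cong) auto
  also have "\<dots> = a\<^sup>2 * m + a * (m * integral\<^sup>L lborel g)"
    using conv_integrable[OF k(3) gi] k(3) by (simp add: m_def)
  finally have s: "integral\<^sup>L lborel g * (1 - a * m) = a * (a * m)"
    by (simp add: algebra_simps power2_eq_square)
  have am1: "1 - a * m = a * \<mu>" using am by (simp add: algebra_simps)
  have am2: "a * m = 1 - a * \<mu>" using am1 by simp
  have "integral\<^sup>L lborel g * (a * \<mu>) = a * (1 - a * \<mu>)"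
    using s unfolding am1 unfolding am2 .
  then have "integral\<^sup>L lborel g = 1 / \<mu> - a"
    using a0 mu mult_right_cancel[of "a * \<mu>" "integral\<^sup>L lborel g" "1 / \<mu> - a"]
    by (simp add: left_diff_distrib right_diff_distrib)
  then show ?thesis unfolding jump_resolvent_def using gu g0 gi geq a_def m_def by blast
qed

section \<open>Bounds, equation and concentration estimate for the jump resolvent\<close>

context
  fixes k g \<mu> a
  assumes k: "unimodal k" "\<And>x. 0 \<le> k x" "integrable lborel k" and mu: "0 < \<mu>"
    and res: "jump_resolvent k \<mu> g a"
begin

lemma jump_resolvent_simps:
  shows "unimodal g" "0 \<le> g x" "integrable lborel g" "0 < a" "a * (integral\<^sup>L lborel k + \<mu>) = 1"
     "integral\<^sup>L lborel g = 1 / \<mu> - a" "g x = a\<^sup>2 * k x + a * conv k g x"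
     "g \<in> borel_measurable borel" "k \<in> borel_measurable borel"
proof -
  have "0 \<le> integral\<^sup>L lborel k" using k(2) by simp
  then have "0 < integral\<^sup>L lborel k + \<mu>" using mu by simp
  then show "0 < a" "a * (integral\<^sup>L lborel k + \<mu>) = 1"
    using res unfolding jump_resolvent_def by auto
  show "unimodal g" "0 \<le> g x" "integrable lborel g" "integral\<^sup>L lborel g = 1 / \<mu> - a" "g x = a\<^sup>2 * k x + a * conv k g x"
    using res unfolding jump_resolvent_def by blast+
  then show "g \<in> borel_measurable borel" "k \<in> borel_measurable borel"
    using unimodal_measurable k by auto
qed

text \<open>The resolvent is convolution with a positive measure of total mass
  \<open>1 / \<mu>\<close>.\<close>

lemma jump_resolvent_bound:
  assumes m: "\<phi> \<in> borel_measurable borel" and b: "\<And>x. \<bar>\<phi> x\<bar> \<le> B"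
  shows "\<bar>a * \<phi> x + conv g \<phi> x\<bar> \<le> B / \<mu>"
proof -
  note R = jump_resolvent_simps
  have "\<bar>a * \<phi> x + conv g \<phi> x\<bar> \<le> a * B + B * (1 / \<mu> - a)"
    using conv_le[OF R(3) R(2) m b, of x] R(4) b[of x] unfolding R(6)
    by (intro order_trans[OF abs_triangle_ineq] add_mono) (auto simp: abs_mult)
  then show ?thesis by (simp add: algebra_simps)
qed

text \<open>Convolving the fixed-point equation for \<open>g\<close> with \<open>\<phi>\<close>
  gives \<open>conv g \<phi> = a * conv k w\<close>, that is,
  \<open>w = a * (\<phi> + conv k w)\<close>; and \<open>a\<close> is the reciprocal of the mass of
  \<open>k\<close> plus \<open>\<mu>\<close>.\<close>

lemma jump_resolvent_equation:
  assumes m: "\<phi> \<in> borel_measurable borel" and b: "\<And>x. \<bar>\<phi> x\<bar> \<le> B"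
  defines "w \<equiv> \<lambda>x. a * \<phi> x + conv g \<phi> x"
  shows "(integral\<^sup>L lborel k + \<mu>) * w x - conv k w x = \<phi> x"
proof -
  note R = jump_resolvent_simps
  have cm: "conv g \<phi> \<in> borel_measurable borel" using m R(8) by measurable
  have cb: "\<bar>conv g \<phi> x\<bar> \<le> B * integral\<^sup>L lborel g" for x by (rule conv_le[OF R(3) R(2) m b])
  have ab: "\<bar>a * \<phi> x\<bar> \<le> a * B" for x using b[of x] R(4) by (simp add: abs_mult)
  have kw: "conv k w x = a * conv k \<phi> x + conv (conv k g) \<phi> x"
  proof -
    have "conv k w x = conv k (\<lambda>x. a * \<phi> x) x + conv k (conv g \<phi>) x"
      unfolding w_def by (rule conv_add[OF k(3) _ cm ab cb]) (use m in auto)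
    then show ?thesis
      unfolding conv_cmult using conv_assoc[OF k(3) R(3) m b] by simp
  qed
  have gk: "conv g \<phi> x = a\<^sup>2 * conv k \<phi> x + a * conv (conv k g) \<phi> x"
  proof -
    have "conv g \<phi> x = (LBINT y. a\<^sup>2 * (k y * \<phi> (x - y)) + a * (conv k g y * \<phi> (x - y)))"
      unfolding conv_def[of g \<phi>] by (subst R(7)) (simp add: algebra_simps)
    also have "\<dots> = a\<^sup>2 * conv k \<phi> x + a * conv (conv k g) \<phi> x"
      unfolding conv_def[of _ \<phi>]
      using conv_integrable_integrand[OF k(3) m b, of x]
        conv_integrable_integrand[OF conv_integrable(1)[OF k(3) R(3)] m b, of x] by simp
    finally show ?thesis .
  qed
  let ?M = "integral\<^sup>L lborel k + \<mu>"
  have "?M * w x = (a * ?M) * (\<phi> x + a * conv k \<phi> x + conv (conv k g) \<phi> x)"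
    unfolding w_def gk by (simp add: algebra_simps power2_eq_square)
  then show ?thesis unfolding R(5) kw by simp
qed

text \<open>The image under the resolvent of the indicator of a short interval is unimodal with small
  integral, hence small away from the origin; the equation at the origin then bounds the value there.\<close>

lemma jump_resolvent_concentration:
  assumes d: "0 \<le> \<delta>" and r: "0 < r" and kap: "0 < \<kappa>" "\<kappa> \<le> (LBINT y. k y * indicator {y. r < \<bar>y\<bar>} y)"
  shows "a + (LBINT y. g y * indicator {-\<delta>..\<delta>} y) \<le> \<delta> / (\<mu> * r) + 1 / \<kappa>"
proof -
  note R = jump_resolvent_simps
  note [measurable] = R(8,9)
  define \<eta> :: "real \<Rightarrow> real" where "\<eta> = indicator {-\<delta>..\<delta>}"
  define w where "w = (\<lambda>x. a * \<eta> x + conv g \<eta> x)"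
  have chi_u: "unimodal \<eta>" unfolding unimodal_def \<eta>_def by (auto simp: indicator_def)
  have chi0: "0 \<le> \<eta> x" and chi1: "\<bar>\<eta> x\<bar> \<le> 1" for x unfolding \<eta>_def by (auto simp: indicator_def)
  have chi_m [measurable]: "\<eta> \<in> borel_measurable borel" unfolding \<eta>_def by simp
  have chi_i: "integrable lborel \<eta>" "integral\<^sup>L lborel \<eta> = 2 * \<delta>" unfolding \<eta>_def using d by auto
  have cu: "unimodal (conv g \<eta>)" by (rule conv_unimodal[OF R(1,3) chi_u chi0])
  have wu: "unimodal w" unfolding w_def using cu chi_u R(4)
    by (auto simp: unimodal_def intro!: add_mono mult_left_mono)
  have c0: "0 \<le> conv g \<eta> x" for x unfolding conv_def using R(2) chi0 by simp
  have w0: "0 \<le> w x" for x unfolding w_def using c0 chi0 R(4) by simp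
  have wm [measurable]: "w \<in> borel_measurable borel" by (rule unimodal_measurable[OF wu])
  have wb: "\<bar>w x\<bar> \<le> w 0" for x using w0[of x] unimodalD[OF wu, of 0 x] by auto
  have wi: "integrable lborel w"
    unfolding w_def using chi_i conv_integrable(1)[OF R(3) chi_i(1)] by simp
  have wI: "integral\<^sup>L lborel w = 2 * \<delta> / \<mu>"
  proof -
    have "integral\<^sup>L lborel w = a * (2 * \<delta>) + (1 / \<mu> - a) * (2 * \<delta>)"
      unfolding w_def using chi_i conv_integrable[OF R(3) chi_i(1)] R(6) by simp
    then show ?thesis by (simp add: algebra_simps)
  qed
  \<comment> \<open>Unimodality against area: \<open>w\<close> is at least \<open>w r\<close> on an
    interval of length \<open>2 * r\<close>, while its integral is only
    \<open>2 * \<delta> / \<mu>\<close>.\<close>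
  have "w r * (2 * r) = (LBINT y. w r * indicator {-r..r} y)" using r by simp
  also have "\<dots> \<le> integral\<^sup>L lborel w"
  proof (rule integral_mono[OF _ wi])
    show "integrable lborel (\<lambda>y. w r * indicator {-r..r} y)"
      using r by (intro integrable_mult_right integrable_real_indicator) auto
    show "w r * indicator {-r..r} y \<le> w y" for y
      using unimodalD[OF wu, of y r] w0[of y] r by (auto simp: indicator_def abs_le_iff)
  qed
  finally have wr: "w r \<le> \<delta> / (\<mu> * r)"
    unfolding wI using r mu by (simp add: field_simps)
  have chi00: "\<eta> 0 = 1" unfolding \<eta>_def using d by simp
  have kwi: "integrable lborel (\<lambda>y. k y * w (0 - y))"
    by (rule conv_integrable_integrand[OF k(3) wm wb])
  have "(integral\<^sup>L lborel k + \<mu>) * w 0 - conv k w 0 = 1"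
    using jump_resolvent_equation[OF chi_m chi1, of 0] chi00 unfolding w_def by simp
  then have "integral\<^sup>L lborel k * w 0 - conv k w 0 \<le> 1"
    using w0[of 0] mu by (simp add: algebra_simps) (smt (verit) mult_nonneg_nonneg)
  also have "integral\<^sup>L lborel k * w 0 - conv k w 0 = (LBINT y. k y * w 0 - k y * w (0 - y))"
    unfolding conv_def using kwi k(3) by simp
  finally have one: "(LBINT y. k y * w 0 - k y * w (0 - y)) \<le> 1" .
  \<comment> \<open>Only jumps longer than \<open>r\<close> are kept. They land where
    \<open>w\<close> is at most \<open>w r\<close>; shorter jumps contribute nonnegatively because 0
    is the maximum of \<open>w\<close>.\<close>
  have "(LBINT y. (w 0 - w r) * (k y * indicator {y. r < \<bar>y\<bar>} y)) \<le> (LBINT y. k y * w 0 - k y * w (0 - y))"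
  proof (rule integral_mono)
    show "integrable lborel (\<lambda>y. (w 0 - w r) * (k y * indicator {y. r < \<bar>y\<bar>} y))"
      by (intro integrable_mult_right integrable_mult_bounded[OF k(3), where B=1]) (auto simp: indicator_def)
    show "integrable lborel (\<lambda>y. k y * w 0 - k y * w (0 - y))" using kwi k(3) by simp
    fix y
    show "(w 0 - w r) * (k y * indicator {y. r < \<bar>y\<bar>} y) \<le> k y * w 0 - k y * w (0 - y)"
    proof (cases "r < \<bar>y\<bar>")
      case True
      then have "w (- y) \<le> w r" using r by (intro unimodalD[OF wu]) auto
      then have "k y * (w 0 - w r) \<le> k y * (w 0 - w (- y))"
        using k(2) by (intro mult_left_mono) auto
      then show ?thesis using True by (simp add: algebra_simps)
    next
      case False
      have "k y * w (0 - y) \<le> k y * w 0" using k(2) unimodalD[OF wu, of 0 "0 - y"] by (intro mult_left_mono) auto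
      then show ?thesis using False by simp
    qed
  qed
  then have "(w 0 - w r) * (LBINT y. k y * indicator {y. r < \<bar>y\<bar>} y) \<le> 1" using one by simp
  moreover have "0 \<le> w 0 - w r" using unimodalD[OF wu, of 0 r] by simp
  ultimately have "(w 0 - w r) * \<kappa> \<le> 1"
    using kap(2) by (meson mult_left_mono order_trans)
  then have "w 0 - w r \<le> 1 / \<kappa>" using kap(1) by (simp add: field_simps)
  then have "w 0 \<le> \<delta> / (\<mu> * r) + 1 / \<kappa>" using wr by simp
  \<comment> \<open>The value of \<open>w\<close> at 0 is thus the atom plus the mass of
    \<open>g\<close> in the short interval.\<close>
  moreover have "conv g \<eta> 0 = (LBINT y. g y * indicator {-\<delta>..\<delta>} y)"
    unfolding conv_def \<eta>_def
    by (intro Bochner_Integration.integral_cong) (auto simp: indicator_def)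
  ultimately show ?thesis unfolding w_def chi00 by simp
qed

end

section \<open>Mollification and the maximum principle\<close>

definition dq :: "real \<Rightarrow> (real \<Rightarrow> real) \<Rightarrow> real \<Rightarrow> real" where
  "dq h f x = (f (x + h) - f x) / h"

lemma dq_MVT:
  assumes d: "\<And>x. (f has_real_derivative f' x) (at x)" and h: "h \<noteq> 0"
  shows "\<exists>z. \<bar>z - x\<bar> \<le> \<bar>h\<bar> \<and> dq h f x = f' z"
proof (cases "h > 0")
  case True
  then have "x < x + h" by simp
  from MVT2[OF this d] obtain z where "x < z" "z < x + h" "f (x + h) - f x = (x + h - x) * f' z" by blast
  then show ?thesis using True by (intro exI[of _ z]) (auto simp: dq_def field_simps)
next
  case False
  then have "x + h < x" using h by simp
  from MVT2[OF this d] obtain z where z: "x + h < z" "z < x" "f x - f (x + h) = (x - (x + h)) * f' z" by blast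
  then have "f (x + h) - f x = h * f' z" by simp
  then show ?thesis using h z False by (intro exI[of _ z]) (auto simp: dq_def)
qed

lemma lipschitz_of_derivative_bound:
  fixes f :: "real \<Rightarrow> real"
  assumes d: "\<And>x. (f has_real_derivative f' x) (at x)" and b: "\<And>x. \<bar>f' x\<bar> \<le> L"
  shows "\<bar>f x - f y\<bar> \<le> L * \<bar>x - y\<bar>"
proof -
  have lt: "\<bar>f y - f x\<bar> \<le> L * \<bar>y - x\<bar>" if xy: "x < y" for x y
  proof -
    obtain z where "f y - f x = (y - x) * f' z" using MVT2[OF xy d] by blast
    then show ?thesis using mult_right_mono[OF b[of z], of "\<bar>y - x\<bar>"] by (simp add: abs_mult mult.commute)
  qed
  show ?thesis using lt[of x y] lt[of y x] by (cases x y rule: linorder_cases) (auto simp: abs_minus_commute)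
qed

text \<open>Applying the mean value theorem first to the increment of \<open>P\<close> over a step
  of length \<open>t\<close> leaves an increment of \<open>Q\<close> over a step of the same length,
  so the factor is exactly \<open>t\<^sup>2\<close>.\<close>

lemma second_difference_MVT:
  fixes P Q q :: "real \<Rightarrow> real"
  assumes P: "\<And>x. (P has_real_derivative Q x) (at x)" and Q: "\<And>x. (Q has_real_derivative q x) (at x)"
  shows "\<exists>\<xi>. \<bar>\<xi> - x\<bar> \<le> \<bar>t\<bar> \<and> P (x + t) + P (x - t) - 2 * P x = t\<^sup>2 * q \<xi>"
proof -
  have pos: "\<exists>\<xi>. \<bar>\<xi> - x\<bar> \<le> \<bar>t\<bar> \<and> P (x + t) + P (x - t) - 2 * P x = t\<^sup>2 * q \<xi>" if t: "t > 0" for t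
  proof -
    have "((\<lambda>s. P (x + s) - P (x - t + s)) has_real_derivative (Q (x + s) - Q (x - t + s))) (at s)" for s
      by (auto intro!: derivative_eq_intros DERIV_chain2[OF P])
    from MVT2[OF t this] obtain s where s: "0 < s" "s < t"
      "P (x + t) - P (x - t + t) - (P (x + 0) - P (x - t + 0)) = (t - 0) * (Q (x + s) - Q (x - t + s))"
      by blast
    have "x - t + s < x + s" using t by simp
    from MVT2[OF this Q] obtain \<xi> where xi: "x - t + s < \<xi>" "\<xi> < x + s"
      "Q (x + s) - Q (x - t + s) = (x + s - (x - t + s)) * q \<xi>" by blast
    show ?thesis
      using s xi by (intro exI[of _ \<xi>]) (auto simp: power2_eq_square)
  qed
  consider "t > 0" | "t = 0" | "- t > 0" by linarith
  then show ?thesis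
  proof cases
    case 3
    from pos[OF 3] show ?thesis by (auto simp: algebra_simps)
  qed (use pos in auto)
qed

lemma antiderivative_exists:
  fixes f :: "real \<Rightarrow> real"
  assumes "continuous_on UNIV f"
  shows "\<exists>F. \<forall>x. (F has_real_derivative f x) (at x)"
proof -
  have "\<exists>F. \<forall>x::real. (-\<infinity>::ereal) < x \<longrightarrow> x < (\<infinity>::ereal) \<longrightarrow> (F has_vector_derivative f x) (at x)"
    by (rule einterval_antiderivative) (use assms in \<open>auto simp: continuous_on_eq_continuous_at\<close>)
  then show ?thesis by (simp add: has_real_derivative_iff_has_vector_derivative)
qed

text \<open>The function \<open>\<beta>\<close> is the second difference quotient, with step
  \<open>\<eta>\<close>, of a second antiderivative of \<open>\<phi>\<close>, that is, convolution
  with a hat function. It gains two derivatives with explicit bounds, and each of its values is a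
  value of \<open>\<phi>\<close> nearby, so bounds and limits at infinity carry over at
  once.\<close>

lemma mollifier:
  fixes \<phi> :: "real \<Rightarrow> real"
  assumes c: "continuous_on UNIV \<phi>" and b: "\<And>x. \<bar>\<phi> x\<bar> \<le> B" and eta: "\<eta> > 0"
  obtains \<beta> where "continuous_on UNIV \<beta>" "\<And>x. \<exists>\<xi>. \<bar>\<xi> - x\<bar> \<le> \<eta> \<and> \<beta> x = \<phi> \<xi>"
    "\<And>x t. \<bar>\<beta> (x + t) + \<beta> (x - t) - 2 * \<beta> x\<bar> \<le> 4 * B / \<eta>\<^sup>2 * t\<^sup>2"
    "\<And>x h k. h \<noteq> 0 \<Longrightarrow> k \<noteq> 0 \<Longrightarrow>
\<bar>dq h \<beta> x - dq k \<beta> x\<bar> \<le> 4 * B / \<eta>\<^sup>2 * (\<bar>h\<bar> + \<bar>k\<bar>)"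
proof -
  obtain Q where Q: "\<And>x. (Q has_real_derivative \<phi> x) (at x)" using antiderivative_exists[OF c] by blast
  then have "continuous_on UNIV Q" by (meson DERIV_isCont continuous_at_imp_continuous_on)
  then obtain P where P: "\<And>x. (P has_real_derivative Q x) (at x)" using antiderivative_exists by blast
  define \<beta> where "\<beta> x = (P (x + \<eta>) + P (x - \<eta>) - 2 * P x) / \<eta>\<^sup>2" for x
  define \<beta>1 where "\<beta>1 x = (Q (x + \<eta>) + Q (x - \<eta>) - 2 * Q x) / \<eta>\<^sup>2" for x
  define \<beta>2 where "\<beta>2 x = (\<phi> (x + \<eta>) + \<phi> (x - \<eta>) - 2 * \<phi> x) / \<eta>\<^sup>2" for x
  have d1: "(\<beta> has_real_derivative \<beta>1 x) (at x)" for x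
    unfolding \<beta>_def \<beta>1_def
    by (rule DERIV_cdivide) (auto intro!: derivative_eq_intros DERIV_chain2[OF P])
  have d2: "(\<beta>1 has_real_derivative \<beta>2 x) (at x)" for x
    unfolding \<beta>1_def \<beta>2_def
    by (rule DERIV_cdivide) (auto intro!: derivative_eq_intros DERIV_chain2[OF Q])
  have b2: "\<bar>\<beta>2 x\<bar> \<le> 4 * B / \<eta>\<^sup>2" for x
  proof -
    have "\<bar>\<phi> (x + \<eta>) + \<phi> (x - \<eta>) - 2 * \<phi> x\<bar> \<le> 4 * B" using b[of "x + \<eta>"] b[of "x - \<eta>"] b[of x] by linarith
    then show ?thesis unfolding \<beta>2_def by (simp add: divide_right_mono abs_divide)
  qed
  note L = lipschitz_of_derivative_bound[OF d2 b2]
  show thesis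
  proof
    show "continuous_on UNIV \<beta>" using d1 by (meson DERIV_isCont continuous_at_imp_continuous_on)
    show "\<exists>\<xi>. \<bar>\<xi> - x\<bar> \<le> \<eta> \<and> \<beta> x = \<phi> \<xi>" for x
      using second_difference_MVT[OF P Q, of x \<eta>] eta by (auto simp: \<beta>_def)
    show "\<bar>\<beta> (x + t) + \<beta> (x - t) - 2 * \<beta> x\<bar> \<le> 4 * B / \<eta>\<^sup>2 * t\<^sup>2" for x t
    proof -
      obtain \<xi> where "\<beta> (x + t) + \<beta> (x - t) - 2 * \<beta> x = t\<^sup>2 * \<beta>2 \<xi>"
        using second_difference_MVT[OF d1 d2, of x t] by blast
      then show ?thesis using mult_left_mono[OF b2[of \<xi>], of "t\<^sup>2"] by (simp add: abs_mult mult.commute)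
    qed
    show "\<bar>dq h \<beta> x - dq k \<beta> x\<bar> \<le> 4 * B / \<eta>\<^sup>2 * (\<bar>h\<bar> + \<bar>k\<bar>)"
      if hk: "h \<noteq> 0" "k \<noteq> 0" for x h k
    proof -
      obtain y z where yz: "\<bar>y - x\<bar> \<le> \<bar>h\<bar>" "dq h \<beta> x = \<beta>1 y" "\<bar>z - x\<bar> \<le> \<bar>k\<bar>"
        "dq k \<beta> x = \<beta>1 z" using dq_MVT[OF d1] hk by meson
      have "0 \<le> 4 * B / \<eta>\<^sup>2" using b2[of 0] by linarith
      then have "4 * B / \<eta>\<^sup>2 * \<bar>y - z\<bar> \<le> 4 * B / \<eta>\<^sup>2 * (\<bar>h\<bar> + \<bar>k\<bar>)"
        using yz by (intro mult_left_mono) auto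
      then show ?thesis using L[of y z] yz by simp
    qed
  qed
qed

lemma uniformly_continuous_of_limits:
  fixes u :: "real \<Rightarrow> real"
  assumes c: "continuous_on UNIV u" and t: "(u \<longlongrightarrow> p) at_top" and bt: "(u \<longlongrightarrow> q) at_bot" and e: "e > 0"
  shows "\<exists>d>0. \<forall>x y. \<bar>x - y\<bar> \<le> d \<longrightarrow> \<bar>u x - u y\<bar> \<le> e"
proof -
  obtain M where M: "\<And>x. x \<ge> M \<Longrightarrow> \<bar>u x - p\<bar> < e / 2"
    using tendstoD[OF t, of "e/2"] e by (auto simp: eventually_at_top_linorder dist_real_def)
  obtain N where N: "\<And>x. x \<le> N \<Longrightarrow> \<bar>u x - q\<bar> < e / 2"
    using tendstoD[OF bt, of "e/2"] e by (auto simp: eventually_at_bot_linorder dist_real_def)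
  have "uniformly_continuous_on {N - 1 .. M + 1} u"
    by (rule compact_uniformly_continuous) (use c in \<open>auto intro: continuous_on_subset\<close>)
  then obtain d where d: "d > 0"
     "\<And>x y. x \<in> {N - 1..M + 1} \<Longrightarrow> y \<in> {N - 1..M + 1} \<Longrightarrow> dist y x < d \<Longrightarrow> dist (u y) (u x) < e"
    unfolding uniformly_continuous_on_def using e by meson
  show ?thesis
  proof (intro exI[of _ "min 1 (d / 2)"] conjI allI impI)
    show "min 1 (d / 2) > 0" using d by simp
    fix x y :: real assume xy: "\<bar>x - y\<bar> \<le> min 1 (d / 2)"
    consider "x \<in> {N - 1..M + 1}" "y \<in> {N - 1..M + 1}" | "x \<ge> M" "y \<ge> M" | "x \<le> N" "y \<le> N"
      using xy by fastforce
    then show "\<bar>u x - u y\<bar> \<le> e"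
    proof cases
      case 1
      then have "dist (u x) (u y) < e" using xy d by (intro d(2)) (auto simp: dist_real_def)
      then show ?thesis by (simp add: dist_real_def)
    next
      case 2 then show ?thesis using M[of x] M[of y] by linarith
    next
      case 3 then show ?thesis using N[of x] N[of y] by linarith
    qed
  qed
qed

lemma attains_positive_max:
  fixes d :: "real \<Rightarrow> real"
  assumes c: "continuous_on UNIV d" and t: "(d \<longlongrightarrow> 0) at_top" and bt: "(d \<longlongrightarrow> 0) at_bot" and e: "d x1 > 0"
  shows "\<exists>x0. \<forall>y. d y \<le> d x0"
proof -
  obtain M where M: "\<And>x. x \<ge> M \<Longrightarrow> d x < d x1"
    using order_tendstoD(2)[OF t e] by (auto simp: eventually_at_top_linorder)
  obtain N where N: "\<And>x. x \<le> N \<Longrightarrow> d x < d x1"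
    using order_tendstoD(2)[OF bt e] by (auto simp: eventually_at_bot_linorder)
  have "\<exists>x\<in>{min N x1..max M x1}. \<forall>y\<in>{min N x1..max M x1}. d y \<le> d x"
    by (rule continuous_attains_sup) (use c in \<open>auto intro: continuous_on_subset\<close>)
  then obtain x0 where x0: "\<And>y. y \<in> {min N x1..max M x1} \<Longrightarrow> d y \<le> d x0" by blast
  have "d y \<le> d x0" for y
    using x0[of y] x0[of x1] M[of y] N[of y] by fastforce
  then show ?thesis by blast
qed

section \<open>Continuity and limits at infinity of convolutions\<close>

lemma conv_tendsto_sequentially:
  assumes g: "integrable lborel g" and m: "\<phi> \<in> borel_measurable borel" "\<psi> \<in> borel_measurable borel"
    and b: "\<And>x. \<bar>\<phi> x\<bar> \<le> B" and l: "\<And>y. (\<lambda>n. \<phi> (X n - y)) \<longlonglongrightarrow> \<psi> y"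
  shows "(\<lambda>n. conv g \<phi> (X n)) \<longlonglongrightarrow> (LBINT y. g y * \<psi> y)"
  unfolding conv_def
proof (rule integral_dominated_convergence[where w="\<lambda>y. \<bar>g y\<bar> * B"])
  note [measurable] = m borel_measurable_integrable[OF g, simplified]
  show "(\<lambda>y. g y * \<psi> y) \<in> borel_measurable lborel" "(\<lambda>y. g y * \<phi> (X i - y)) \<in> borel_measurable lborel" for i
    by measurable
  show "AE y in lborel. norm (g y * \<phi> (X i - y)) \<le> \<bar>g y\<bar> * B" for i
    using b by (auto simp: abs_mult intro!: AE_I2 mult_left_mono)
  show "AE y in lborel. (\<lambda>n. g y * \<phi> (X n - y)) \<longlonglongrightarrow> g y * \<psi> y"
    by (auto intro!: AE_I2 tendsto_intros l)
qed (use g in auto)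

lemma conv_continuous:
  assumes g: "integrable lborel g" and c: "continuous_on UNIV \<phi>" and b: "\<And>x. \<bar>\<phi> x\<bar> \<le> B"
  shows "continuous_on UNIV (conv g \<phi>)"
proof -
  have m: "\<phi> \<in> borel_measurable borel" by (rule borel_measurable_continuous_onI[OF c])
  have "isCont (conv g \<phi>) x" for x
    unfolding continuous_at_sequentially o_def
  proof (intro allI impI)
    fix X :: "nat \<Rightarrow> real" assume X: "X \<longlonglongrightarrow> x"
    have "(\<lambda>n. \<phi> (X n - y)) \<longlonglongrightarrow> \<phi> (x - y)" for y
      by (rule isCont_tendsto_compose[of _ \<phi>]) (use c X in \<open>auto simp: continuous_on_eq_continuous_at intro!: tendsto_intros\<close>)
    from conv_tendsto_sequentially[OF g m _ b this] show "(\<lambda>n. conv g \<phi> (X n)) \<longlonglongrightarrow> conv g \<phi> x"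
      using m unfolding conv_def by simp
  qed
  then show ?thesis by (simp add: continuous_on_eq_continuous_at)
qed

lemma conv_tendsto_at_top:
  assumes g: "integrable lborel g" and m: "\<phi> \<in> borel_measurable borel" and b: "\<And>x. \<bar>\<phi> x\<bar> \<le> B"
    and l: "(\<phi> \<longlongrightarrow> p) at_top"
  shows "(conv g \<phi> \<longlongrightarrow> p * integral\<^sup>L lborel g) at_top"
proof (rule tendsto_at_topI_sequentially)
  fix X :: "nat \<Rightarrow> real" assume X: "filterlim X at_top sequentially"
  have "(\<lambda>n. \<phi> (X n - y)) \<longlonglongrightarrow> p" for y
    by (rule filterlim_compose[OF l]) (use filterlim_tendsto_add_at_top[OF tendsto_const[of "-y"] X] in simp)
  from conv_tendsto_sequentially[OF g m _ b this] show "(\<lambda>n. conv g \<phi> (X n)) \<longlonglongrightarrow> p * integral\<^sup>L lborel g"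
    by (simp add: mult.commute)
qed

lemma conv_reflect: "(\<And>x. g (- x) = g x) \<Longrightarrow> conv g \<phi> (- x) = conv g (\<lambda>t. \<phi> (- t)) x"
  unfolding conv_def using integral_reflect[of "\<lambda>y. g y * \<phi> (- x - y)" 0] by (simp add: algebra_simps)

lemma conv_tendsto_at_bot:
  assumes g: "integrable lborel g" "\<And>x. g (- x) = g x" and m: "\<phi> \<in> borel_measurable borel" and b: "\<And>x. \<bar>\<phi> x\<bar> \<le> B"
    and l: "(\<phi> \<longlongrightarrow> p) at_bot"
  shows "(conv g \<phi> \<longlongrightarrow> p * integral\<^sup>L lborel g) at_bot"
  unfolding filterlim_at_bot_mirror conv_reflect[of g \<phi>, OF g(2)]
  by (rule conv_tendsto_at_top[OF g(1) _ b]) (use m l in \<open>auto simp: filterlim_at_bot_mirror\<close>)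

text \<open>The second moment makes the operator finite on functions with quadratically small second
  differences. The condition \<open>singular\<close> says that jumps of length between
  \<open>r / 2\<close> and \<open>r\<close> become arbitrarily frequent as \<open>r\<close> tends to
  0; it prevents concentration of the resolvents.\<close>

locale levy_kernel =
  fixes K :: "real \<Rightarrow> real"
  assumes nonneg: "\<And>x. x \<noteq> 0 \<Longrightarrow> 0 \<le> K x"
    and decreasing: "\<And>x y. x \<noteq> 0 \<Longrightarrow> \<bar>x\<bar> \<le> \<bar>y\<bar> \<Longrightarrow> K y \<le> K x"
    and integrable_tail: "\<And>e. 0 < e \<Longrightarrow> integrable lborel (\<lambda>x. K (max \<bar>x\<bar> e))"
    and second_moment: "integrable lborel (\<lambda>x. x\<^sup>2 * K x * indicator {-1..1} x)"
    and singular: "filterlim (\<lambda>r. r * K r) at_top (at_right 0)"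
begin

text \<open>The kernel is flattened at height \<open>K e\<close> near 0, not cut off to 0: the
  cut-off kernel would no longer be unimodal.\<close>

definition trunc :: "real \<Rightarrow> real \<Rightarrow> real" where
  "trunc e x = K (max \<bar>x\<bar> e)"

text \<open>The error scale for replacing \<open>K\<close> by \<open>trunc e\<close> on a function
  whose second differences are \<open>O(t\<^sup>2)\<close>.\<close>

definition rest :: "real \<Rightarrow> real" where
  "rest e = (LBINT x. x\<^sup>2 * K x * indicator {-e..e} x)"

lemma trunc:
  assumes "0 < e"
  shows "unimodal (trunc e)" "0 \<le> trunc e x" "integrable lborel (trunc e)" "e \<le> \<bar>x\<bar> \<Longrightarrow> trunc e x = K x"
    "x \<noteq> 0 \<Longrightarrow> trunc e x \<le> K x"
proof -
  have even: "K \<bar>x\<bar> = K x" if "x \<noteq> 0" for x using decreasing[of x "\<bar>x\<bar>"] decreasing[of "\<bar>x\<bar>" x] that by auto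
  show "unimodal (trunc e)"
    unfolding unimodal_def trunc_def using assms by (auto intro!: decreasing)
  show "0 \<le> trunc e x" unfolding trunc_def using assms by (intro nonneg) auto
  show "integrable lborel (trunc e)"
    using integrable_tail[OF assms] unfolding trunc_def[abs_def] .
  show "e \<le> \<bar>x\<bar> \<Longrightarrow> trunc e x = K x" using assms even[of x] by (auto simp: trunc_def max_def)
  show "x \<noteq> 0 \<Longrightarrow> trunc e x \<le> K x" unfolding trunc_def using assms by (intro decreasing) auto
qed

lemma trunc_measurable [measurable]: "0 < e \<Longrightarrow> trunc e \<in> borel_measurable borel"
  by (intro unimodal_measurable trunc)

lemma second_moment_integrable:
  assumes "e \<le> 1"
  shows "integrable lborel (\<lambda>x. x\<^sup>2 * K x * indicator {-e..e} x)"
proof -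
  have "integrable lborel (\<lambda>x. (x\<^sup>2 * K x * indicator {-1..1} x) * indicator {-e..e} x)"
    by (rule integrable_mult_bounded[OF second_moment, where B=1]) (auto simp: indicator_def)
  moreover have "(x\<^sup>2 * K x * indicator {-1..1} x) * indicator {-e..e} x = x\<^sup>2 * K x * indicator {-e..e} x" for x
    using assms by (auto simp: indicator_def)
  ultimately show ?thesis by simp
qed

lemma rest_tendsto_0:
  assumes X: "X \<longlonglongrightarrow> 0" and X1: "\<And>n. 0 < X n" "\<And>n. X n \<le> 1"
  shows "(\<lambda>n. rest (X n)) \<longlonglongrightarrow> 0"
proof -
  have "(\<lambda>n. rest (X n)) \<longlonglongrightarrow> (\<integral>x. 0 \<partial>(lborel :: real measure))"
    unfolding rest_def
  proof (rule integral_dominated_convergence[where w="\<lambda>x. x\<^sup>2 * K x * indicator {-1..1} x"])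
    show "(\<lambda>x. x\<^sup>2 * K x * indicator {-X n..X n} x) \<in> borel_measurable lborel" for n
      using second_moment_integrable[OF X1(2)] by auto
    have p: "0 \<le> x\<^sup>2 * K x" for x using nonneg[of x] by (cases "x = 0") auto
    show "AE x in lborel. norm (x\<^sup>2 * K x * indicator {-X n..X n} x) \<le> x\<^sup>2 * K x * indicator {-1..1} x" for n
      using p X1(2)[of n] by (intro AE_I2) (auto simp: indicator_def)
    show "AE x in lborel. (\<lambda>n. x\<^sup>2 * K x * indicator {- X n..X n} x) \<longlonglongrightarrow> 0"
    proof (rule AE_I2)
      fix x :: real
      show "(\<lambda>n. x\<^sup>2 * K x * indicator {- X n..X n} x) \<longlonglongrightarrow> 0"
      proof (cases "x = 0")
        case False
        then have "\<forall>\<^sub>F n in sequentially. X n < \<bar>x\<bar>" using order_tendstoD(2)[OF X, of "\<bar>x\<bar>"] by simp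
        then have "\<forall>\<^sub>F n in sequentially. x\<^sup>2 * K x * indicator {- X n..X n} x = 0"
          by eventually_elim (auto simp: indicator_def)
        then show ?thesis by (rule tendsto_eventually)
      qed simp
    qed
  qed (use second_moment in auto)
  then show ?thesis by simp
qed

text \<open>Touching from above: at a maximum of \<open>u - w\<close> the truncated integrals of \<open>u\<close> dominate those of \<open>w\<close>,
  and the singular part of the latter is controlled by the second differences of \<open>w\<close>.\<close>

lemma has_L_at_max:
  assumes L: "has_L K u x0 l" and e: "0 < e" "e \<le> 1"
    and m: "w \<in> borel_measurable borel" and b: "\<And>x. \<bar>w x\<bar> \<le> W"
    and D: "\<And>t. \<bar>w (x0 + t) + w (x0 - t) - 2 * w x0\<bar> \<le> C * t\<^sup>2"
    and max: "\<And>y. u y - w y \<le> u x0 - w x0"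
  shows "integral\<^sup>L lborel (trunc e) * w x0 - conv (trunc e) w x0 - C * rest e \<le> l"
proof -
  note [measurable] = m trunc_measurable[OF e(1)]
  define E where "E t = 2 * w x0 - w (x0 + t) - w (x0 - t)" for t
  have E: "\<bar>E t\<bar> \<le> C * t\<^sup>2" for t unfolding E_def using D[of t] by linarith
  have C0: "0 \<le> C" using E[of 1] by simp
  have p: "0 \<le> x\<^sup>2 * K x" for x using nonneg[of x] by (cases "x = 0") auto
  have rest0: "0 \<le> rest e" unfolding rest_def using p by (intro integral_nonneg_AE AE_I2) (auto simp: indicator_def)
  have Em [measurable]: "E \<in> borel_measurable borel" unfolding E_def[abs_def] by measurable
  have Eb: "\<bar>E t\<bar> \<le> 4 * W" for t unfolding E_def using b[of x0] b[of "x0 + t"] b[of "x0 - t"] by linarith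
  define A where "A = integral\<^sup>L lborel (trunc e) * w x0 - conv (trunc e) w x0"
  \<comment> \<open>For an even kernel the first difference may be averaged over \<open>t\<close>
    and \<open>- t\<close>. This produces the second difference, which is quadratically small at the
    singularity.\<close>
  have half: "(LBINT t. k t * (w x0 - w (x0 - t))) = (LBINT t. k t * E t) / 2"
    if k: "integrable lborel k" and ke: "\<And>t. k (- t) = k t" for k :: "real \<Rightarrow> real"
  proof -
    have wb: "\<bar>w x0 - w (x0 - t)\<bar> \<le> 2 * W" "\<bar>w x0 - w (x0 + t)\<bar> \<le> 2 * W" for t
      using b[of x0] b[of "x0 - t"] b[of "x0 + t"] by linarith+
    have i: "integrable lborel (\<lambda>t. k t * (w x0 - w (x0 - t)))" "integrable lborel (\<lambda>t. k t * (w x0 - w (x0 + t)))"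
      by (rule integrable_mult_bounded[OF k, where B="2*W"]; use wb in simp)+
    have "(LBINT t. k t * (w x0 - w (x0 - t))) = (LBINT t. k t * (w x0 - w (x0 + t)))"
      using integral_reflect[of "\<lambda>t. k t * (w x0 - w (x0 - t))" 0] ke by simp
    moreover have "(LBINT t. k t * E t) = (LBINT t. k t * (w x0 - w (x0 - t))) + (LBINT t. k t * (w x0 - w (x0 + t)))"
      unfolding Bochner_Integration.integral_add[OF i, symmetric] E_def by (simp add: algebra_simps)
    ultimately show ?thesis by simp
  qed
  have Tint: "integrable lborel (trunc e)" by (rule trunc(3)[OF e(1)])
  have A_eq: "A = (LBINT t. trunc e t * E t) / 2"
  proof -
    have "A = (LBINT t. trunc e t * (w x0 - w (x0 - t)))"
      unfolding A_def conv_def right_diff_distrib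
      using conv_integrable_integrand[OF Tint m b, of x0] Tint by simp
    also have "\<dots> = (LBINT t. trunc e t * E t) / 2"
      by (rule half[OF Tint unimodal_even[OF trunc(1)[OF e(1)]]])
    finally show ?thesis .
  qed
  \<comment> \<open>For \<open>w\<close>, the kernel \<open>trunc e\<close> is exchanged for
    \<open>K\<close> cut off at \<open>d\<close>. The two agree beyond \<open>e\<close>, and within
    \<open>e\<close> both lie between 0 and \<open>K\<close>, so the exchange costs at most a
    multiple of \<open>rest e\<close>. Only then is \<open>w\<close> replaced by \<open>u\<close>,
    using the maximum at \<open>x0\<close>.\<close>
  have "A - C * rest e \<le> set_lebesgue_integral lborel {y. d < \<bar>x0 - y\<bar>} (\<lambda>y. (u x0 - u y) * K (x0 - y))"
    if d: "0 < d" "d < e" for d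
  proof -
    define kd where "kd t = indicator {t. d < \<bar>t\<bar>} t * trunc d t" for t :: real
    have kdK: "kd t = indicator {t. d < \<bar>t\<bar>} t * K t" for t
      unfolding kd_def using trunc(4)[OF d(1), of t] by (auto simp: indicator_def)
    have kdi: "integrable lborel kd"
      unfolding kd_def[abs_def] using integrable_mult_bounded[OF trunc(3)[OF d(1)], of "indicator {t. d < \<bar>t\<bar>}" 1]
      by (simp add: mult.commute indicator_def)
    have kde: "kd (- t) = kd t" for t unfolding kd_def using unimodal_even[OF trunc(1)[OF d(1)]] by (simp add: indicator_def)
    have kd0: "0 \<le> kd t" for t unfolding kd_def using trunc(2)[OF d(1)] by (simp add: indicator_def)
    have "A - C * rest e \<le> (LBINT t. kd t * E t) / 2"
    proof -
      have iT: "integrable lborel (\<lambda>t. trunc e t * E t)" and ik: "integrable lborel (\<lambda>t. kd t * E t)"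
        using integrable_mult_bounded[OF Tint _ Eb] integrable_mult_bounded[OF kdi _ Eb] by simp_all
      have "(LBINT t. trunc e t * E t) - (LBINT t. kd t * E t) = (LBINT t. trunc e t * E t - kd t * E t)"
        by (rule Bochner_Integration.integral_diff[OF iT ik, symmetric])
      also have "\<dots> \<le> (LBINT t. C * (t\<^sup>2 * K t * indicator {-e..e} t))"
      proof (rule integral_mono)
        show "integrable lborel (\<lambda>t. C * (t\<^sup>2 * K t * indicator {-e..e} t))"
          using second_moment_integrable[OF e(2)] by simp
        fix t
        show "trunc e t * E t - kd t * E t \<le> C * (t\<^sup>2 * K t * indicator {-e..e} t)"
        proof (cases "t = 0")
          case True then show ?thesis using E[of 0] by simp
        next
          case t: False
          show ?thesis
          proof (cases "\<bar>t\<bar> \<le> e")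
            case True
            have "0 \<le> trunc e t" "trunc e t \<le> K t" using trunc[OF e(1)] t by auto
            moreover have "0 \<le> kd t" "kd t \<le> K t" using kd0 kdK[of t] nonneg[OF t] by (auto simp: indicator_def)
            ultimately have "\<bar>trunc e t - kd t\<bar> \<le> K t" by linarith
            then have "\<bar>trunc e t - kd t\<bar> * \<bar>E t\<bar> \<le> K t * (C * t\<^sup>2)"
              using E[of t] by (intro mult_mono) (auto intro: nonneg t)
            then have "(trunc e t - kd t) * E t \<le> K t * (C * t\<^sup>2)"
              by (metis abs_ge_self abs_mult order_trans)
            then show ?thesis using True by (simp add: algebra_simps indicator_def abs_le_iff)
          next
            case False
            then have "trunc e t = kd t" using trunc(4)[OF e(1), of t] kdK[of t] d by (auto simp: indicator_def)
            then show ?thesis using False by (auto simp: indicator_def)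
          qed
        qed
      qed (use iT ik in auto)
      also have "\<dots> = C * rest e" unfolding rest_def by simp
      finally have "(LBINT t. trunc e t * E t) - C * rest e \<le> (LBINT t. kd t * E t)" by simp
      moreover have "0 \<le> C * rest e" using C0 rest0 by simp
      ultimately show ?thesis unfolding A_eq by (simp add: field_simps)
    qed
    also have "\<dots> = (LBINT t. kd t * (w x0 - w (x0 - t)))"
      by (rule half[OF kdi kde, symmetric])
    also have "\<dots> \<le> (LBINT t. indicator {t. d < \<bar>t\<bar>} t * ((u x0 - u (x0 - t)) * K t))"
    proof (rule integral_mono)
      show "integrable lborel (\<lambda>t. kd t * (w x0 - w (x0 - t)))"
      proof (rule integrable_mult_bounded[OF kdi])
        show "\<bar>w x0 - w (x0 - t)\<bar> \<le> 2 * W" for t using b[of x0] b[of "x0 - t"] by linarith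
      qed measurable
      have "integrable lborel (\<lambda>y. indicator {y. d < \<bar>x0 - y\<bar>} y * ((u x0 - u y) * K (x0 - y)))"
        using L d unfolding has_L_def set_integrable_def by auto
      then have "integrable lborel (\<lambda>t. indicator {y. d < \<bar>x0 - y\<bar>} (x0 - t) * ((u x0 - u (x0 - t)) * K (x0 - (x0 - t))))"
        unfolding integrable_reflect[of "\<lambda>y. indicator {y. d < \<bar>x0 - y\<bar>} y * ((u x0 - u y) * K (x0 - y))" x0] .
      then show "integrable lborel (\<lambda>t. indicator {t. d < \<bar>t\<bar>} t * ((u x0 - u (x0 - t)) * K t))"
        by (simp add: indicator_def)
      fix t
      show "kd t * (w x0 - w (x0 - t)) \<le> indicator {t. d < \<bar>t\<bar>} t * ((u x0 - u (x0 - t)) * K t)"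
        using mult_left_mono[of "w x0 - w (x0 - t)" "u x0 - u (x0 - t)" "kd t"] max[of "x0 - t"] kd0[of t] kdK[of t]
        by (simp add: algebra_simps)
    qed
    also have "\<dots> = set_lebesgue_integral lborel {y. d < \<bar>x0 - y\<bar>} (\<lambda>y. (u x0 - u y) * K (x0 - y))"
      unfolding set_lebesgue_integral_def
      using integral_reflect[of "\<lambda>y. indicator {y. d < \<bar>x0 - y\<bar>} y * ((u x0 - u y) * K (x0 - y))" x0]
      by (simp add: indicator_def)
    finally show ?thesis .
  qed
  then have "A - C * rest e \<le> l"
    using L e unfolding has_L_def
    by (intro tendsto_lowerbound[of _ l "at_right 0"]) (auto intro!: eventually_at_rightI[of 0 e])
  then show ?thesis by (simp add: A_def)
qed

end

section \<open>Comparison of a pointwise solution with the truncated resolvents\<close>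

context levy_kernel
begin

lemma rest_nonneg: "0 \<le> rest e"
proof -
  have p: "0 \<le> x\<^sup>2 * K x" for x using nonneg[of x] by (cases "x = 0") auto
  then show ?thesis unfolding rest_def by (intro integral_nonneg_AE AE_I2) (auto simp: indicator_def)
qed

text \<open>The resolvent image \<open>w\<close> of \<open>\<beta>\<close> has the same limits at
  infinity as \<open>u\<close>, because the resolvent has mass \<open>1 / \<mu>\<close>; a positive
  value of \<open>u - w\<close> therefore forces a maximum. There the touching lemma compares the
  equation of \<open>u\<close> with the resolvent equation of \<open>w\<close>. The function
  \<open>\<beta>\<close> stands for a smoothed \<open>\<psi>\<close>, since \<open>w\<close>
  inherits its second differences from it.\<close>

lemma resolvent_comparison:
  assumes mu: "0 < \<mu>" and e: "0 < e" "e \<le> 1" and res: "jump_resolvent (trunc e) \<mu> g a"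
    and u: "continuous_on UNIV u" "(u \<longlongrightarrow> p) at_top" "(u \<longlongrightarrow> q) at_bot"
    and \<beta>: "continuous_on UNIV \<beta>" "(\<beta> \<longlongrightarrow> \<mu> * p) at_top" "(\<beta> \<longlongrightarrow> \<mu> * q) at_bot" "\<And>x. \<bar>\<beta> x\<bar> \<le> B"
    and D: "\<And>x t. \<bar>\<beta> (x + t) + \<beta> (x - t) - 2 * \<beta> x\<bar> \<le> C * t\<^sup>2"
    and L: "\<And>x. has_L K u x (\<psi> x - \<mu> * u x)"
    and le: "\<And>x. \<psi> x \<le> \<beta> x + \<epsilon>" and eps: "0 \<le> \<epsilon>"
  shows "u x - (a * \<beta> x + conv g \<beta> x) \<le> (\<epsilon> + C / \<mu> * rest e) / \<mu>"
proof -
  define w where "w = (\<lambda>x. a * \<beta> x + conv g \<beta> x)"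
  note T = trunc(1,2,3)[OF e(1)]
  note R = jump_resolvent_simps[OF T mu res]
  have bm [measurable]: "\<beta> \<in> borel_measurable borel" by (rule borel_measurable_continuous_onI[OF \<beta>(1)])
  have C0: "0 \<le> C" using D[of 0 1] by simp
  have wc: "continuous_on UNIV w" unfolding w_def
    by (intro continuous_intros \<beta>(1) conv_continuous[OF R(3) \<beta>(1,4)])
  have ge: "g (- x) = g x" for x by (rule unimodal_even[OF R(1)])
  have lim: "a * (\<mu> * p) + \<mu> * p * integral\<^sup>L lborel g = p" for p
    unfolding R(6) using mu by (simp add: field_simps)
  have wt: "(w \<longlongrightarrow> p) at_top"
    using tendsto_add[OF tendsto_mult[OF tendsto_const[of a] \<beta>(2)] conv_tendsto_at_top[OF R(3) bm \<beta>(4,2)]]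
    unfolding w_def lim .
  have wb: "(w \<longlongrightarrow> q) at_bot"
    using tendsto_add[OF tendsto_mult[OF tendsto_const[of a] \<beta>(3)] conv_tendsto_at_bot[OF R(3) ge bm \<beta>(4,3)]]
    unfolding w_def lim .
  have W: "\<bar>w x\<bar> \<le> B / \<mu>" for x
    unfolding w_def by (rule jump_resolvent_bound[OF T mu res bm \<beta>(4)])
  have wm: "w \<in> borel_measurable borel" by (rule borel_measurable_continuous_onI[OF wc])
  \<comment> \<open>Second differences commute with the resolvent, so the bound for
    \<open>\<beta>\<close> passes to \<open>w\<close> with the factor
    \<open>1 / \<mu>\<close>.\<close>
  have wD: "\<bar>w (x + t) + w (x - t) - 2 * w x\<bar> \<le> C / \<mu> * t\<^sup>2" for x t
  proof -
    define \<beta>' where "\<beta>' x = \<beta> (x + t) + \<beta> (x - t) - 2 * \<beta> x" for x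
    have m': "\<beta>' \<in> borel_measurable borel" unfolding \<beta>'_def[abs_def] by measurable
    have b': "\<bar>\<beta>' x\<bar> \<le> C * t\<^sup>2" for x using D by (simp add: \<beta>'_def)
    have bb: "\<bar>\<beta> (x + s)\<bar> \<le> B" "\<bar>\<beta> (x - t)\<bar> \<le> B" "\<bar>\<beta> (x + t) + \<beta> (x - t)\<bar> \<le> 2 * B" "\<bar>2 * \<beta> x\<bar> \<le> 2 * B" for x s
      using \<beta>(4)[of "x + s"] \<beta>(4)[of "x + t"] \<beta>(4)[of "x - t"] \<beta>(4)[of x] by linarith+
    have "conv g \<beta>' x = conv g (\<lambda>x. \<beta> (x + t) + \<beta> (x - t)) x - conv g (\<lambda>x. 2 * \<beta> x) x"
      unfolding \<beta>'_def by (rule conv_diff[OF R(3) _ _ bb(3,4)]) measurable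
    also have "conv g (\<lambda>x. \<beta> (x + t) + \<beta> (x - t)) x = conv g (\<lambda>x. \<beta> (x + t)) x + conv g (\<lambda>x. \<beta> (x - t)) x"
      by (rule conv_add[OF R(3) _ _ bb(1,2)]) measurable
    finally have "conv g \<beta>' x = conv g \<beta> (x + t) + conv g \<beta> (x - t) - 2 * conv g \<beta> x"
      using conv_translate[of g \<beta> t x] conv_translate[of g \<beta> "-t" x] by (simp add: conv_cmult)
    then have "w (x + t) + w (x - t) - 2 * w x = a * \<beta>' x + conv g \<beta>' x"
      unfolding w_def \<beta>'_def by (simp add: algebra_simps)
    then show ?thesis using jump_resolvent_bound[OF T mu res m' b', of x] by (simp add: divide_simps)
  qed
  have rhs0: "0 \<le> (\<epsilon> + C / \<mu> * rest e) / \<mu>" using eps C0 mu rest_nonneg by simp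
  show ?thesis
  proof (rule ccontr)
    assume "\<not> ?thesis"
    then have "u x - w x > (\<epsilon> + C / \<mu> * rest e) / \<mu>" by (simp add: w_def)
    then have big: "u x - w x > (\<epsilon> + C / \<mu> * rest e) / \<mu>" and pos: "u x - w x > 0" using rhs0 by linarith+
    have "\<exists>x0. \<forall>y. u y - w y \<le> u x0 - w x0"
    proof (rule attains_positive_max)
      show "continuous_on UNIV (\<lambda>x. u x - w x)" by (intro continuous_on_diff u wc)
      show "((\<lambda>x. u x - w x) \<longlongrightarrow> 0) at_top" using tendsto_diff[OF u(2) wt] by simp
      show "((\<lambda>x. u x - w x) \<longlongrightarrow> 0) at_bot" using tendsto_diff[OF u(3) wb] by simp
    qed (rule pos)
    then obtain x0 where x0: "\<And>y. u y - w y \<le> u x0 - w x0" by blast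
    have "integral\<^sup>L lborel (trunc e) * w x0 - conv (trunc e) w x0 - C / \<mu> * rest e \<le> \<psi> x0 - \<mu> * u x0"
      by (rule has_L_at_max[OF L e wm W wD x0])
    moreover have "(integral\<^sup>L lborel (trunc e) + \<mu>) * w x0 - conv (trunc e) w x0 = \<beta> x0"
      unfolding w_def by (rule jump_resolvent_equation[OF T mu res bm \<beta>(4)])
    ultimately have "\<mu> * (u x0 - w x0) \<le> \<epsilon> + C / \<mu> * rest e"
      using le[of x0] by (simp add: algebra_simps)
    then have "u x0 - w x0 \<le> (\<epsilon> + C / \<mu> * rest e) / \<mu>" using mu by (simp add: field_simps)
    then show False using big x0[of x] by linarith
  qed
qed

lemma has_L_uminus: "has_L K u x l \<Longrightarrow> has_L K (\<lambda>x. - u x) x (- l)"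
proof -
  assume L: "has_L K u x l"
  have eq: "(- u x - - u y) * K (x - y) = - ((u x - u y) * K (x - y))" for y by (simp add: algebra_simps)
  have "set_integrable lborel A (\<lambda>y. - f y) \<longleftrightarrow> set_integrable lborel A f" for A and f :: "real \<Rightarrow> real"
    unfolding set_integrable_def by simp
  moreover have "set_lebesgue_integral lborel A (\<lambda>y. - f y) = - set_lebesgue_integral lborel A f" for A and f :: "real \<Rightarrow> real"
    unfolding set_lebesgue_integral_def by simp
  ultimately show ?thesis using L unfolding has_L_def eq by (auto intro: tendsto_minus)
qed

text \<open>Comparison with a mollification of \<open>\<phi>\<close>, applied to \<open>u\<close>
  and to \<open>- u\<close>, gives both bounds. The constant \<open>C\<close> blows up with the
  mollification scale, hence depends on \<open>\<epsilon>\<close>, but not on \<open>e\<close>; so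
  \<open>e\<close> can tend to 0 first.\<close>

lemma resolvent_approximation:
  assumes mu: "0 < \<mu>" and eps: "0 < \<epsilon>"
    and u: "continuous_on UNIV u" "(u \<longlongrightarrow> p) at_top" "(u \<longlongrightarrow> q) at_bot"
    and \<phi>: "continuous_on UNIV \<phi>" "(\<phi> \<longlongrightarrow> \<mu> * p) at_top" "(\<phi> \<longlongrightarrow> \<mu> * q) at_bot" "\<And>x. \<bar>\<phi> x\<bar> \<le> B"
    and L: "\<And>x. has_L K u x (\<phi> x - \<mu> * u x)"
  shows "\<exists>C\<ge>0. \<forall>e g a x. 0 < e \<longrightarrow> e \<le> 1 \<longrightarrow> jump_resolvent (trunc e) \<mu> g a \<longrightarrow>
     \<bar>u x - (a * \<phi> x + conv g \<phi> x)\<bar> \<le> \<epsilon> + C * rest e"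
proof -
  \<comment> \<open>The mollification error is paid twice, in the comparison and in returning from
    \<open>\<beta>\<close> to \<open>\<phi>\<close>; each time it costs
    \<open>\<epsilon>1 / \<mu> = \<epsilon> / 2\<close>.\<close>
  define \<epsilon>1 where "\<epsilon>1 = \<epsilon> * \<mu> / 2"
  have e1: "0 < \<epsilon>1" unfolding \<epsilon>1_def using mu eps by simp
  obtain d where d: "d > 0" "\<And>x y. \<bar>x - y\<bar> \<le> d \<Longrightarrow> \<bar>\<phi> x - \<phi> y\<bar> \<le> \<epsilon>1"
    using uniformly_continuous_of_limits[OF \<phi>(1-3) e1] by blast
  obtain \<beta> where b: "continuous_on UNIV \<beta>" "\<And>x. \<exists>\<xi>. \<bar>\<xi> - x\<bar> \<le> d \<and> \<beta> x = \<phi> \<xi>"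
    "\<And>x t. \<bar>\<beta> (x + t) + \<beta> (x - t) - 2 * \<beta> x\<bar> \<le> 4 * B / d\<^sup>2 * t\<^sup>2"
    by (rule mollifier[OF \<phi>(1,4) d(1)]) (rule that)
  define C where "C = 4 * B / d\<^sup>2"
  have C0: "0 \<le> C" unfolding C_def using \<phi>(4)[of 0] by simp
  have bB: "\<bar>\<beta> x\<bar> \<le> B" for x using b(2)[of x] \<phi>(4) by metis
  have close: "\<bar>\<phi> x - \<beta> x\<bar> \<le> \<epsilon>1" for x
  proof -
    obtain \<xi> where "\<bar>\<xi> - x\<bar> \<le> d" "\<beta> x = \<phi> \<xi>" using b(2) by blast
    then show ?thesis using d(2)[of x \<xi>] by (simp add: abs_minus_commute)
  qed
  have bt: "(\<beta> \<longlongrightarrow> \<mu> * p) at_top"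
  proof (rule tendstoI)
    fix r :: real assume "r > 0"
    then obtain N where N: "\<And>x. x \<ge> N \<Longrightarrow> dist (\<phi> x) (\<mu> * p) < r"
      using tendstoD[OF \<phi>(2)] by (auto simp: eventually_at_top_linorder)
    have "dist (\<beta> x) (\<mu> * p) < r" if "x \<ge> N + d" for x
    proof -
      obtain \<xi> where "\<bar>\<xi> - x\<bar> \<le> d" "\<beta> x = \<phi> \<xi>" using b(2) by blast
      then show ?thesis using N[of \<xi>] that by auto
    qed
    then show "\<forall>\<^sub>F x in at_top. dist (\<beta> x) (\<mu> * p) < r" by (auto simp: eventually_at_top_linorder)
  qed
  have bb: "(\<beta> \<longlongrightarrow> \<mu> * q) at_bot"
  proof (rule tendstoI)
    fix r :: real assume "r > 0"
    then obtain N where N: "\<And>x. x \<le> N \<Longrightarrow> dist (\<phi> x) (\<mu> * q) < r"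
      using tendstoD[OF \<phi>(3)] by (auto simp: eventually_at_bot_linorder)
    have "dist (\<beta> x) (\<mu> * q) < r" if "x \<le> N - d" for x
    proof -
      obtain \<xi> where "\<bar>\<xi> - x\<bar> \<le> d" "\<beta> x = \<phi> \<xi>" using b(2) by blast
      then show ?thesis using N[of \<xi>] that by auto
    qed
    then show "\<forall>\<^sub>F x in at_bot. dist (\<beta> x) (\<mu> * q) < r" by (auto simp: eventually_at_bot_linorder)
  qed
  have bm: "\<beta> \<in> borel_measurable borel" and pm: "\<phi> \<in> borel_measurable borel"
    using b(1) \<phi>(1) by (auto intro: borel_measurable_continuous_onI)
  have "\<bar>u x - (a * \<phi> x + conv g \<phi> x)\<bar> \<le> \<epsilon> + C / \<mu> / \<mu> * rest e"
    if e: "0 < e" "e \<le> 1" and res: "jump_resolvent (trunc e) \<mu> g a" for e g a x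
  proof -
    note T = trunc(1,2,3)[OF e(1)]
    note R = jump_resolvent_simps[OF T mu res]
    have up: "u x - (a * \<beta> x + conv g \<beta> x) \<le> (\<epsilon>1 + C / \<mu> * rest e) / \<mu>"
    proof (rule resolvent_comparison[OF mu e res u b(1) bt bb bB _ L])
      show "\<phi> x \<le> \<beta> x + \<epsilon>1" for x using close[of x] by linarith
      show "\<bar>\<beta> (x + t) + \<beta> (x - t) - 2 * \<beta> x\<bar> \<le> C * t\<^sup>2" for x t
        using b(3) unfolding C_def .
    qed (use e1 in simp)
    have "- u x - (a * - \<beta> x + conv g (\<lambda>x. - \<beta> x) x) \<le> (\<epsilon>1 + C / \<mu> * rest e) / \<mu>"
    proof (rule resolvent_comparison[OF mu e res, where \<psi>="\<lambda>x. - \<phi> x" and p="-p" and q="-q"])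
      show "has_L K (\<lambda>x. - u x) x (- \<phi> x - \<mu> * - u x)" for x
        using has_L_uminus[OF L[of x]] by simp
      show "- \<phi> x \<le> - \<beta> x + \<epsilon>1" for x using close[of x] by linarith
      show "\<bar>- \<beta> (x + t) + - \<beta> (x - t) - 2 * - \<beta> x\<bar> \<le> C * t\<^sup>2" for x t
        using b(3)[of x t] unfolding C_def by linarith
      show "\<bar>- \<beta> x\<bar> \<le> B" for x using bB by simp
      show "continuous_on UNIV (\<lambda>x. - u x)" "continuous_on UNIV (\<lambda>x. - \<beta> x)"
        by (intro continuous_on_minus u b(1))+
      show "((\<lambda>x. - u x) \<longlongrightarrow> - p) at_top" "((\<lambda>x. - u x) \<longlongrightarrow> - q) at_bot"
        by (intro tendsto_minus u)+
      show "((\<lambda>x. - \<beta> x) \<longlongrightarrow> \<mu> * - p) at_top" "((\<lambda>x. - \<beta> x) \<longlongrightarrow> \<mu> * - q) at_bot"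
        using tendsto_minus[OF bt] tendsto_minus[OF bb] by simp_all
    qed (use e1 in simp)
    then have lo: "(a * \<beta> x + conv g \<beta> x) - u x \<le> (\<epsilon>1 + C / \<mu> * rest e) / \<mu>"
      by (simp add: conv_uminus)
    have dm: "(\<lambda>x. \<phi> x - \<beta> x) \<in> borel_measurable borel" using bm pm by measurable
    have "\<bar>a * (\<phi> x - \<beta> x) + conv g (\<lambda>x. \<phi> x - \<beta> x) x\<bar> \<le> \<epsilon>1 / \<mu>"
      by (rule jump_resolvent_bound[OF T mu res dm close])
    then have "\<bar>(a * \<phi> x + conv g \<phi> x) - (a * \<beta> x + conv g \<beta> x)\<bar> \<le> \<epsilon>1 / \<mu>"
      unfolding conv_diff[OF R(3) pm bm \<phi>(4) bB] by (simp add: algebra_simps)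
    moreover have "(\<epsilon>1 + C / \<mu> * rest e) / \<mu> + \<epsilon>1 / \<mu> = \<epsilon> + C / \<mu> / \<mu> * rest e"
      unfolding \<epsilon>1_def using mu by (simp add: field_simps)
    ultimately show ?thesis using up lo by linarith
  qed
  moreover have "0 \<le> C / \<mu> / \<mu>" using C0 mu by simp
  ultimately show ?thesis by (intro exI[of _ "C / \<mu> / \<mu>"]) simp
qed

text \<open>A scale \<open>s\<close> with \<open>s * K s\<close> at least
  \<open>4 / \<epsilon>\<close> gives total jump rate at least \<open>2 / \<epsilon>\<close> between
  \<open>s / 2\<close> and \<open>s\<close>, for every truncation level up to \<open>s\<close>. The
  concentration estimate then yields \<open>\<epsilon> / 2\<close> from the rate and, by the choice
  of \<open>\<delta>\<close>, \<open>\<epsilon> / 2\<close> from the interval, uniformly in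
  \<open>e\<close>.\<close>

lemma resolvent_no_concentration:
  assumes mu: "0 < \<mu>" and eps: "0 < \<epsilon>"
  shows "\<exists>\<delta>>0. \<exists>e0>0. \<forall>e g a. 0 < e \<longrightarrow> e \<le> e0 \<longrightarrow> jump_resolvent (trunc e) \<mu> g a \<longrightarrow>
      a + (LBINT y. g y * indicator {-\<delta>..\<delta>} y) \<le> \<epsilon>"
proof -
  have "\<forall>\<^sub>F r in at_right 0. 4 / \<epsilon> \<le> r * K r"
    using singular by (auto simp: filterlim_at_top)
  moreover have "\<forall>\<^sub>F r in at_right (0::real). 0 < r" by (auto simp: eventually_at_right_less)
  ultimately have "\<forall>\<^sub>F r in at_right 0. 4 / \<epsilon> \<le> r * K r \<and> 0 < r" by eventually_elim auto
  then obtain s where s: "4 / \<epsilon> \<le> s * K s" "0 < s"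
    using eventually_happens'[OF trivial_limit_at_right_real] by blast
  define r where "r = s / 2"
  have r: "0 < r" "s = 2 * r" using s(2) by (auto simp: r_def)
  define \<delta> where "\<delta> = \<epsilon> * \<mu> * r / 2"
  have "a + (LBINT y. g y * indicator {-\<delta>..\<delta>} y) \<le> \<epsilon>"
    if e: "0 < e" "e \<le> s" and res: "jump_resolvent (trunc e) \<mu> g a" for e g a
  proof -
    note T = trunc(1,2,3)[OF e(1)]
    have d0: "0 \<le> \<delta>" unfolding \<delta>_def using eps mu r by simp
    have i: "integrable lborel (\<lambda>y. trunc e y * indicator {y. r < \<bar>y\<bar>} y)"
      by (rule integrable_mult_bounded[OF T(3), where B=1]) (auto simp: indicator_def)
    have "2 / \<epsilon> \<le> K s * r" using s r by (simp add: field_simps)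
    also have "\<dots> = (LBINT y. K s * indicator {r<..s} y)" using r by simp
    also have "\<dots> \<le> (LBINT y. trunc e y * indicator {y. r < \<bar>y\<bar>} y)"
    proof (rule integral_mono[OF _ i])
      show "integrable lborel (\<lambda>y. K s * indicator {r<..s} y)"
        using r by (intro integrable_mult_right integrable_real_indicator) auto
      show "K s * indicator {r<..s} y \<le> trunc e y * indicator {y. r < \<bar>y\<bar>} y" for y
        using T(2)[of y] r e decreasing[of "max \<bar>y\<bar> e" s] by (auto simp: indicator_def trunc_def)
    qed
    finally have kap: "2 / \<epsilon> \<le> (LBINT y. trunc e y * indicator {y. r < \<bar>y\<bar>} y)" .
    have "a + (LBINT y. g y * indicator {-\<delta>..\<delta>} y) \<le> \<delta> / (\<mu> * r) + 1 / (2 / \<epsilon>)"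
      by (rule jump_resolvent_concentration[OF T mu res d0 r(1) _ kap]) (use eps in simp)
    also have "\<dots> = \<epsilon>" unfolding \<delta>_def using eps mu r by (simp add: field_simps)
    finally show ?thesis .
  qed
  moreover have "0 < \<delta>" unfolding \<delta>_def using eps mu r by simp
  ultimately show ?thesis using s(2) by blast
qed

end

section \<open>The Green function\<close>

text \<open>Helly's theorem is applied to the right limits \<open>h n\<close>, which are
  right-continuous. Since \<open>h n y \<le> f n x \<le> h n x\<close> for \<open>y < x\<close>,
  convergence at continuity points of the limit passes back to \<open>f n\<close>.\<close>

lemma Helly_selection_mono:
  fixes f :: "nat \<Rightarrow> real \<Rightarrow> real"
  assumes mono: "\<And>n. mono (f n)" and bdd: "\<And>n x. \<bar>f n x\<bar> \<le> M"
  shows "\<exists>s F. strict_mono (s :: nat \<Rightarrow> nat) \<and> mono F \<and> (\<forall>x. isCont F x \<longrightarrow> (\<lambda>n. f (s n) x) \<longlonglongrightarrow> F x)"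
proof -
  define h where "h n x = Inf (f n ` {x<..})" for n x
  have bb: "bdd_below (f n ` {x<..})" for n x
    using bdd[of n] by (intro bdd_belowI[of _ "- M"]) (auto simp: abs_le_iff minus_le_iff)
  have hle: "h n x \<le> f n y" if "x < y" for n x y
    unfolding h_def using that bb by (intro cInf_lower) auto
  have fle: "f n x \<le> h n x" for n x
    unfolding h_def using monoD[OF mono] by (intro cInf_greatest) auto
  have hmono: "mono (h n)" for n
  proof (rule monoI)
    fix x y :: real assume "x \<le> y"
    then show "h n x \<le> h n y"
      using hle[of x y n] fle[of n y] by (cases "x = y") auto
  qed
  have hb: "\<bar>h n x\<bar> \<le> M" for n x
    using hle[of x "x + 1" n] fle[of n x] bdd[of n x] bdd[of n "x + 1"] by auto
  have rc: "continuous (at_right x) (h n)" for n x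
  proof -
    have "\<forall>e>0. \<exists>d>0. h n (x + d) - h n x < e"
    proof (intro allI impI)
      fix e :: real assume "e > 0"
      then have "\<exists>y\<in>f n ` {x<..}. y < h n x + e"
        unfolding h_def by (intro cInf_lessD) auto
      then obtain y where y: "x < y" "f n y < h n x + e" by auto
      have "h n (x + (y - x) / 2) \<le> f n y" using y by (intro hle) (auto simp: field_simps)
      then show "\<exists>d>0. h n (x + d) - h n x < e"
        using y by (intro exI[of _ "(y - x) / 2"]) auto
    qed
    then show ?thesis
      by (subst continuous_at_right_real_increasing) (use hmono in \<open>auto simp: mono_def\<close>)
  qed
  obtain s F where s: "strict_mono s" and F: "mono F"
    and c: "\<And>x. isCont F x \<Longrightarrow> (\<lambda>n. h (s n) x) \<longlonglongrightarrow> F x"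
    using Helly_selection[of h M, OF rc hmono hb] by blast
  have "(\<lambda>n. f (s n) x) \<longlonglongrightarrow> F x" if x: "isCont F x" for x
  proof (rule order_tendstoI)
    fix l assume "l < F x"
    then have "\<forall>\<^sub>F y in at x. l < F y" using x by (simp add: order_tendstoD(1) isCont_def)
    then obtain d where d: "d > 0" "\<And>y. y \<noteq> x \<Longrightarrow> dist y x < d \<Longrightarrow> l < F y"
      unfolding eventually_at by auto
    \<comment> \<open>Discontinuities of a monotone function are countable, so a continuity point
      exists just to the left of \<open>x\<close>.\<close>
    have "open {x - d <..< x}" "{x - d <..< x} \<noteq> {}" using d by auto
    then obtain y where y: "y \<in> {x - d <..< x}" "isCont F y"
      using open_minus_countable[OF mono_ctble_discont[OF F], of "{x - d <..< x}"] by auto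
    then have "l < F y" using d(2)[of y] by (auto simp: dist_real_def)
    then have "\<forall>\<^sub>F n in sequentially. l < h (s n) y" using order_tendstoD(1)[OF c[OF y(2)]] by blast
    then show "\<forall>\<^sub>F n in sequentially. l < f (s n) x"
      by (rule eventually_mono) (use y in \<open>auto intro: less_le_trans[OF _ hle]\<close>)
  next
    fix l assume "F x < l"
    then have "\<forall>\<^sub>F n in sequentially. h (s n) x < l" using order_tendstoD(2)[OF c[OF x]] by blast
    then show "\<forall>\<^sub>F n in sequentially. f (s n) x < l"
      by (rule eventually_mono) (rule le_less_trans[OF fle])
  qed
  then show ?thesis using s F by blast
qed

text \<open>Unlike \<open>unimodal\<close>, this allows a singularity at the origin, where the value is irrelevant.\<close>

definition unimodal_kernel :: "(real \<Rightarrow> real) \<Rightarrow> bool" where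
  "unimodal_kernel G \<longleftrightarrow> (\<forall>x. 0 \<le> G x) \<and> (\<forall>x y. x \<noteq> 0 \<longrightarrow> \<bar>x\<bar> \<le> \<bar>y\<bar> \<longrightarrow> G y \<le> G x) \<and> integrable lborel G"

text \<open>A bound on the mass thus becomes a pointwise bound away from 0, uniform over a whole
  family.\<close>

lemma unimodal_integral_ge:
  assumes g: "unimodal g" "\<And>x. 0 \<le> g x" "integrable lborel g"
  shows "2 * \<bar>x\<bar> * g x \<le> integral\<^sup>L lborel g"
proof -
  have "2 * \<bar>x\<bar> * g x = (LBINT y. g x * indicator {-\<bar>x\<bar>..\<bar>x\<bar>} y)" by simp
  also have "\<dots> \<le> integral\<^sup>L lborel g"
  proof (rule integral_mono[OF _ g(3)])
    show "integrable lborel (\<lambda>y. g x * indicator {-\<bar>x\<bar>..\<bar>x\<bar>} y)"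
      by (intro integrable_mult_right integrable_real_indicator) auto
    show "g x * indicator {-\<bar>x\<bar>..\<bar>x\<bar>} y \<le> g y" for y
      using g(2)[of y] unimodalD[OF g(1), of y x] by (auto simp: indicator_def abs_le_iff)
  qed
  finally show ?thesis .
qed

text \<open>The substitutions \<open>x = exp t\<close> and \<open>v \<mapsto> 1 / (1 + v)\<close>
  turn decreasing functions on the half-line, possibly unbounded near 0 in the limit, into
  increasing functions with values in (0, 1], to which Helly's theorem applies. Integrability of the
  limit is Fatou's lemma.\<close>

lemma unimodal_compactness:
  fixes g :: "nat \<Rightarrow> real \<Rightarrow> real"
  assumes g: "\<And>n. unimodal (g n)" "\<And>n x. 0 \<le> g n x" "\<And>n. integrable lborel (g n)"
    and M: "\<And>n. integral\<^sup>L lborel (g n) \<le> M"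
  shows "\<exists>s G. strict_mono s \<and> unimodal_kernel G \<and> (AE x in lborel. (\<lambda>n. g (s n) x) \<longlonglongrightarrow> G x)"
proof -
  define f where "f n t = 1 / (1 + g n (exp t))" for n t
  have pos: "0 < 1 + g n x" for n x using g(2)[of n x] by linarith
  have fm: "mono (f n)" for n
    unfolding f_def by (intro monoI divide_left_mono mult_pos_pos pos add_left_mono unimodalD[OF g(1)]) auto
  have f1: "0 < f n t" "f n t \<le> 1" for n t unfolding f_def using pos[of n] g(2)[of n "exp t"] by auto
  then have "\<bar>f n t\<bar> \<le> 1" for n t by (simp add: less_imp_le)
  then obtain s F where s: "strict_mono s" and F: "mono F"
    and c: "\<And>x. isCont F x \<Longrightarrow> (\<lambda>n. f (s n) x) \<longlonglongrightarrow> F x"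
    using Helly_selection_mono[of f 1, OF fm] by blast
  have "0 \<le> integral\<^sup>L lborel (g 0)" using g(2) by simp
  then have M0: "0 \<le> M" using M[of 0] by linarith
  have Fb: "0 < F t \<and> F t \<le> 1" for t
  proof -
    obtain t1 where t1: "t1 < t" "isCont F t1"
      using open_minus_countable[OF mono_ctble_discont[OF F], of "{..<t}"] by auto
    obtain t2 where t2: "t < t2" "isCont F t2"
      using open_minus_countable[OF mono_ctble_discont[OF F], of "{t<..}"] by auto
    \<comment> \<open>The mass bound keeps the transformed functions away from 0, so the limit
      kernel is finite away from the origin.\<close>
    have "1 / (1 + M / (2 * exp t1)) \<le> f n t1" for n
    proof -
      have "g n (exp t1) \<le> M / (2 * exp t1)"
        using unimodal_integral_ge[of "g n" "exp t1", OF g(1,2,3)] M[of n] by (simp add: field_simps)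
      then show ?thesis unfolding f_def using g(2)[of n "exp t1"] M0
        by (intro divide_left_mono) (auto intro!: mult_pos_pos add_pos_nonneg)
    qed
    then have "1 / (1 + M / (2 * exp t1)) \<le> F t1"
      by (intro LIMSEQ_le_const[OF c[OF t1(2)]]) auto
    moreover have "0 < 1 / (1 + M / (2 * exp t1))" using M0 by (auto intro!: add_pos_nonneg)
    moreover have "F t1 \<le> F t" "F t \<le> F t2" using t1 t2 monoD[OF F] by auto
    moreover have "F t2 \<le> 1" by (intro LIMSEQ_le_const2[OF c[OF t2(2)]]) (use f1 in auto)
    ultimately show ?thesis by linarith
  qed
  define G where "G x = 1 / F (ln \<bar>x\<bar>) - 1" for x
  have G0: "0 \<le> G x" for x unfolding G_def using Fb[of "ln \<bar>x\<bar>"] by simp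
  have Gd: "G y \<le> G x" if "x \<noteq> 0" "\<bar>x\<bar> \<le> \<bar>y\<bar>" for x y
  proof -
    have "F (ln \<bar>x\<bar>) \<le> F (ln \<bar>y\<bar>)" using that by (intro monoD[OF F]) (auto intro!: ln_mono)
    then show ?thesis unfolding G_def using Fb[of "ln \<bar>x\<bar>"] by (simp add: frac_le)
  qed
  have [measurable]: "F \<in> borel_measurable borel" by (rule borel_measurable_mono[OF F])
  have Gm [measurable]: "G \<in> borel_measurable borel" unfolding G_def[abs_def] by measurable
  \<comment> \<open>The origin together with the points whose logarithmic distance to 0 is a
    discontinuity of \<open>F\<close>.\<close>
  define N where "N = {0} \<union> (\<lambda>t. exp t) ` {t. \<not> isCont F t} \<union> (\<lambda>t. - exp t) ` {t. \<not> isCont F t}"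
  have "countable N" unfolding N_def using mono_ctble_discont[OF F] by auto
  then have AEN: "AE x in lborel. x \<notin> N" by (intro AE_not_in countable_imp_null_set_lborel)
  have lim: "(\<lambda>n. g (s n) x) \<longlonglongrightarrow> G x" if "x \<notin> N" for x
  proof -
    have x0: "x \<noteq> 0" using that by (auto simp: N_def)
    have "isCont F (ln \<bar>x\<bar>)"
    proof (rule ccontr)
      assume "\<not> isCont F (ln \<bar>x\<bar>)"
      moreover have "x = exp (ln \<bar>x\<bar>) \<or> x = - exp (ln \<bar>x\<bar>)" using x0 by auto
      ultimately have "x \<in> N" unfolding N_def by blast
      then show False using that by simp
    qed
    then have "(\<lambda>n. 1 / f (s n) (ln \<bar>x\<bar>) - 1) \<longlonglongrightarrow> G x"
      unfolding G_def using Fb[of "ln \<bar>x\<bar>"] by (intro tendsto_intros c) auto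
    moreover have "1 / f (s n) (ln \<bar>x\<bar>) - 1 = g (s n) x" for n
      unfolding f_def using x0 unimodal_even[OF g(1), of "s n" x] by (auto simp: abs_if)
    ultimately show ?thesis by simp
  qed
  have gm [measurable]: "g n \<in> borel_measurable borel" for n by (rule unimodal_measurable[OF g(1)])
  have "integrable lborel G"
  proof (rule integrableI_nonneg)
    have "(\<integral>\<^sup>+x. G x \<partial>lborel) = (\<integral>\<^sup>+x. liminf (\<lambda>n. ennreal (g (s n) x)) \<partial>lborel)"
    proof (rule nn_integral_cong_AE)
      show "AE x in lborel. ennreal (G x) = liminf (\<lambda>n. ennreal (g (s n) x))"
        using AEN
      proof eventually_elim
        case (elim x)
        then have "(\<lambda>n. ennreal (g (s n) x)) \<longlonglongrightarrow> ennreal (G x)" by (intro tendsto_ennrealI lim)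
        then show ?case by (rule lim_imp_Liminf[symmetric, rotated]) simp
      qed
    qed
    also have "\<dots> \<le> liminf (\<lambda>n. \<integral>\<^sup>+x. g (s n) x \<partial>lborel)"
      by (rule nn_integral_liminf) measurable
    also have "\<dots> \<le> ennreal M"
    proof (rule Liminf_le[OF sequentially_bot])
      show "\<forall>\<^sub>F n in sequentially. (\<integral>\<^sup>+x. ennreal (g (s n) x) \<partial>lborel) \<le> ennreal M"
      proof (rule always_eventually, rule allI)
        fix n
        have "(\<integral>\<^sup>+x. ennreal (g (s n) x) \<partial>lborel) = ennreal (integral\<^sup>L lborel (g (s n)))"
          by (rule nn_integral_eq_integral) (use g in auto)
        then show "(\<integral>\<^sup>+x. ennreal (g (s n) x) \<partial>lborel) \<le> ennreal M" using M[of "s n"] by (simp add: ennreal_leI)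
      qed
    qed
    also have "\<dots> < \<infinity>" by simp
    finally show "(\<integral>\<^sup>+x. ennreal (G x) \<partial>lborel) < \<infinity>" .
  qed (use G0 in auto)
  then have "unimodal_kernel G" unfolding unimodal_kernel_def using G0 Gd by blast
  moreover have "AE x in lborel. (\<lambda>n. g (s n) x) \<longlonglongrightarrow> G x" using AEN by eventually_elim (rule lim)
  ultimately show ?thesis using s by blast
qed

text \<open>Dominated convergence on shrinking intervals. This is where all later smallness of the
  singular part of the kernel comes from.\<close>

lemma small_mass_near_0:
  fixes G :: "real \<Rightarrow> real"
  assumes G: "integrable lborel G" "\<And>x. 0 \<le> G x" and e: "0 < e"
  shows "\<exists>\<delta>>0. (LBINT x. G x * indicator {-\<delta>..\<delta>} x) \<le> e"
proof -
  have "(\<lambda>n. LBINT x. G x * indicator {- inverse (real (Suc n))..inverse (real (Suc n))} x)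
     \<longlonglongrightarrow> (\<integral>x. 0 \<partial>(lborel :: real measure))"
  proof (rule integral_dominated_convergence[where w=G])
    have "AE x in lborel. x \<noteq> (0 :: real)" by (rule AE_lborel_singleton)
    then show "AE x in lborel. (\<lambda>n. G x * indicator {- inverse (real (Suc n))..inverse (real (Suc n))} x) \<longlonglongrightarrow> 0"
    proof eventually_elim
      case (elim x)
      have "\<forall>\<^sub>F n in sequentially. inverse (real (Suc n)) < \<bar>x\<bar>"
        by (rule order_tendstoD(2)[OF LIMSEQ_inverse_real_of_nat]) (use elim in simp)
      then have "\<forall>\<^sub>F n in sequentially. G x * indicator {- inverse (real (Suc n))..inverse (real (Suc n))} x = 0"
        by eventually_elim (auto simp: indicator_def)
      then show ?case by (rule tendsto_eventually)
    qed
    show "AE x in lborel. norm (G x * indicator {- inverse (real (Suc n))..inverse (real (Suc n))} x) \<le> G x" for n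
      using G(2) by (auto simp: indicator_def)
  qed (use G in auto)
  then have "\<forall>\<^sub>F n in sequentially. (LBINT x. G x * indicator {- inverse (real (Suc n))..inverse (real (Suc n))} x) < e"
    using e by (intro order_tendstoD(2)) auto
  then obtain n where "(LBINT x. G x * indicator {- inverse (real (Suc n))..inverse (real (Suc n))} x) < e"
    by (auto simp: eventually_sequentially)
  then show ?thesis by (intro exI[of _ "inverse (real (Suc n))"]) auto
qed

text \<open>On an annulus the mass bound dominates the densities and convergence almost everywhere
  suffices. Near 0 the hypothesis \<open>conc\<close> makes the contribution small; far out the mass
  need not converge, but it is bounded and \<open>S\<close> is small there.\<close>

lemma unimodal_limit_integral:
  fixes g :: "nat \<Rightarrow> real \<Rightarrow> real"
  assumes g: "\<And>n. unimodal (g n)" "\<And>n x. 0 \<le> g n x" "\<And>n. integrable lborel (g n)"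
    and M: "\<And>n. integral\<^sup>L lborel (g n) \<le> M"
    and G: "unimodal_kernel G" and lim: "AE x in lborel. (\<lambda>n. g n x) \<longlonglongrightarrow> G x"
    and conc: "\<And>e. 0 < e \<Longrightarrow> \<exists>\<delta>>0. \<forall>\<^sub>F n in sequentially. (LBINT x. g n x * indicator {-\<delta>..\<delta>} x) \<le> e"
    and S: "S \<in> borel_measurable borel" "\<And>x. \<bar>S x\<bar> \<le> B" "(S \<longlongrightarrow> 0) at_top" "(S \<longlongrightarrow> 0) at_bot"
  shows "(\<lambda>n. LBINT x. g n x * S x) \<longlonglongrightarrow> (LBINT x. G x * S x)"
proof (rule tendstoI)
  fix r :: real assume r: "0 < r"
  have Gi: "integrable lborel G" and G0: "\<And>x. 0 \<le> G x" using G by (auto simp: unimodal_kernel_def)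
  note [measurable] = unimodal_measurable[OF g(1)] S(1) borel_measurable_integrable[OF Gi, simplified]
  define M' where "M' = max M (integral\<^sup>L lborel G)"
  have M'0: "0 \<le> M'" unfolding M'_def using G0 by (auto simp: le_max_iff_disj)
  have B0: "0 \<le> B" using S(2)[of 0] by linarith
  \<comment> \<open>Discarding the complement of the annulus costs \<open>e * (B + M')\<close> for
    \<open>g n\<close> and again for \<open>G\<close>, and the annulus itself costs
    \<open>e\<close>; the sum stays below \<open>r\<close>.\<close>
  define e where "e = r / (3 * (B + M' + 1))"
  have e: "0 < e" unfolding e_def using r B0 M'0 by simp
  have eB: "3 * (e * (B + M')) + 3 * e = r"
  proof -
    have "e * (3 * (B + M' + 1)) = r" unfolding e_def using B0 M'0 by simp
    then show ?thesis by (simp add: algebra_simps)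
  qed
  obtain R1 where R1: "\<And>x. x \<ge> R1 \<Longrightarrow> \<bar>S x\<bar> < e"
    using tendstoD[OF S(3) e] by (auto simp: eventually_at_top_linorder dist_real_def)
  obtain R2 where R2: "\<And>x. x \<le> R2 \<Longrightarrow> \<bar>S x\<bar> < e"
    using tendstoD[OF S(4) e] by (auto simp: eventually_at_bot_linorder dist_real_def)
  define R where "R = max 0 (max R1 (- R2))"
  have R: "\<bar>S x\<bar> \<le> e" if "\<bar>x\<bar> \<ge> R" for x
    using R1[of x] R2[of x] that unfolding R_def by (cases "x \<ge> 0") auto
  obtain \<delta>1 where d1: "0 < \<delta>1" "\<forall>\<^sub>F n in sequentially. (LBINT x. g n x * indicator {-\<delta>1..\<delta>1} x) \<le> e"
    using conc[OF e] by blast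
  obtain \<delta>2 where d2: "0 < \<delta>2" "(LBINT x. G x * indicator {-\<delta>2..\<delta>2} x) \<le> e"
    using small_mass_near_0[OF Gi G0 e] by blast
  define \<delta> where "\<delta> = min \<delta>1 \<delta>2"
  have d: "0 < \<delta>" unfolding \<delta>_def using d1 d2 by simp
  define A where "A = {x::real. \<delta> < \<bar>x\<bar> \<and> \<bar>x\<bar> < R}"
  have A [measurable]: "A \<in> sets borel" unfolding A_def by measurable
  have outer: "\<bar>(LBINT x. k x * S x) - (LBINT x. k x * S x * indicator A x)\<bar> \<le> e * (B + M')"
    if k: "integrable lborel k" "\<And>x. 0 \<le> k x" "integral\<^sup>L lborel k \<le> M'"
      and d': "\<delta> \<le> \<delta>'" and sm: "(LBINT x. k x * indicator {-\<delta>'..\<delta>'} x) \<le> e" for k \<delta>'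
  proof -
    have i1: "integrable lborel (\<lambda>x. k x * S x)" by (rule integrable_mult_bounded[OF k(1) _ S(2)]) measurable
    have i2: "integrable lborel (\<lambda>x. k x * S x * indicator A x)"
      by (rule integrable_mult_bounded[OF i1, where B=1]) (auto simp: indicator_def)
    have i3: "integrable lborel (\<lambda>x. k x * indicator {-\<delta>'..\<delta>'} x)"
      by (rule integrable_mult_bounded[OF k(1), where B=1]) (auto simp: indicator_def)
    have "\<bar>(LBINT x. k x * S x) - (LBINT x. k x * S x * indicator A x)\<bar> =
       \<bar>LBINT x. k x * S x - k x * S x * indicator A x\<bar>"
      by (simp add: Bochner_Integration.integral_diff[OF i1 i2])
    also have "\<dots> \<le> (LBINT x. \<bar>k x * S x - k x * S x * indicator A x\<bar>)"
      by (rule integral_abs_bound)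
    also have "\<dots> \<le> (LBINT x. B * (k x * indicator {-\<delta>'..\<delta>'} x) + e * k x)"
    proof (rule integral_mono)
      fix x
      show "\<bar>k x * S x - k x * S x * indicator A x\<bar> \<le> B * (k x * indicator {-\<delta>'..\<delta>'} x) + e * k x"
      proof (cases "x \<in> A")
        case True
        then show ?thesis using B0 e k(2)[of x] by (simp add: indicator_def)
      next
        case False
        have p: "0 \<le> e * k x" "0 \<le> B * k x" using B0 e k(2) by simp_all
        from False consider "\<bar>x\<bar> \<le> \<delta>'" | "R \<le> \<bar>x\<bar>" using d' by (auto simp: A_def not_less)
        then show ?thesis
        proof cases
          case 1
          then show ?thesis using False mult_right_mono[OF S(2)[of x] k(2)[of x]] p k(2)[of x]
            by (auto simp: abs_mult mult.commute indicator_def abs_le_iff)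
        next
          case 2
          then show ?thesis using False mult_right_mono[OF R[OF 2] k(2)[of x]] p k(2)[of x]
            by (auto simp: abs_mult mult.commute indicator_def)
        qed
      qed
    qed (use i1 i2 i3 k(1) in auto)
    also have "\<dots> = B * (LBINT x. k x * indicator {-\<delta>'..\<delta>'} x) + e * integral\<^sup>L lborel k"
      using i3 k(1) by simp
    also have "\<dots> \<le> B * e + e * M'" using sm k(3) B0 e by (intro add_mono mult_left_mono) auto
    finally show ?thesis by (simp add: algebra_simps)
  qed
  have "(\<lambda>n. LBINT x. g n x * S x * indicator A x) \<longlonglongrightarrow> (LBINT x. G x * S x * indicator A x)"
  proof (rule integral_dominated_convergence[where w="\<lambda>x. M / (2 * \<delta>) * B * indicator {-R..R} x"])
    show "integrable lborel (\<lambda>x. M / (2 * \<delta>) * B * indicator {-R..R} x)"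
      by (intro integrable_mult_right integrable_real_indicator) (auto simp: R_def)
    show "AE x in lborel. (\<lambda>n. g n x * S x * indicator A x) \<longlonglongrightarrow> G x * S x * indicator A x"
      using lim by eventually_elim (intro tendsto_intros)
    show "AE x in lborel. norm (g n x * S x * indicator A x) \<le> M / (2 * \<delta>) * B * indicator {-R..R} x" for n
    proof (rule AE_I2)
      fix x
      show "norm (g n x * S x * indicator A x) \<le> M / (2 * \<delta>) * B * indicator {-R..R} x"
      proof (cases "x \<in> A")
        case True
        have "2 * \<delta> * g n x \<le> 2 * \<bar>x\<bar> * g n x" using True g(2) by (intro mult_right_mono) (auto simp: A_def)
        also have "\<dots> \<le> M" using unimodal_integral_ge[of "g n" x, OF g(1,2,3)] M[of n] by linarith
        finally have "g n x \<le> M / (2 * \<delta>)" using d by (simp add: field_simps)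
        then have "g n x * \<bar>S x\<bar> \<le> M / (2 * \<delta>) * B"
          using g(2)[of n x] S(2)[of x] by (intro mult_mono) auto
        then show ?thesis using True g(2)[of n x] by (auto simp: A_def indicator_def abs_mult)
      next
        case False
        have "0 \<le> integral\<^sup>L lborel (g n)" using g(2) by simp
        then have "0 \<le> M" using M[of n] by linarith
        then show ?thesis using False B0 d by (auto simp: indicator_def)
      qed
    qed
  qed measurable
  from tendstoD[OF this e] d1(2) show "\<forall>\<^sub>F n in sequentially. dist (LBINT x. g n x * S x) (LBINT x. G x * S x) < r"
  proof eventually_elim
    case (elim n)
    have "\<bar>(LBINT x. g n x * S x) - (LBINT x. g n x * S x * indicator A x)\<bar> \<le> e * (B + M')"
      by (rule outer[OF g(3,2) _ _ elim(2)]) (use M[of n] in \<open>auto simp: M'_def \<delta>_def\<close>)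
    moreover have "\<bar>(LBINT x. G x * S x) - (LBINT x. G x * S x * indicator A x)\<bar> \<le> e * (B + M')"
      by (rule outer[OF Gi G0 _ _ d2(2)]) (auto simp: M'_def \<delta>_def)
    moreover have "0 \<le> e * (B + M')" using e B0 M'0 by simp
    ultimately show ?case using elim(1) eB e unfolding dist_real_def by linarith
  qed
qed

section \<open>The limit kernel represents the solution\<close>

context levy_kernel
begin

text \<open>No tightness of the resolvent densities is needed: for odd \<open>\<phi>\<close> the mass lost at infinity cancels.\<close>

theorem green_function:
  assumes mu: "0 < \<mu>"
    and u: "continuous_on UNIV u" "(u \<longlongrightarrow> p) at_top" "(u \<longlongrightarrow> - p) at_bot"
    and \<phi>: "continuous_on UNIV \<phi>" "(\<phi> \<longlongrightarrow> \<mu> * p) at_top" "\<And>x. \<bar>\<phi> x\<bar> \<le> B" "\<And>x. \<phi> (- x) = - \<phi> x"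
    and L: "\<And>x. has_L K u x (\<phi> x - \<mu> * u x)"
  shows "\<exists>G. unimodal_kernel G \<and> (\<forall>x. u x = conv G \<phi> x)"
proof -
  have pm [measurable]: "\<phi> \<in> borel_measurable borel" using \<phi>(1) by (auto intro: borel_measurable_continuous_onI)
  have pb: "(\<phi> \<longlongrightarrow> \<mu> * - p) at_bot"
    unfolding filterlim_at_bot_mirror using tendsto_minus[OF \<phi>(2)] \<phi>(4) by simp
  define e where "e n = inverse (real (Suc n))" for n
  have e: "0 < e n" "e n \<le> 1" for n unfolding e_def by (auto simp: field_simps)
  have e_lim: "e \<longlonglongrightarrow> 0" unfolding e_def by (rule LIMSEQ_inverse_real_of_nat)
  have "\<forall>n. \<exists>g a. jump_resolvent (trunc (e n)) \<mu> g a"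
    using jump_resolvent_exists[OF trunc(1,2,3)[OF e(1)] mu] by blast
  then obtain g a where res: "\<And>n. jump_resolvent (trunc (e n)) \<mu> (g n) (a n)" by metis
  note R = jump_resolvent_simps[OF trunc(1,2,3)[OF e(1)] mu res]
  have M: "integral\<^sup>L lborel (g n) \<le> 1 / \<mu>" for n using R(4,6)[of n] by simp
  obtain s G where s: "strict_mono s" and G: "unimodal_kernel G"
    and lim: "AE x in lborel. (\<lambda>n. g (s n) x) \<longlonglongrightarrow> G x"
    using unimodal_compactness[of g, OF R(1,2,3) M] by blast
  have es: "(\<lambda>n. e (s n)) \<longlonglongrightarrow> 0" using LIMSEQ_subseq_LIMSEQ[OF e_lim s] by (simp add: o_def)
  have noconc: "\<exists>\<delta>>0. \<forall>\<^sub>F n in sequentially. a (s n) + (LBINT x. g (s n) x * indicator {-\<delta>..\<delta>} x) \<le> r" if r: "0 < r" for r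
  proof -
    obtain \<delta> e0 where d: "0 < \<delta>" "0 < e0" "\<And>e g a. 0 < e \<Longrightarrow> e \<le> e0 \<Longrightarrow> jump_resolvent (trunc e) \<mu> g a \<Longrightarrow>
      a + (LBINT y. g y * indicator {-\<delta>..\<delta>} y) \<le> r"
      using resolvent_no_concentration[OF mu r] by blast
    have "\<forall>\<^sub>F n in sequentially. e (s n) < e0" by (rule order_tendstoD(2)[OF es d(2)])
    then have "\<forall>\<^sub>F n in sequentially. a (s n) + (LBINT x. g (s n) x * indicator {-\<delta>..\<delta>} x) \<le> r"
      by eventually_elim (rule d(3)[OF e(1) _ res], simp)
    then show ?thesis using d(1) by blast
  qed
  have mass0: "0 \<le> (LBINT x. g n x * indicator {-\<delta>..\<delta>} x)" for n \<delta>
    using R(2) by (intro integral_nonneg_AE AE_I2) auto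
  have a0: "(\<lambda>n. a (s n)) \<longlonglongrightarrow> 0"
  proof (rule tendstoI)
    fix r :: real assume "0 < r"
    then obtain \<delta> where "\<forall>\<^sub>F n in sequentially. a (s n) + (LBINT x. g (s n) x * indicator {-\<delta>..\<delta>} x) \<le> r / 2"
      using noconc[of "r/2"] by auto
    then show "\<forall>\<^sub>F n in sequentially. dist (a (s n)) 0 < r"
    proof eventually_elim
      case (elim n)
      then show ?case using R(4)[of "s n"] mass0[of "s n" \<delta>] \<open>0 < r\<close> by (simp add: dist_real_def)
    qed
  qed
  have conc: "\<exists>\<delta>>0. \<forall>\<^sub>F n in sequentially. (LBINT x. g (s n) x * indicator {-\<delta>..\<delta>} x) \<le> r" if r: "0 < r" for r
  proof -
    obtain \<delta> where "\<delta> > 0" and "\<forall>\<^sub>F n in sequentially. a (s n) + (LBINT x. g (s n) x * indicator {-\<delta>..\<delta>} x) \<le> r"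
      using noconc[OF r] by blast
    from this(2) have "\<forall>\<^sub>F n in sequentially. (LBINT x. g (s n) x * indicator {-\<delta>..\<delta>} x) \<le> r"
    proof eventually_elim
      case (elim n) then show ?case using R(4)[of "s n"] by linarith
    qed
    then show ?thesis using \<open>\<delta> > 0\<close> by blast
  qed
  have "u x = conv G \<phi> x" for x
  proof -
    \<comment> \<open>The even part of \<open>y \<mapsto> \<phi> (x - y)\<close>, which is all that
      an even kernel sees. As \<open>\<phi>\<close> has opposite limits at the two ends,
      \<open>S\<close> tends to 0 at both.\<close>
    define S where "S y = (\<phi> (x - y) + \<phi> (x + y)) / 2" for y
    have Sm: "S \<in> borel_measurable borel" unfolding S_def[abs_def] by measurable
    have Sb: "\<bar>S y\<bar> \<le> B" for y unfolding S_def using \<phi>(3)[of "x - y"] \<phi>(3)[of "x + y"] by auto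
    have St: "(S \<longlongrightarrow> 0) at_top"
    proof -
      have "((\<lambda>y. \<phi> (x + y)) \<longlongrightarrow> \<mu> * p) at_top"
        by (rule filterlim_compose[OF \<phi>(2)]) (rule filterlim_tendsto_add_at_top[OF tendsto_const filterlim_ident])
      moreover have "((\<lambda>y. \<phi> (x - y)) \<longlongrightarrow> \<mu> * - p) at_top"
        by (rule filterlim_compose[OF pb])
          (use filterlim_tendsto_add_at_top[OF tendsto_const[of "-x"] filterlim_ident] in
            \<open>simp add: filterlim_uminus_at_bot\<close>)
      ultimately have "((\<lambda>y. (\<phi> (x - y) + \<phi> (x + y)) / 2) \<longlongrightarrow> (\<mu> * - p + \<mu> * p) / 2) at_top"
        by (intro tendsto_intros) auto
      then show ?thesis unfolding S_def[abs_def] by simp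
    qed
    have Se: "S (- y) = S y" for y unfolding S_def by (simp add: add.commute)
    have Sbt: "(S \<longlongrightarrow> 0) at_bot" unfolding filterlim_at_bot_mirror Se by (rule St)
    have symm: "conv k \<phi> x = (LBINT y. k y * S y)" if k: "integrable lborel k" "AE y in lborel. k (- y) = k y" for k
    proof -
      have i: "integrable lborel (\<lambda>y. k y * \<phi> (x - y))" "integrable lborel (\<lambda>y. k y * \<phi> (x + y))"
        by (rule integrable_mult_bounded[OF k(1), where B=B]; use \<phi>(3) in simp)+
      have "conv k \<phi> x = (LBINT y. k (- y) * \<phi> (x + y))"
        unfolding conv_def using integral_reflect[of "\<lambda>y. k y * \<phi> (x - y)" 0] by simp
      also have "\<dots> = (LBINT y. k y * \<phi> (x + y))"
      proof (rule integral_cong_AE)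
        have [measurable]: "k \<in> borel_measurable borel" using borel_measurable_integrable[OF k(1)] by simp
        show "(\<lambda>y. k (- y) * \<phi> (x + y)) \<in> borel_measurable lborel"
          "(\<lambda>y. k y * \<phi> (x + y)) \<in> borel_measurable lborel" by measurable
        show "AE y in lborel. k (- y) * \<phi> (x + y) = k y * \<phi> (x + y)"
          using k(2) by eventually_elim simp
      qed
      finally have "2 * conv k \<phi> x = (LBINT y. k y * \<phi> (x - y)) + (LBINT y. k y * \<phi> (x + y))"
        unfolding conv_def by simp
      also have "\<dots> = (LBINT y. k y * \<phi> (x - y) + k y * \<phi> (x + y))"
        by (rule Bochner_Integration.integral_add[OF i, symmetric])
      also have "\<dots> = (LBINT y. 2 * (k y * S y))" unfolding S_def
        by (intro Bochner_Integration.integral_cong) (auto simp: field_simps)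
      finally show ?thesis by simp
    qed
    have "(\<lambda>n. LBINT y. g (s n) y * S y) \<longlonglongrightarrow> (LBINT y. G y * S y)"
      by (rule unimodal_limit_integral[OF R(1) R(2) R(3) M G lim conc Sm Sb St Sbt])
    moreover have "conv (g n) \<phi> x = (LBINT y. g n y * S y)" for n
      using unimodal_even[OF R(1)] by (intro symm R(3)) auto
    moreover have "conv G \<phi> x = (LBINT y. G y * S y)"
    proof (rule symm)
      show "integrable lborel G" using G by (simp add: unimodal_kernel_def)
      have "G (- y) = G y" if "y \<noteq> 0" for y
        using G that unfolding unimodal_kernel_def by (metis abs_minus_cancel antisym neg_equal_0_iff_equal order_refl)
      then show "AE y in lborel. G (- y) = G y" using AE_lborel_singleton[of "0::real"] by auto
    qed
    ultimately have c1: "(\<lambda>n. conv (g (s n)) \<phi> x) \<longlonglongrightarrow> conv G \<phi> x" by simp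
    have "(\<lambda>n. a (s n) * \<phi> x + conv (g (s n)) \<phi> x) \<longlonglongrightarrow> 0 * \<phi> x + conv G \<phi> x"
      by (intro tendsto_intros a0 c1)
    then have l1: "(\<lambda>n. a (s n) * \<phi> x + conv (g (s n)) \<phi> x) \<longlonglongrightarrow> conv G \<phi> x" by simp
    \<comment> \<open>Half of \<open>r\<close> is spent on a fixed mollification, which fixes
      \<open>C\<close>; afterwards \<open>C * rest\<close> is made small along the sequence.\<close>
    have "(\<lambda>n. a (s n) * \<phi> x + conv (g (s n)) \<phi> x) \<longlonglongrightarrow> u x"
    proof (rule tendstoI)
      fix r :: real assume r: "0 < r"
      then have r2: "0 < r / 2" by simp
      obtain C where C: "0 \<le> C" "\<forall>e g a x. 0 < e \<longrightarrow> e \<le> 1 \<longrightarrow> jump_resolvent (trunc e) \<mu> g a \<longrightarrow>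
         \<bar>u x - (a * \<phi> x + conv g \<phi> x)\<bar> \<le> r / 2 + C * rest e"
        using resolvent_approximation[OF mu r2 u \<phi>(1,2) pb \<phi>(3) L] by blast
      have "(\<lambda>n. C * rest (e (s n))) \<longlonglongrightarrow> C * 0"
        by (intro tendsto_intros rest_tendsto_0 es e)
      then have "\<forall>\<^sub>F n in sequentially. C * rest (e (s n)) < r / 2"
        using r2 by (intro order_tendstoD(2)) auto
      then show "\<forall>\<^sub>F n in sequentially. dist (a (s n) * \<phi> x + conv (g (s n)) \<phi> x) (u x) < r"
      proof eventually_elim
        case (elim n)
        have "\<bar>u x - (a (s n) * \<phi> x + conv (g (s n)) \<phi> x)\<bar> \<le> r / 2 + C * rest (e (s n))"
          using C(2) e res by blast
        then show ?case using elim unfolding dist_real_def by linarith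
      qed
    qed
    then show ?thesis using l1 by (rule LIMSEQ_unique)
  qed
  then show ?thesis using G by blast
qed

end

section \<open>Smoothing by a unimodal kernel\<close>

lemma unimodal_kernelD:
  assumes "unimodal_kernel G"
  shows "0 \<le> G x" "x \<noteq> 0 \<Longrightarrow> \<bar>x\<bar> \<le> \<bar>y\<bar> \<Longrightarrow> G y \<le> G x" "integrable lborel G" "G \<in> borel_measurable borel"
    "x \<noteq> 0 \<Longrightarrow> G (- x) = G x"
proof -
  show "0 \<le> G x" "x \<noteq> 0 \<Longrightarrow> \<bar>x\<bar> \<le> \<bar>y\<bar> \<Longrightarrow> G y \<le> G x" "integrable lborel G"
    using assms by (auto simp: unimodal_kernel_def)
  then show "G \<in> borel_measurable borel" using borel_measurable_integrable by force
  show "G (- x) = G x" if "x \<noteq> 0"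
    using assms that unfolding unimodal_kernel_def by (metis abs_minus_cancel antisym neg_equal_0_iff_equal order_refl)
qed

lemma unimodal_imp_kernel:
  "unimodal g \<Longrightarrow> (\<And>x. 0 \<le> g x) \<Longrightarrow> integrable lborel g \<Longrightarrow> unimodal_kernel g"
  unfolding unimodal_kernel_def unimodal_def by blast

text \<open>By unimodality the sign of \<open>G (y + h) - G y\<close> changes only at \<open>- h / 2\<close>.\<close>

lemma unimodal_kernel_shift_L1:
  assumes G: "unimodal_kernel G" and h: "0 < h"
  shows "(LBINT y. \<bar>G (y + h) - G y\<bar>) \<le> 2 * (LBINT y. G y * indicator {-h..h} y)"
proof -
  note D = unimodal_kernelD[OF G]
  note [measurable] = D(4)
  define \<sigma> :: "real \<Rightarrow> real" where "\<sigma> y = (if y < - h / 2 then 1 else - 1)" for y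
  have sm [measurable]: "\<sigma> \<in> borel_measurable borel" unfolding \<sigma>_def[abs_def] by measurable
  have sb: "\<bar>\<sigma> y\<bar> \<le> 1" for y by (simp add: \<sigma>_def)
  have Gh: "integrable lborel (\<lambda>y. G (y + h))" using D(3) by (simp add: integrable_translate)
  have i1: "integrable lborel (\<lambda>y. G (y + h) * \<sigma> y)" and i2: "integrable lborel (\<lambda>y. G y * \<sigma> y)"
    by (rule integrable_mult_bounded[OF Gh _ sb], simp, rule integrable_mult_bounded[OF D(3) _ sb], simp)
  have i3: "integrable lborel (\<lambda>y. G y * \<sigma> (y - h))"
    by (rule integrable_mult_bounded[OF D(3) _ sb]) measurable
  have i4: "integrable lborel (\<lambda>y. G y * indicator {-h..h} y)"
    by (rule integrable_mult_bounded[OF D(3), where B=1]) (auto simp: indicator_def)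
  have "(LBINT y. \<bar>G (y + h) - G y\<bar>) = (LBINT y. G (y + h) * \<sigma> y - G y * \<sigma> y)"
  proof (rule integral_cong_AE)
    show "AE y in lborel. \<bar>G (y + h) - G y\<bar> = G (y + h) * \<sigma> y - G y * \<sigma> y"
      using AE_lborel_singleton[of "0::real"] AE_lborel_singleton[of "-h"]
    proof eventually_elim
      case (elim y)
      show ?case
      proof (cases "y < - h / 2")
        case True
        then have "\<bar>y + h\<bar> \<le> \<bar>y\<bar>" using h by linarith
        then show ?thesis using D(2)[of "y + h" y] elim True by (simp add: \<sigma>_def)
      next
        case False
        then have "\<bar>y\<bar> \<le> \<bar>y + h\<bar>" using h by linarith
        then show ?thesis using D(2)[of y "y + h"] elim False by (simp add: \<sigma>_def)
      qed
    qed
  qed measurable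
  also have "\<dots> = (LBINT y. G (y + h) * \<sigma> y) - (LBINT y. G y * \<sigma> y)"
    by (rule Bochner_Integration.integral_diff[OF i1 i2])
  \<comment> \<open>Translation moves the shift onto the sign function, and
    \<open>\<sigma> (y - h) - \<sigma> y\<close> equals 2 on an interval of length \<open>h\<close>
    around 0 and vanishes elsewhere.\<close>
  also have "(LBINT y. G (y + h) * \<sigma> y) = (LBINT y. G y * \<sigma> (y - h))"
    using integral_translate[of "\<lambda>y. G y * \<sigma> (y - h)" h] by simp
  also have "(LBINT y. G y * \<sigma> (y - h)) - (LBINT y. G y * \<sigma> y) = (LBINT y. G y * \<sigma> (y - h) - G y * \<sigma> y)"
    by (rule Bochner_Integration.integral_diff[OF i3 i2, symmetric])
  also have "\<dots> \<le> (LBINT y. 2 * (G y * indicator {-h..h} y))"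
    by (rule integral_mono) (use i2 i3 i4 D(1) h in \<open>auto simp: \<sigma>_def indicator_def\<close>)
  finally show ?thesis by simp
qed

text \<open>The increment is moved from \<open>\<phi>\<close> onto the kernel, so a bound on
  \<open>\<phi>\<close> is enough and the modulus of continuity is the mass of \<open>G\<close> near
  0.\<close>

lemma conv_shift_le:
  assumes G: "unimodal_kernel G" and m: "\<phi> \<in> borel_measurable borel" and b: "\<And>x. \<bar>\<phi> x\<bar> \<le> B"
  shows "\<bar>conv G \<phi> (x + h) - conv G \<phi> x\<bar> \<le> 2 * B * (LBINT y. G y * indicator {-\<bar>h\<bar>..\<bar>h\<bar>} y)"
proof -
  note D = unimodal_kernelD[OF G]
  have pos: "\<bar>conv G \<phi> (x + h) - conv G \<phi> x\<bar> \<le> 2 * B * (LBINT y. G y * indicator {-h..h} y)"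
    if h: "0 < h" for x h
  proof -
    have Gh: "integrable lborel (\<lambda>y. G (y + h))" using D(3) by (simp add: integrable_translate)
    have i1: "integrable lborel (\<lambda>y. G (y + h) * \<phi> (x - y))" and i2: "integrable lborel (\<lambda>y. G y * \<phi> (x - y))"
      using conv_integrable_integrand[OF Gh m b] conv_integrable_integrand[OF D(3) m b] by auto
    have B0: "0 \<le> B" using b[of 0] by linarith
    have "conv G \<phi> (x + h) = (LBINT y. G (y + h) * \<phi> (x - y))"
      unfolding conv_def using integral_translate[of "\<lambda>y. G y * \<phi> (x + h - y)" h] by simp
    then have "conv G \<phi> (x + h) - conv G \<phi> x = (LBINT y. G (y + h) * \<phi> (x - y) - G y * \<phi> (x - y))"
      using Bochner_Integration.integral_diff[OF i1 i2] by (simp add: conv_def)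
    then have "\<bar>conv G \<phi> (x + h) - conv G \<phi> x\<bar> \<le> (LBINT y. \<bar>G (y + h) * \<phi> (x - y) - G y * \<phi> (x - y)\<bar>)"
      using integral_abs_bound by simp
    also have "\<dots> \<le> (LBINT y. B * \<bar>G (y + h) - G y\<bar>)"
    proof (rule integral_mono)
      show "\<bar>G (y + h) * \<phi> (x - y) - G y * \<phi> (x - y)\<bar> \<le> B * \<bar>G (y + h) - G y\<bar>" for y
        using mult_right_mono[OF b[of "x - y"], of "\<bar>G (y + h) - G y\<bar>"]
        by (simp add: abs_mult mult.commute flip: left_diff_distrib)
    qed (use i1 i2 Gh D(3) in auto)
    also have "\<dots> \<le> B * (2 * (LBINT y. G y * indicator {-h..h} y))"
      using mult_left_mono[OF unimodal_kernel_shift_L1[OF G h] B0] by simp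
    finally show ?thesis by simp
  qed
  consider "h > 0" | "h = 0" | "h < 0" by linarith
  then show ?thesis
  proof cases
    case 1 then show ?thesis using pos[of h x] by simp
  next
    case 2
    have "0 \<le> B" using b[of 0] by linarith
    moreover have "0 \<le> (LBINT y. G y * indicator {-\<bar>h\<bar>..\<bar>h\<bar>} y)"
      using D(1) by (intro integral_nonneg_AE AE_I2) auto
    ultimately show ?thesis using 2 by simp
  next
    case 3 then show ?thesis using pos[of "-h" "x + h"] by (simp add: abs_minus_commute)
  qed
qed

lemma conv_uniformly_continuous:
  assumes G: "unimodal_kernel G" and m: "\<phi> \<in> borel_measurable borel" and b: "\<And>x. \<bar>\<phi> x\<bar> \<le> B" and e: "0 < e"
  shows "\<exists>d>0. \<forall>x y. \<bar>x - y\<bar> \<le> d \<longrightarrow> \<bar>conv G \<phi> x - conv G \<phi> y\<bar> \<le> e"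
proof -
  note D = unimodal_kernelD[OF G]
  have B0: "0 \<le> B" using b[of 0] by linarith
  have "0 < e / (2 * B + 1)" using e B0 by simp
  from small_mass_near_0[OF D(3,1) this] obtain d where d: "0 < d"
    "(LBINT y. G y * indicator {-d..d} y) \<le> e / (2 * B + 1)" by blast
  have "\<bar>conv G \<phi> x - conv G \<phi> y\<bar> \<le> e" if "\<bar>x - y\<bar> \<le> d" for x y
  proof -
    have i: "integrable lborel (\<lambda>y. G y * indicator {-c..c} y)" for c
      by (rule integrable_mult_bounded[OF D(3), where B=1]) (auto simp: indicator_def)
    have "(LBINT t. G t * indicator {-\<bar>x - y\<bar>..\<bar>x - y\<bar>} t) \<le> (LBINT y. G y * indicator {-d..d} y)"
      by (rule integral_mono[OF i i]) (use that D(1) in \<open>auto simp: indicator_def\<close>)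
    then have "2 * B * (LBINT t. G t * indicator {-\<bar>x - y\<bar>..\<bar>x - y\<bar>} t) \<le> 2 * B * (e / (2 * B + 1))"
      using d(2) B0 by (intro mult_left_mono) auto
    also have "\<dots> \<le> e" using B0 e by (simp add: field_simps)
    finally show ?thesis using conv_shift_le[OF G m b, of y "x - y"] by simp
  qed
  then show ?thesis using d(1) by blast
qed

text \<open>\<open>G1\<close> is the singular part, of small mass, and \<open>G2\<close> the bounded
  part. The decomposition is expressed by its action on bounded functions because at the origin,
  where \<open>G\<close> may take a low value, the pointwise sum can fail.\<close>

definition kernel_split :: "(real \<Rightarrow> real) \<Rightarrow> real \<Rightarrow> (real \<Rightarrow> real) \<Rightarrow> (real \<Rightarrow> real) \<Rightarrow> real \<Rightarrow> bool" where
  "kernel_split G \<theta> G1 G2 c \<longleftrightarrow> integrable lborel G1 \<and> (\<forall>x. 0 \<le> G1 x) \<and> integral\<^sup>L lborel G1 \<le> \<theta> \<and>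
     unimodal_kernel G2 \<and> (\<forall>x. G2 x \<le> c) \<and> 0 \<le> c \<and>
     (\<forall>\<phi> B x. \<phi> \<in> borel_measurable borel \<longrightarrow> (\<forall>x. \<bar>\<phi> x\<bar> \<le> B) \<longrightarrow> conv G \<phi> x = conv G1 \<phi> x + conv G2 \<phi> x)"

lemma kernel_splitD:
  assumes "kernel_split G \<theta> G1 G2 c"
  shows "integrable lborel G1" "0 \<le> G1 x" "integral\<^sup>L lborel G1 \<le> \<theta>" "unimodal_kernel G2" "G2 x \<le> c" "0 \<le> c"
    "\<phi> \<in> borel_measurable borel \<Longrightarrow> (\<And>x. \<bar>\<phi> x\<bar> \<le> B) \<Longrightarrow> conv G \<phi> x = conv G1 \<phi> x + conv G2 \<phi> x"
  using assms unfolding kernel_split_def by blast+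

lemma kernel_split_exists:
  assumes G: "unimodal_kernel G" and th: "0 < \<theta>"
  shows "\<exists>G1 G2 c. kernel_split G \<theta> G1 G2 c"
proof -
  note D = unimodal_kernelD[OF G]
  note [measurable] = D(4)
  obtain \<delta> where d: "0 < \<delta>" "(LBINT x. G x * indicator {-\<delta>..\<delta>} x) \<le> \<theta>"
    using small_mass_near_0[OF D(3,1) th] by blast
  \<comment> \<open>The same flattening as for the truncated jump kernels; it keeps the bounded part
    unimodal.\<close>
  define G2 where "G2 x = G (max \<bar>x\<bar> \<delta>)" for x
  define G1 where "G1 x = max 0 (G x - G2 x)" for x
  have u: "unimodal G2" unfolding unimodal_def G2_def using d by (auto intro!: D(2))
  have G20: "0 \<le> G2 x" for x by (simp add: G2_def D(1))
  have G2le: "G2 x \<le> G x" if "x \<noteq> 0" for x unfolding G2_def using that by (intro D(2)) auto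
  have [measurable]: "G2 \<in> borel_measurable borel" by (rule unimodal_measurable[OF u])
  have AE0: "AE x in lborel. x \<noteq> (0::real)" by (rule AE_lborel_singleton)
  have G2i: "integrable lborel G2"
    by (rule Bochner_Integration.integrable_bound[OF D(3)]) (use AE0 G20 G2le D(1) in auto)
  have G1le: "G1 x \<le> G x * indicator {-\<delta>..\<delta>} x" for x
  proof (cases "\<bar>x\<bar> \<le> \<delta>")
    case True then show ?thesis using D(1)[of x] G20[of x] by (auto simp: G1_def indicator_def)
  next
    case False
    then have "G2 x = G x" using D(5)[of x] d by (auto simp: G2_def max_def abs_if)
    then show ?thesis using False D(1) by (auto simp: G1_def indicator_def)
  qed
  have G10: "0 \<le> G1 x" for x by (simp add: G1_def)
  have G1m [measurable]: "G1 \<in> borel_measurable borel" unfolding G1_def[abs_def] by measurable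
  have i: "integrable lborel (\<lambda>y. G y * indicator {-\<delta>..\<delta>} y)"
    by (rule integrable_mult_bounded[OF D(3), where B=1]) (auto simp: indicator_def)
  have G1i: "integrable lborel G1"
    by (rule Bochner_Integration.integrable_bound[OF i]) (use G1le G10 D(1) in \<open>auto simp: abs_mult\<close>)
  have G1I: "integral\<^sup>L lborel G1 \<le> \<theta>"
    using integral_mono[OF G1i i G1le] d(2) by linarith
  have split: "conv G \<phi> x = conv G1 \<phi> x + conv G2 \<phi> x"
    if m [measurable]: "\<phi> \<in> borel_measurable borel" and b: "\<And>x. \<bar>\<phi> x\<bar> \<le> B" for \<phi> B x
  proof -
    have "conv G \<phi> x = (LBINT y. G1 y * \<phi> (x - y) + G2 y * \<phi> (x - y))"
      unfolding conv_def
    proof (rule integral_cong_AE)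
      show "AE y in lborel. G y * \<phi> (x - y) = G1 y * \<phi> (x - y) + G2 y * \<phi> (x - y)"
        using AE0 by eventually_elim (use G2le in \<open>auto simp: G1_def max_def algebra_simps\<close>)
    qed measurable
    also have "\<dots> = conv G1 \<phi> x + conv G2 \<phi> x"
      unfolding conv_def
      by (rule Bochner_Integration.integral_add; rule conv_integrable_integrand[OF _ m b]) (use G1i G2i in auto)
    finally show ?thesis .
  qed
  have "G2 x \<le> G \<delta>" for x unfolding G2_def using d by (auto intro!: D(2))
  moreover have "0 \<le> G \<delta>" by (rule D(1))
  ultimately have "kernel_split G \<theta> G1 G2 (G \<delta>)"
    unfolding kernel_split_def using G1i G10 G1I unimodal_imp_kernel[OF u G20 G2i] split by blast
  then show ?thesis by blast
qed

lemma mass_le_of_bounded: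
  assumes G: "unimodal_kernel G" and c: "\<And>x. G x \<le> c"
  shows "(LBINT y. G y * indicator {-\<bar>h\<bar>..\<bar>h\<bar>} y) \<le> 2 * \<bar>h\<bar> * c"
proof -
  have i: "integrable lborel (\<lambda>y. G y * indicator {-\<bar>h\<bar>..\<bar>h\<bar>} y)"
    by (rule integrable_mult_bounded[OF unimodal_kernelD(3)[OF G], where B=1]) (auto simp: indicator_def)
  have "(LBINT y. G y * indicator {-\<bar>h\<bar>..\<bar>h\<bar>} y) \<le> (LBINT y. c * indicator {-\<bar>h\<bar>..\<bar>h\<bar>} y)"
  proof (rule integral_mono[OF i])
    show "integrable lborel (\<lambda>y. c * indicator {-\<bar>h\<bar>..\<bar>h\<bar>} y)"
      by (intro integrable_mult_right integrable_real_indicator) auto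
    show "G y * indicator {-\<bar>h\<bar>..\<bar>h\<bar>} y \<le> c * indicator {-\<bar>h\<bar>..\<bar>h\<bar>} y" for y
      using c by (auto simp: indicator_def)
  qed
  then show ?thesis by (simp add: mult.commute)
qed

text \<open>The part of small mass passes the increment of \<open>\<phi>\<close> on with factor
  \<open>\<theta>\<close>, and the bounded unimodal part gives an increment linear in
  \<open>h\<close> from the bound \<open>B\<close> alone. With \<open>\<theta>\<close> small, the
  first term can later be absorbed.\<close>

lemma conv_smoothing:
  assumes G: "unimodal_kernel G" and th: "0 < \<theta>"
  shows "\<exists>C\<ge>0. \<forall>\<phi> B E h x. \<phi> \<in> borel_measurable borel \<longrightarrow> (\<forall>x. \<bar>\<phi> x\<bar> \<le> B) \<longrightarrow> (\<forall>x. \<bar>\<phi> (x + h) - \<phi> x\<bar> \<le> E) \<longrightarrow>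
     \<bar>conv G \<phi> (x + h) - conv G \<phi> x\<bar> \<le> \<theta> * E + C * B * \<bar>h\<bar>"
proof -
  obtain G1 G2 c where "kernel_split G \<theta> G1 G2 c" using kernel_split_exists[OF G th] by blast
  note S = kernel_splitD[OF this]
  note G1 = S(1-3) and G2 = S(4-6) and split = S(7)
  have "\<bar>conv G \<phi> (x + h) - conv G \<phi> x\<bar> \<le> \<theta> * E + 4 * c * B * \<bar>h\<bar>"
    if m: "\<phi> \<in> borel_measurable borel" and b: "\<And>x. \<bar>\<phi> x\<bar> \<le> B" and E: "\<And>x. \<bar>\<phi> (x + h) - \<phi> x\<bar> \<le> E" for \<phi> B E h x
  proof -
    have B0: "0 \<le> B" and E0: "0 \<le> E" using b[of 0] E[of 0] by linarith+
    have mh: "(\<lambda>x. \<phi> (x + h)) \<in> borel_measurable borel" using m by measurable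
    have "conv G1 \<phi> (x + h) - conv G1 \<phi> x = conv G1 (\<lambda>x. \<phi> (x + h) - \<phi> x) x"
      using conv_diff[OF G1(1) mh m b b] by (simp add: conv_translate)
    also have "\<bar>\<dots>\<bar> \<le> E * integral\<^sup>L lborel G1"
      by (rule conv_le[OF G1(1,2) _ E]) (use m mh in measurable)
    also have "\<dots> \<le> \<theta> * E" using mult_left_mono[OF G1(3) E0] by (simp add: mult.commute)
    finally have 1: "\<bar>conv G1 \<phi> (x + h) - conv G1 \<phi> x\<bar> \<le> \<theta> * E" .
    have "\<bar>conv G2 \<phi> (x + h) - conv G2 \<phi> x\<bar> \<le> 2 * B * (LBINT y. G2 y * indicator {-\<bar>h\<bar>..\<bar>h\<bar>} y)"
      by (rule conv_shift_le[OF G2(1) m b])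
    also have "\<dots> \<le> 2 * B * (2 * \<bar>h\<bar> * c)"
      using B0 by (intro mult_left_mono mass_le_of_bounded G2) auto
    finally show ?thesis using 1 unfolding split[OF m b] by (simp add: mult_ac)
  qed
  then show ?thesis using G2(3) by (intro exI[of _ "4 * c"]) auto
qed

section \<open>Difference quotients and derivatives of convolutions\<close>

lemma dq_measurable [measurable]:
  assumes [measurable]: "f \<in> borel_measurable borel"
  shows "dq h f \<in> borel_measurable borel"
  unfolding dq_def[abs_def] by measurable

lemma conv_dq:
  assumes g: "integrable lborel g" and m: "\<phi> \<in> borel_measurable borel" and b: "\<And>x. \<bar>\<phi> x\<bar> \<le> B"
  shows "dq h (conv g \<phi>) x = conv g (dq h \<phi>) x"
proof -
  have mh: "(\<lambda>x. \<phi> (x + h)) \<in> borel_measurable borel" using m by measurable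
  have "conv g (dq h \<phi>) x = conv g (\<lambda>x. inverse h * (\<phi> (x + h) - \<phi> x)) x"
    by (simp add: dq_def[abs_def] divide_inverse mult.commute)
  also have "\<dots> = inverse h * (conv g \<phi> (x + h) - conv g \<phi> x)"
    unfolding conv_cmult conv_diff[OF g mh m b b] conv_translate ..
  finally show ?thesis by (simp add: dq_def divide_inverse mult.commute)
qed

lemma dq_abs_le:
  assumes "\<And>x. \<bar>f x\<bar> \<le> B" shows "\<bar>dq h f x\<bar> \<le> 2 * B / \<bar>h\<bar>"
proof -
  have "\<bar>f (x + h) - f x\<bar> \<le> 2 * B" using assms[of x] assms[of "x + h"] by linarith
  then show ?thesis unfolding dq_def by (simp add: abs_divide divide_right_mono)
qed

lemma dq_lipschitz:
  assumes "\<And>x y. \<bar>f x - f y\<bar> \<le> L * \<bar>x - y\<bar>" and "h \<noteq> 0" shows "\<bar>dq h f x\<bar> \<le> L"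
  using assms(1)[of "x + h" x] assms(2) unfolding dq_def by (simp add: abs_divide field_simps)

text \<open>The same splitting for differences of two quotients, so that the existence of a
  derivative can be concluded and need not be presupposed. Under the bounded part,
  \<open>\<phi>\<close> is split into a mollification, whose quotients are Cauchy at an explicit
  rate, and a remainder of size \<open>L * \<eta>\<close>, whose quotients are small for every
  step.\<close>

lemma conv_dq_cauchy:
  assumes G: "unimodal_kernel G" and th: "0 < \<theta>" and e: "0 < e"
    and \<phi>: "\<And>x. \<bar>\<phi> x\<bar> \<le> B" "\<And>x y. \<bar>\<phi> x - \<phi> y\<bar> \<le> L * \<bar>x - y\<bar>"
  shows "\<exists>d>0. \<forall>h k E x. h \<noteq> 0 \<longrightarrow> k \<noteq> 0 \<longrightarrow> \<bar>h\<bar> \<le> d \<longrightarrow> \<bar>k\<bar> \<le> d \<longrightarrow> (\<forall>x. \<bar>dq h \<phi> x - dq k \<phi> x\<bar> \<le> E) \<longrightarrow>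
      \<bar>dq h (conv G \<phi>) x - dq k (conv G \<phi>) x\<bar> \<le> \<theta> * E + e"
proof -
  obtain G1 G2 c where "kernel_split G \<theta> G1 G2 c" using kernel_split_exists[OF G th] by blast
  note S = kernel_splitD[OF this]
  note G1 = S(1-3) and G2 = S(4-6) and split = S(7)
  note D2 = unimodal_kernelD[OF G2(1)]
  have L0: "0 \<le> L" using \<phi>(2)[of 1 0] by simp
  have B0: "0 \<le> B" using \<phi>(1)[of 0] by linarith
  have pc: "continuous_on UNIV \<phi>"
  proof (rule lipschitz_on_continuous_on)
    show "L-lipschitz_on UNIV \<phi>" by (rule lipschitz_onI) (use \<phi>(2) L0 in \<open>auto simp: dist_real_def\<close>)
  qed
  have pm: "\<phi> \<in> borel_measurable borel" by (rule borel_measurable_continuous_onI[OF pc])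
  \<comment> \<open>Of the error \<open>e\<close>, each of the two quotients of the remainder may
    use \<open>e / 4\<close>, which fixes \<open>\<eta>\<close>; the mollified part may use
    \<open>e / 2\<close>, which fixes \<open>d\<close> below.\<close>
  define \<eta> where "\<eta> = e / (4 * (4 * c * L + 1))"
  have cL: "0 \<le> c * L" using G2(3) L0 by simp
  have eta: "0 < \<eta>" unfolding \<eta>_def using e cL by simp
  have eta2: "4 * c * (L * \<eta>) \<le> e / 4"
  proof -
    have "\<eta> * (4 * c * L + 1) = e / 4" unfolding \<eta>_def using cL by (simp add: field_simps)
    then show ?thesis using eta by (simp add: algebra_simps)
  qed
  obtain \<beta> where bc: "continuous_on UNIV \<beta>" and bx: "\<And>x. \<exists>\<xi>. \<bar>\<xi> - x\<bar> \<le> \<eta> \<and> \<beta> x = \<phi> \<xi>"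
    and bq: "\<And>x h k. h \<noteq> 0 \<Longrightarrow> k \<noteq> 0 \<Longrightarrow>
\<bar>dq h \<beta> x - dq k \<beta> x\<bar> \<le> 4 * B / \<eta>\<^sup>2 * (\<bar>h\<bar> + \<bar>k\<bar>)"
    by (rule mollifier[OF pc \<phi>(1) eta]) (rule that)
  have bm: "\<beta> \<in> borel_measurable borel" by (rule borel_measurable_continuous_onI[OF bc])
  have bB: "\<bar>\<beta> x\<bar> \<le> B" for x using bx[of x] \<phi>(1) by metis
  define \<rho> where "\<rho> x = \<phi> x - \<beta> x" for x
  have rm: "\<rho> \<in> borel_measurable borel" unfolding \<rho>_def[abs_def] using pm bm by measurable
  have rb: "\<bar>\<rho> x\<bar> \<le> L * \<eta>" for x
  proof -
    obtain \<xi> where xi: "\<bar>\<xi> - x\<bar> \<le> \<eta>" "\<beta> x = \<phi> \<xi>" using bx by blast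
    have "\<bar>\<phi> x - \<phi> \<xi>\<bar> \<le> L * \<bar>x - \<xi>\<bar>" by (rule \<phi>(2))
    also have "\<dots> \<le> L * \<eta>" using xi L0 by (intro mult_left_mono) auto
    finally show ?thesis using xi by (simp add: \<rho>_def)
  qed
  define M2 where "M2 = integral\<^sup>L lborel G2"
  have M20: "0 \<le> M2" unfolding M2_def using D2(1) by simp
  define Q where "Q = 4 * B / \<eta>\<^sup>2 * M2"
  have Q0: "0 \<le> Q" unfolding Q_def using B0 M20 by simp
  define d where "d = e / (4 * (Q + 1))"
  have d: "0 < d" unfolding d_def using e Q0 by simp
  have dQ: "Q * d \<le> e / 4"
  proof -
    have "d * (Q + 1) = e / 4" unfolding d_def using Q0 by (simp add: field_simps)
    then show ?thesis using d by (simp add: algebra_simps)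
  qed
  \<comment> \<open>For a bounded unimodal kernel the increment of the convolution is linear in both
    the step and the size of the remainder, so dividing by the step leaves a bound independent of
    \<open>h\<close>.\<close>
  have rq: "\<bar>dq h (conv G2 \<rho>) x\<bar> \<le> e / 4" if "h \<noteq> 0" for h x
  proof -
    have "\<bar>conv G2 \<rho> (x + h) - conv G2 \<rho> x\<bar> \<le> 2 * (L * \<eta>) * (LBINT y. G2 y * indicator {-\<bar>h\<bar>..\<bar>h\<bar>} y)"
      by (rule conv_shift_le[OF G2(1) rm rb])
    also have "\<dots> \<le> 2 * (L * \<eta>) * (2 * \<bar>h\<bar> * c)"
      using L0 eta by (intro mult_left_mono mass_le_of_bounded G2) auto
    also have "\<dots> = 4 * c * (L * \<eta>) * \<bar>h\<bar>" by simp
    also have "\<dots> \<le> e / 4 * \<bar>h\<bar>" using eta2 by (intro mult_right_mono) auto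
    finally show ?thesis using that unfolding dq_def by (simp add: abs_divide field_simps)
  qed
  have "\<bar>dq h (conv G \<phi>) x - dq k (conv G \<phi>) x\<bar> \<le> \<theta> * E + e"
    if hk: "h \<noteq> 0" "k \<noteq> 0" "\<bar>h\<bar> \<le> d" "\<bar>k\<bar> \<le> d" and E: "\<And>x. \<bar>dq h \<phi> x - dq k \<phi> x\<bar> \<le> E" for h k E x
  proof -
    have E0: "0 \<le> E" using E[of 0] by linarith
    have 1: "\<bar>dq h (conv G1 \<phi>) x - dq k (conv G1 \<phi>) x\<bar> \<le> \<theta> * E"
    proof -
      have "dq h (conv G1 \<phi>) x - dq k (conv G1 \<phi>) x = conv G1 (\<lambda>x. dq h \<phi> x - dq k \<phi> x) x"
        unfolding conv_dq[OF G1(1) pm \<phi>(1)]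
        by (rule conv_diff[symmetric, OF G1(1) _ _ dq_abs_le[OF \<phi>(1)] dq_abs_le[OF \<phi>(1)]]) (use pm in measurable)
      also have "\<bar>\<dots>\<bar> \<le> E * integral\<^sup>L lborel G1"
        by (rule conv_le[OF G1(1,2) _ E]) (use pm in measurable)
      also have "\<dots> \<le> \<theta> * E" using mult_left_mono[OF G1(3) E0] by (simp add: mult.commute)
      finally show ?thesis .
    qed
    have 2: "\<bar>dq h (conv G2 \<beta>) x - dq k (conv G2 \<beta>) x\<bar> \<le> e / 2"
    proof -
      have "dq h (conv G2 \<beta>) x - dq k (conv G2 \<beta>) x = conv G2 (\<lambda>x. dq h \<beta> x - dq k \<beta> x) x"
        unfolding conv_dq[OF D2(3) bm bB]
        by (rule conv_diff[symmetric, OF D2(3) _ _ dq_abs_le[OF bB] dq_abs_le[OF bB]]) (use bm in measurable)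
      also have "\<bar>\<dots>\<bar> \<le> 4 * B / \<eta>\<^sup>2 * (\<bar>h\<bar> + \<bar>k\<bar>) * M2"
        unfolding M2_def by (rule conv_le[OF D2(3,1)]) (use bm bq[OF hk(1,2)] in auto)
      also have "\<dots> = Q * (\<bar>h\<bar> + \<bar>k\<bar>)" by (simp add: Q_def)
      also have "\<dots> \<le> Q * (2 * d)" using hk Q0 by (intro mult_left_mono) auto
      also have "\<dots> \<le> e / 2" using dQ by simp
      finally show ?thesis .
    qed
    have "\<phi> = (\<lambda>x. \<beta> x + \<rho> x)" by (simp add: \<rho>_def)
    then have G2s: "conv G2 \<phi> x = conv G2 \<beta> x + conv G2 \<rho> x" for x
      using conv_add[OF D2(3) bm rm bB rb] by simp
    have "dq h (conv G \<phi>) x - dq k (conv G \<phi>) x =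
       (dq h (conv G1 \<phi>) x - dq k (conv G1 \<phi>) x) + (dq h (conv G2 \<beta>) x - dq k (conv G2 \<beta>) x)
       + (dq h (conv G2 \<rho>) x - dq k (conv G2 \<rho>) x)"
      unfolding dq_def split[OF pm \<phi>(1)] G2s by (simp add: field_simps add_divide_distrib diff_divide_distrib)
    then show ?thesis using 1 2 rq[OF hk(1), of x] rq[OF hk(2), of x] by linarith
  qed
  then show ?thesis using d by blast
qed

lemma derivative_of_uniformly_cauchy:
  assumes "\<And>e. 0 < e \<Longrightarrow> \<exists>d>0. \<forall>h k. h \<noteq> 0 \<longrightarrow> k \<noteq> 0 \<longrightarrow> \<bar>h\<bar> \<le> d \<longrightarrow> \<bar>k\<bar> \<le> d \<longrightarrow> \<bar>dq h w x - dq k w x\<bar> \<le> e"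
  shows "\<exists>q. (w has_real_derivative q) (at x)"
proof -
  define H where "H n = inverse (real (Suc n))" for n
  have H0: "H n \<noteq> 0" for n by (simp add: H_def)
  have Hl: "H \<longlonglongrightarrow> 0" unfolding H_def by (rule LIMSEQ_inverse_real_of_nat)
  have Hd: "\<forall>\<^sub>F n in sequentially. \<bar>H n\<bar> \<le> d" if "0 < d" for d
    using tendstoD[OF Hl that] by eventually_elim (simp add: dist_real_def)
  have "Cauchy (\<lambda>n. dq (H n) w x)"
  proof (rule metric_CauchyI)
    fix e :: real assume e: "0 < e"
    then obtain d where d: "d > 0" "\<And>h k. h \<noteq> 0 \<Longrightarrow> k \<noteq> 0 \<Longrightarrow> \<bar>h\<bar> \<le> d \<Longrightarrow> \<bar>k\<bar> \<le> d \<Longrightarrow> \<bar>dq h w x - dq k w x\<bar> \<le> e / 2"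
      using assms[of "e/2"] by auto
    obtain N where "\<And>n. n \<ge> N \<Longrightarrow> \<bar>H n\<bar> \<le> d" using Hd[OF d(1)] by (auto simp: eventually_sequentially)
    then have "dist (dq (H m) w x) (dq (H n) w x) < e" if "m \<ge> N" "n \<ge> N" for m n
      using d(2)[OF H0 H0, of m n] that e unfolding dist_real_def by fastforce
    then show "\<exists>M. \<forall>m\<ge>M. \<forall>n\<ge>M. dist (dq (H m) w x) (dq (H n) w x) < e" by blast
  qed
  then obtain q where q: "(\<lambda>n. dq (H n) w x) \<longlonglongrightarrow> q" by (auto simp: Cauchy_convergent_iff convergent_def)
  have "((\<lambda>h. dq h w x) \<longlongrightarrow> q) (at 0)"
  proof (rule tendstoI)
    fix e :: real assume e: "0 < e"
    then obtain d where d: "d > 0" "\<And>h k. h \<noteq> 0 \<Longrightarrow> k \<noteq> 0 \<Longrightarrow> \<bar>h\<bar> \<le> d \<Longrightarrow> \<bar>k\<bar> \<le> d \<Longrightarrow> \<bar>dq h w x - dq k w x\<bar> \<le> e / 2"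
      using assms[of "e/2"] by auto
    have "dist (dq h w x) q < e" if h: "h \<noteq> 0" "\<bar>h\<bar> \<le> d" for h
    proof -
      have "\<bar>dq h w x - q\<bar> \<le> e / 2"
      proof (rule tendsto_upperbound)
        show "(\<lambda>n. \<bar>dq h w x - dq (H n) w x\<bar>) \<longlonglongrightarrow> \<bar>dq h w x - q\<bar>" by (intro tendsto_intros q)
        show "\<forall>\<^sub>F n in sequentially. \<bar>dq h w x - dq (H n) w x\<bar> \<le> e / 2"
          using Hd[OF d(1)] by eventually_elim (rule d(2)[OF h(1) H0 h(2)])
      qed simp
      then show ?thesis using e by (simp add: dist_real_def)
    qed
    then show "\<forall>\<^sub>F h in at 0. dist (dq h w x) q < e"
      unfolding eventually_at using d(1) by (intro exI[of _ d]) (auto simp: dist_real_def)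
  qed
  then show ?thesis unfolding DERIV_def dq_def by blast
qed

lemma derivative_measurable:
  assumes d: "\<And>x. (f has_real_derivative f' x) (at x)"
  shows "f' \<in> borel_measurable borel"
proof (rule borel_measurable_LIMSEQ_real)
  have "continuous_on UNIV f" using d by (meson DERIV_isCont continuous_at_imp_continuous_on)
  then have [measurable]: "f \<in> borel_measurable borel" by (rule borel_measurable_continuous_onI)
  show "dq (inverse (real (Suc n))) f \<in> borel_measurable borel" for n by measurable
  show "(\<lambda>n. dq (inverse (real (Suc n))) f x) \<longlonglongrightarrow> f' x" for x
    unfolding dq_def
    by (rule filterlim_compose[OF d[unfolded DERIV_def]])
      (use LIMSEQ_inverse_real_of_nat in \<open>auto simp: filterlim_at simp del: of_nat_Suc\<close>)
qed

lemma conv_derivative: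
  assumes g: "integrable lborel g" and \<phi>: "\<And>x. \<bar>\<phi> x\<bar> \<le> B" "\<And>x y. \<bar>\<phi> x - \<phi> y\<bar> \<le> L * \<bar>x - y\<bar>"
    and d: "\<And>x. (\<phi> has_real_derivative \<phi>' x) (at x)"
  shows "(conv g \<phi> has_real_derivative conv g \<phi>' x) (at x)"
proof -
  have "continuous_on UNIV \<phi>" using d by (meson DERIV_isCont continuous_at_imp_continuous_on)
  then have pm [measurable]: "\<phi> \<in> borel_measurable borel" by (rule borel_measurable_continuous_onI)
  have p'm [measurable]: "\<phi>' \<in> borel_measurable borel" by (rule derivative_measurable[OF d])
  have gm [measurable]: "g \<in> borel_measurable borel" using borel_measurable_integrable[OF g] by simp
  have "((\<lambda>h. dq h (conv g \<phi>) x) \<longlongrightarrow> conv g \<phi>' x) (at 0)"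
    unfolding tendsto_at_iff_sequentially o_def
  proof (intro allI impI)
    fix X :: "nat \<Rightarrow> real" assume X: "\<forall>i. X i \<in> UNIV - {0}" "X \<longlonglongrightarrow> 0"
    have "(\<lambda>i. LBINT y. g y * dq (X i) \<phi> (x - y)) \<longlonglongrightarrow> (LBINT y. g y * \<phi>' (x - y))"
    proof (rule integral_dominated_convergence[where w="\<lambda>y. \<bar>g y\<bar> * L"])
      show "AE y in lborel. norm (g y * dq (X i) \<phi> (x - y)) \<le> \<bar>g y\<bar> * L" for i
        using dq_lipschitz[OF \<phi>(2)] X(1) by (auto simp: abs_mult intro!: AE_I2 mult_left_mono)
      show "AE y in lborel. (\<lambda>i. g y * dq (X i) \<phi> (x - y)) \<longlonglongrightarrow> g y * \<phi>' (x - y)"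
      proof (rule AE_I2)
        fix y
        have "filterlim X (at 0) sequentially" using X by (auto simp: filterlim_at)
        then have "(\<lambda>i. dq (X i) \<phi> (x - y)) \<longlonglongrightarrow> \<phi>' (x - y)"
          unfolding dq_def by (rule filterlim_compose[OF d[unfolded DERIV_def]])
        then show "(\<lambda>i. g y * dq (X i) \<phi> (x - y)) \<longlonglongrightarrow> g y * \<phi>' (x - y)" by (intro tendsto_intros)
      qed
    qed (use g in \<open>auto, measurable\<close>)
    then show "(\<lambda>i. dq (X i) (conv g \<phi>) x) \<longlonglongrightarrow> conv g \<phi>' x"
      unfolding conv_dq[OF g pm \<phi>(1)] by (simp add: conv_def)
  qed
  then show ?thesis unfolding DERIV_def dq_def .
qed

text \<open>Over a fixed step a convergent function changes arbitrarily little far out. Its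
  derivative is therefore small at a mean value point, and uniform continuity transports this to
  \<open>x\<close>.\<close>

lemma barbalat:
  assumes d: "\<And>x. (w has_real_derivative w' x) (at x)" and l: "(w \<longlongrightarrow> l) at_top"
    and uc: "\<And>e. 0 < e \<Longrightarrow> \<exists>d>0. \<forall>x y. \<bar>x - y\<bar> \<le> d \<longrightarrow> \<bar>w' x - w' y\<bar> \<le> e"
  shows "(w' \<longlongrightarrow> 0) at_top"
proof (rule tendstoI)
  fix e :: real assume e: "0 < e"
  then obtain \<delta> where \<delta>: "0 < \<delta>" "\<And>x y. \<bar>x - y\<bar> \<le> \<delta> \<Longrightarrow> \<bar>w' x - w' y\<bar> \<le> e / 2" using uc[of "e/2"] by auto
  have "0 < e * \<delta> / 8" using e \<delta> by simp
  from tendstoD[OF l this] obtain N where N: "\<And>x. x \<ge> N \<Longrightarrow> \<bar>w x - l\<bar> < e * \<delta> / 8"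
    by (auto simp: eventually_at_top_linorder dist_real_def)
  have "dist (w' x) 0 < e" if x: "x \<ge> N" for x
  proof -
    have "x < x + \<delta>" using \<delta> by simp
    from MVT2[OF this d] obtain z where z: "x < z" "z < x + \<delta>" "w (x + \<delta>) - w x = \<delta> * w' z" by auto
    have "\<bar>w (x + \<delta>) - w x\<bar> < e * \<delta> / 4" using N[of x] N[of "x + \<delta>"] x \<delta>(1) by linarith
    then have "\<delta> * \<bar>w' z\<bar> < \<delta> * (e / 4)" unfolding z(3) using \<delta>(1) by (simp add: abs_mult mult_ac)
    then have "\<bar>w' z\<bar> < e / 4" using \<delta>(1) by simp
    moreover have "\<bar>w' x - w' z\<bar> \<le> e / 2" using z by (intro \<delta>(2)) auto
    ultimately show ?thesis using e unfolding dist_real_def by linarith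
  qed
  then show "\<forall>\<^sub>F x in at_top. dist (w' x) 0 < e" by (auto simp: eventually_at_top_linorder)
qed

section \<open>The strong maximum principle for odd functions\<close>

text \<open>Passing to the limit in chord slopes gives only the weak inequality. Strictness comes
  from applying it at the midpoint, which lies strictly above the chord.\<close>

lemma strictly_concave_above_tangent:
  assumes c: "strictly_concave_on S f" and S: "x \<in> S" "y \<in> S" "x \<noteq> y"
    and d: "(f has_real_derivative D) (at x)"
  shows "f y < f x + D * (y - x)"
proof -
  have cc: "f ((1 - t) * x + t * y) > (1 - t) * f x + t * f y" if "x \<in> S" "y \<in> S" "x \<noteq> y" "0 < t" "t < 1" for x y t
    using c that unfolding strictly_concave_on_def by blast
  have weak: "f z \<le> f x + D * (z - x)" if z: "z \<in> S" "z \<noteq> x" for z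
  proof -
    have "((\<lambda>t. f (x + t * (z - x))) has_real_derivative D * (z - x)) (at 0)"
      by (auto intro!: derivative_eq_intros DERIV_chain2[where f=f, OF _ _] simp: d)
    then have "((\<lambda>t. (f (x + t * (z - x)) - f x) / t) \<longlongrightarrow> D * (z - x)) (at 0)"
      by (simp add: DERIV_def)
    then have "((\<lambda>t. (f (x + t * (z - x)) - f x) / t) \<longlongrightarrow> D * (z - x)) (at_right 0)"
      by (rule tendsto_mono[rotated]) (simp add: at_le)
    then have "f z - f x \<le> D * (z - x)"
    proof (rule tendsto_lowerbound)
      have "f z - f x \<le> (f (x + t * (z - x)) - f x) / t" if t: "0 < t" "t < 1" for t
      proof -
        have "(1 - t) * x + t * z = x + t * (z - x)" by (simp add: algebra_simps)
        then have "f x + t * (f z - f x) < f (x + t * (z - x))"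
          using cc[OF S(1) z(1) _ t] z(2) by (simp add: algebra_simps)
        then show ?thesis using t by (simp add: field_simps)
      qed
      then show "\<forall>\<^sub>F t in at_right 0. f z - f x \<le> (f (x + t * (z - x)) - f x) / t"
        by (intro eventually_at_rightI[of 0 1]) auto
    qed simp
    then show ?thesis by simp
  qed
  define m where "m = (1 - 1/2) * x + 1/2 * y"
  have "(1 - 1/2) * f x + 1/2 * f y < f m" unfolding m_def by (rule cc) (use S in auto)
  moreover have "m \<in> S"
    using convexD[of S x y "1/2" "1/2"] c S unfolding m_def strictly_concave_on_def by simp
  then have "f m \<le> f x + D * (m - x)" using S by (intro weak) (auto simp: m_def)
  ultimately show ?thesis by (simp add: m_def algebra_simps)
qed

lemma strictly_concave_derivative_less:
  assumes c: "strictly_concave_on S f" and S: "x \<in> S" "y \<in> S" "x < y"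
    and d: "(f has_real_derivative D) (at x)" "(f has_real_derivative E) (at y)"
  shows "E < D"
proof -
  have "f y < f x + D * (y - x)" "f x < f y + E * (x - y)"
    using strictly_concave_above_tangent[OF c] S d by auto
  then have "E * (y - x) < D * (y - x)" by (simp add: algebra_simps)
  then show ?thesis using S(3) by simp
qed

text \<open>Absorption: the supremum \<open>S\<close> is finite and satisfies
  \<open>S \<le> S / 2 + e\<close>. The a priori bound \<open>B\<close> provides finiteness and
  leaves no trace in the result.\<close>

lemma uniform_bound_contraction:
  fixes q :: "'a \<Rightarrow> real"
  assumes b: "\<And>x. \<bar>q x\<bar> \<le> B" and c: "\<And>E x. (\<And>x. \<bar>q x\<bar> \<le> E) \<Longrightarrow> \<bar>q x\<bar> \<le> E / 2 + e"
  shows "\<bar>q x\<bar> \<le> 2 * e"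
proof -
  define S where "S = (SUP x. \<bar>q x\<bar>)"
  have "bdd_above (range (\<lambda>x. \<bar>q x\<bar>))" using b by (intro bdd_aboveI[of _ B]) auto
  then have S: "\<bar>q x\<bar> \<le> S" for x unfolding S_def by (intro cSUP_upper) auto
  have "S \<le> S / 2 + e" unfolding S_def[symmetric]
    by (subst S_def, rule cSUP_least) (use c[OF S] in auto)
  then show ?thesis using S[of x] by linarith
qed

lemma derivative_bound_of_lipschitz:
  fixes f :: "real \<Rightarrow> real"
  assumes d: "(f has_real_derivative D) (at x)" and L: "\<And>x y. \<bar>f x - f y\<bar> \<le> L * \<bar>x - y\<bar>"
  shows "\<bar>D\<bar> \<le> L"
proof (rule tendsto_upperbound)
  show "((\<lambda>h. \<bar>dq h f x\<bar>) \<longlongrightarrow> \<bar>D\<bar>) (at 0)"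
    using d unfolding DERIV_def dq_def by (intro tendsto_rabs)
  show "\<forall>\<^sub>F h in at 0. \<bar>dq h f x\<bar> \<le> L"
    using dq_lipschitz[OF L] by (auto simp: eventually_at_filter)
qed simp

lemma AE_lborel_dense:
  assumes "AE x in lborel. P x" and ab: "a < (b::real)"
  shows "\<exists>x. a < x \<and> x < b \<and> P x"
proof (rule ccontr)
  assume n: "\<not> ?thesis"
  have "AE x in lborel. x \<notin> {a<..<b}"
    using assms(1) by eventually_elim (use n in auto)
  then have "emeasure lborel {a<..<b} = 0"
    by (subst (asm) AE_iff_measurable[of "{a<..<b}"]) auto
  then show False using ab by simp
qed

text \<open>Folding \<open>y\<close> onto \<open>- y\<close> replaces the kernel by
  \<open>G (x - y) - G (x + y)\<close>. For positive \<open>x\<close> this is nonnegative for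
  positive \<open>y\<close> and nonpositive for negative \<open>y\<close>, like
  \<open>\<psi>\<close>, so the product is nonnegative on both half-lines, up to the points where
  \<open>G\<close> is evaluated at its singularity.\<close>

lemma conv_odd_symmetrized:
  assumes G: "unimodal_kernel G" and m: "\<psi> \<in> borel_measurable borel" and b: "\<And>x. \<bar>\<psi> x\<bar> \<le> B"
    and odd: "\<And>x. \<psi> (- x) = - \<psi> x" and nn: "\<And>x. 0 < x \<Longrightarrow> 0 \<le> \<psi> x" and x: "0 < x"
  shows "2 * conv G \<psi> x = (LBINT y. (G (x - y) - G (x + y)) * \<psi> y)"
    "integrable lborel (\<lambda>y. (G (x - y) - G (x + y)) * \<psi> y)"
    "AE y in lborel. 0 \<le> (G (x - y) - G (x + y)) * \<psi> y"
proof -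
  note D = unimodal_kernelD[OF G]
  have g1: "integrable lborel (\<lambda>y. G (x - y))" using D(3) by (simp add: integrable_reflect)
  have g2: "integrable lborel (\<lambda>y. G (x + y))" using D(3) integrable_translate[of G x] by (simp add: add.commute)
  have i: "integrable lborel (\<lambda>y. G (x - y) * \<psi> y)" "integrable lborel (\<lambda>y. G (x + y) * \<psi> y)"
    by (rule integrable_mult_bounded[OF g1 _ b], use m in simp) (rule integrable_mult_bounded[OF g2 _ b], use m in simp)
  have "conv G \<psi> x = (LBINT y. G (x + y) * \<psi> (- y))"
    unfolding conv_commute using integral_reflect[of "\<lambda>y. G (x - y) * \<psi> y" 0] by simp
  also have "\<dots> = - (LBINT y. G (x + y) * \<psi> y)" unfolding odd by simp
  finally have "2 * conv G \<psi> x = (LBINT y. G (x - y) * \<psi> y) - (LBINT y. G (x + y) * \<psi> y)"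
    unfolding conv_commute[of G \<psi>] by simp
  then show "2 * conv G \<psi> x = (LBINT y. (G (x - y) - G (x + y)) * \<psi> y)"
    using Bochner_Integration.integral_diff[OF i] by (simp add: left_diff_distrib)
  show "integrable lborel (\<lambda>y. (G (x - y) - G (x + y)) * \<psi> y)"
    using i by (simp add: left_diff_distrib)
  show "AE y in lborel. 0 \<le> (G (x - y) - G (x + y)) * \<psi> y"
    using AE_lborel_singleton[of x] AE_lborel_singleton[of "-x"] AE_lborel_singleton[of "0::real"]
  proof eventually_elim
    case (elim y)
    show ?case
    proof (cases "y > 0")
      case True
      then have "\<bar>x - y\<bar> \<le> \<bar>x + y\<bar>" using x by linarith
      then have "G (x + y) \<le> G (x - y)" using elim by (intro D(2)) auto
      then show ?thesis using nn[OF True] by simp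
    next
      case False
      then have "\<bar>x + y\<bar> \<le> \<bar>x - y\<bar>" using x by linarith
      then have "G (x - y) \<le> G (x + y)" using elim by (intro D(2)) auto
      moreover have "\<psi> y \<le> 0" using nn[of "- y"] odd[of y] False elim by simp
      ultimately show ?thesis by (intro mult_nonpos_nonpos) auto
    qed
  qed
qed

lemma conv_odd_nonneg:
  assumes "unimodal_kernel G" "\<psi> \<in> borel_measurable borel" "\<And>x. \<bar>\<psi> x\<bar> \<le> B"
    "\<And>x. \<psi> (- x) = - \<psi> x" "\<And>x. 0 < x \<Longrightarrow> 0 \<le> \<psi> x" "0 < x"
  shows "0 \<le> conv G \<psi> x"
proof -
  have "0 \<le> 2 * conv G \<psi> x"
    using conv_odd_symmetrized(1)[OF assms] integral_nonneg_AE[OF conv_odd_symmetrized(3)[OF assms]] by linarith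
  then show ?thesis by simp
qed

text \<open>A substitute for strict decrease: by integrability the set where \<open>G\<close> is at
  least \<open>G r\<close> is bounded, and across its supremum \<open>d\<close> the kernel drops
  strictly.\<close>

lemma unimodal_kernel_decay_point:
  assumes G: "unimodal_kernel G" and r: "r \<noteq> 0" "0 < G r"
  obtains d where "0 < d" "\<And>a b. a \<noteq> 0 \<Longrightarrow> \<bar>a\<bar> < d \<Longrightarrow> d < \<bar>b\<bar> \<Longrightarrow> G b < G a"
proof -
  note D = unimodal_kernelD[OF G]
  define T where "T = {t. 0 < t \<and> G r \<le> G t}"
  have rT: "\<bar>r\<bar> \<in> T" unfolding T_def using r D(2)[of "\<bar>r\<bar>" r] by auto
  have "t \<le> integral\<^sup>L lborel G / G r" if t: "t \<in> T" for t
  proof -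
    have "t * G r = (LBINT y. G r * indicator {0<..t} y)" using t by (simp add: T_def)
    also have "\<dots> \<le> integral\<^sup>L lborel G"
    proof (rule integral_mono[OF _ D(3)])
      show "integrable lborel (\<lambda>y. G r * indicator {0<..t} y)"
        using t by (intro integrable_mult_right integrable_real_indicator) (auto simp: T_def)
      show "G r * indicator {0<..t} y \<le> G y" for y
        using D(1)[of y] D(2)[of y t] t by (auto simp: T_def indicator_def)
    qed
    finally show ?thesis using r(2) by (simp add: field_simps)
  qed
  then have bdd: "bdd_above T" by (intro bdd_aboveI)
  define d where "d = Sup T"
  have d0: "0 < d" using cSup_upper[OF rT bdd] r by (simp add: d_def)
  have "G b < G a" if ab: "a \<noteq> 0" "\<bar>a\<bar> < d" "d < \<bar>b\<bar>" for a b
  proof -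
    obtain t where t: "t \<in> T" "\<bar>a\<bar> < t" using ab(2) rT less_cSup_iff[OF _ bdd] unfolding d_def by blast
    then have "G r \<le> G a" using D(2)[of a t] ab by (auto simp: T_def)
    moreover have "\<bar>b\<bar> \<notin> T" using cSup_upper[OF _ bdd, of "\<bar>b\<bar>"] ab by (auto simp: d_def)
    then have "G \<bar>b\<bar> < G r" using ab d0 by (auto simp: T_def)
    moreover have "G b \<le> G \<bar>b\<bar>" using ab d0 by (intro D(2)) auto
    ultimately show ?thesis by linarith
  qed
  with d0 show thesis by (rule that)
qed

text \<open>A nonnegative integrand with zero integral vanishes almost everywhere, hence
  \<open>\<psi>\<close> vanishes wherever the folded kernel is positive. For \<open>y\<close>
  between \<open>\<bar>d - x\<bar>\<close> and \<open>d + x\<close> one has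
  \<open>\<bar>x - y\<bar> < d < x + y\<close>, and the drop at \<open>d\<close> applies; continuity
  removes the null set.\<close>

lemma conv_odd_eq_0:
  assumes G: "unimodal_kernel G" and r: "r \<noteq> 0" "0 < G r"
    and c: "continuous_on UNIV \<psi>" and b: "\<And>x. \<bar>\<psi> x\<bar> \<le> B"
    and odd: "\<And>x. \<psi> (- x) = - \<psi> x" and nn: "\<And>x. 0 < x \<Longrightarrow> 0 \<le> \<psi> x" and x: "0 < x" and z: "conv G \<psi> x = 0"
  shows "\<exists>a b. 0 \<le> a \<and> a < b \<and> (\<forall>y. a < y \<longrightarrow> y < b \<longrightarrow> \<psi> y = 0)"
proof -
  have m: "\<psi> \<in> borel_measurable borel" by (rule borel_measurable_continuous_onI[OF c])
  note S = conv_odd_symmetrized[OF G m b odd nn x]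
  have AE0: "AE y in lborel. (G (x - y) - G (x + y)) * \<psi> y = 0"
    using integral_nonneg_eq_0_iff_AE[OF S(2,3)] S(1) z by simp
  obtain d where d: "0 < d" "\<And>a b. a \<noteq> 0 \<Longrightarrow> \<bar>a\<bar> < d \<Longrightarrow> d < \<bar>b\<bar> \<Longrightarrow> G b < G a"
    using unimodal_kernel_decay_point[OF G r] by blast
  have AE1: "AE y in lborel. y \<in> {\<bar>d - x\<bar><..<d + x} \<longrightarrow> \<psi> y = 0"
    using AE0 AE_lborel_singleton[of x]
  proof eventually_elim
    case (elim y)
    show ?case
    proof
      assume "y \<in> {\<bar>d - x\<bar><..<d + x}"
      then have "G (x + y) < G (x - y)" using elim by (intro d(2)) auto
      then show "\<psi> y = 0" using elim by simp
    qed
  qed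
  have "\<psi> y = 0" if y: "\<bar>d - x\<bar> < y" "y < d + x" for y
  proof (rule ccontr)
    assume "\<psi> y \<noteq> 0"
    then have "\<forall>\<^sub>F t in at y. \<psi> t \<noteq> 0"
      using c by (intro tendsto_imp_eventually_ne[of _ "\<psi> y"]) (auto simp: continuous_on_eq_continuous_at isCont_def)
    then obtain e where e: "0 < e" "\<And>t. t \<noteq> y \<Longrightarrow> dist t y < e \<Longrightarrow> \<psi> t \<noteq> 0" unfolding eventually_at by blast
    have "y < min (y + e) (d + x)" using e y by simp
    from AE_lborel_dense[OF AE1 this] obtain t where "y < t" "t < y + e" "t < d + x" "\<psi> t = 0" using y by auto
    then show False using e(2)[of t] by (auto simp: dist_real_def)
  qed
  then show ?thesis using d(1) x by (intro exI[of _ "\<bar>d - x\<bar>"] exI[of _ "d + x"]) auto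
qed

section \<open>Regularity of the layer\<close>

lemma abs_mult_le: "\<bar>a\<bar> \<le> A \<Longrightarrow> \<bar>b\<bar> \<le> B \<Longrightarrow> \<bar>a * b\<bar> \<le> A * B" for a b :: real
  unfolding abs_mult by (rule mult_mono) auto

lemma continuous_on_of_modulus:
  fixes w :: "real \<Rightarrow> real"
  assumes uc: "\<And>e. 0 < e \<Longrightarrow> \<exists>d>0. \<forall>x y. \<bar>x - y\<bar> \<le> d \<longrightarrow> \<bar>w x - w y\<bar> \<le> e"
  shows "continuous_on UNIV w"
proof -
  have "isCont w x" for x
    unfolding isCont_def
  proof (rule tendstoI)
    fix e :: real assume "0 < e"
    then obtain d where d: "0 < d" "\<And>x y. \<bar>x - y\<bar> \<le> d \<Longrightarrow> \<bar>w x - w y\<bar> \<le> e / 2" using uc[of "e/2"] by auto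
    have "dist (w y) (w x) < e" if "dist y x < d" for y
      using d(2)[of y x] that \<open>0 < e\<close> by (simp add: dist_real_def)
    then show "\<forall>\<^sub>F y in at x. dist (w y) (w x) < e" unfolding eventually_at using d(1) by blast
  qed
  then show ?thesis by (simp add: continuous_on_eq_continuous_at)
qed

lemma increasing_of_pos_derivative:
  fixes u :: "real \<Rightarrow> real"
  assumes d: "\<And>x. (u has_real_derivative u1 x) (at x)" and pos: "\<And>x. 0 < u1 x" and xy: "x < y"
  shows "u x < u y"
proof -
  obtain z where "u y - u x = (y - x) * u1 z" using MVT2[OF xy d] by blast
  moreover have "0 < (y - x) * u1 z" using xy pos by simp
  ultimately show ?thesis by simp
qed

lemma less_limit_of_increasing:
  fixes u :: "real \<Rightarrow> real"
  assumes mono: "\<And>x y. x < y \<Longrightarrow> u x < u y" and lim: "(u \<longlongrightarrow> l) at_top"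
  shows "u x < l"
proof -
  have "u (x + 1) \<le> l"
  proof (rule tendsto_lowerbound[OF lim])
    show "\<forall>\<^sub>F y in at_top. u (x + 1) \<le> u y"
      by (rule eventually_mono[OF eventually_gt_at_top[of "x + 1"]]) (intro less_imp_le mono)
  qed simp
  then show ?thesis using mono[of x "x + 1"] by simp
qed

text \<open>The nonlocal equation is present only as \<open>u_eq\<close>. The bound by
  \<open>\<mu>\<close> is asked on [-1, 1], which contains the range of \<open>u\<close>.\<close>

locale odd_layer =
  fixes f f1 f2 u u1 G :: "real \<Rightarrow> real" and \<mu> :: real
  assumes f: "\<And>x. (f has_real_derivative f1 x) (at x)" and f1: "\<And>x. (f1 has_real_derivative f2 x) (at x)"
    and f2: "continuous_on UNIV f2" and f_odd: "\<And>x. f (- x) = - f x"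
    and concave: "strictly_concave_on {0<..<1} f"
    and u: "\<And>x. (u has_real_derivative u1 x) (at x)" and u1_pos: "\<And>x. 0 < u1 x"
    and u_odd: "\<And>x. u (- x) = - u x" and u_top: "(u \<longlongrightarrow> 1) at_top"
    and G: "unimodal_kernel G" and u_eq: "\<And>x. u x = conv G (\<lambda>x. f (u x) + \<mu> * u x) x"
    and mu: "\<And>s. \<bar>s\<bar> \<le> 1 \<Longrightarrow> \<bar>f1 s\<bar> < \<mu>"
begin

definition F :: "real \<Rightarrow> real" where "F s = f s + \<mu> * s"
definition p :: "real \<Rightarrow> real" where "p x = f1 (u x) + \<mu>"

lemmas GD = unimodal_kernelD[OF G]

lemma mu_pos: "0 < \<mu>" using mu[of 0] by simp

lemma u_mono: "x < y \<Longrightarrow> u x < u y"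
  by (rule increasing_of_pos_derivative[OF u u1_pos])

lemma u_less_1: "u x < 1"
  by (rule less_limit_of_increasing[OF u_mono u_top])

lemma u_abs: "\<bar>u x\<bar> < 1"
  using u_less_1[of x] u_less_1[of "- x"] u_odd[of x] by linarith

lemma u_0: "u 0 = 0" using u_odd[of 0] by simp

lemma u_pos: "0 < x \<Longrightarrow> 0 < u x" using u_mono[of 0 x] u_0 by simp

lemma u_bot: "(u \<longlongrightarrow> - 1) at_bot"
  unfolding filterlim_at_bot_mirror u_odd by (intro tendsto_minus u_top)

lemma u_cont: "continuous_on UNIV u" using u by (meson DERIV_isCont continuous_at_imp_continuous_on)
lemma u_meas [measurable]: "u \<in> borel_measurable borel" by (rule borel_measurable_continuous_onI[OF u_cont])

lemma f1_even: "f1 (- x) = f1 x"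
proof -
  have "((\<lambda>x. f (- x)) has_real_derivative f1 (- x) * - 1) (at x)"
    by (rule DERIV_chain2[OF f]) (auto intro!: derivative_eq_intros)
  moreover have "((\<lambda>x. f (- x)) has_real_derivative - f1 x) (at x)"
    unfolding f_odd by (intro DERIV_minus f)
  ultimately show ?thesis using DERIV_unique by force
qed

lemma F_deriv: "(F has_real_derivative f1 s + \<mu>) (at s)"
  unfolding F_def[abs_def] by (auto intro!: derivative_eq_intros f)

lemma F_odd: "F (- s) = - F s" by (simp add: F_def f_odd)
lemma F_0: "F 0 = 0" using F_odd[of 0] by simp

lemma F_lipschitz:
  assumes "\<bar>s\<bar> \<le> 1" "\<bar>t\<bar> \<le> 1"
  shows "\<bar>F s - F t\<bar> \<le> 2 * \<mu> * \<bar>s - t\<bar>"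
proof -
  have lt: "\<bar>F t - F s\<bar> \<le> 2 * \<mu> * \<bar>t - s\<bar>" if "\<bar>s\<bar> \<le> 1" "\<bar>t\<bar> \<le> 1" and st: "s < t" for s t
  proof -
    obtain z where z: "s < z" "z < t" "F t - F s = (t - s) * (f1 z + \<mu>)" using MVT2[OF st F_deriv] by blast
    have "\<bar>f1 z + \<mu>\<bar> \<le> 2 * \<mu>" using mu[of z] z that by linarith
    from mult_right_mono[OF this, of "\<bar>t - s\<bar>"] show ?thesis unfolding z by (simp add: abs_mult mult.commute)
  qed
  show ?thesis using lt[of s t] lt[of t s] assms by (cases s t rule: linorder_cases) (auto simp: abs_minus_commute)
qed

lemma Fu_bound: "\<bar>F (u x)\<bar> \<le> 2 * \<mu>"
proof -
  have "\<bar>F (u x) - F 0\<bar> \<le> 2 * \<mu> * \<bar>u x - 0\<bar>" using u_abs[of x] by (intro F_lipschitz) auto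
  also have "\<dots> \<le> 2 * \<mu> * 1" using u_abs[of x] mu_pos by (intro mult_left_mono) auto
  finally show ?thesis by (simp add: F_0)
qed

lemma Fu_deriv: "((\<lambda>x. F (u x)) has_real_derivative p x * u1 x) (at x)"
  unfolding p_def by (rule DERIV_chain2[OF F_deriv u])

lemma Fu_meas [measurable]: "(\<lambda>x. F (u x)) \<in> borel_measurable borel"
proof -
  have "continuous_on UNIV F" using F_deriv by (meson DERIV_isCont continuous_at_imp_continuous_on)
  then have [measurable]: "F \<in> borel_measurable borel" by (rule borel_measurable_continuous_onI)
  show ?thesis by measurable
qed

lemma u_conv: "u = conv G (\<lambda>x. F (u x))"
  unfolding F_def by (rule ext) (rule u_eq)

lemma p_pos: "0 < p x" and p_le: "p x \<le> 2 * \<mu>" and p_abs: "\<bar>p x\<bar> \<le> 2 * \<mu>"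
  using mu[of "u x"] u_abs[of x] mu_pos unfolding p_def by linarith+

text \<open>Why the mass \<open>1 / (4 * \<mu>)\<close> is split off: \<open>2 * \<mu>\<close> is a
  Lipschitz constant of \<open>F\<close> on the range of \<open>u\<close> and a bound for
  \<open>p\<close>, so one application of the equation halves increments.\<close>

lemma half_mu: "1 / (4 * \<mu>) * (2 * \<mu> * E) = E / 2" "0 < 1 / (4 * \<mu>)"
  using mu_pos by (auto simp: field_simps)

text \<open>For fixed \<open>h\<close>, a bound \<open>E\<close> on the increments of
  \<open>u\<close> reproduces itself through \<open>u = conv G (F o u)\<close> as
  \<open>E / 2\<close> plus a multiple of \<open>\<bar>h\<bar>\<close>; since \<open>u\<close> is
  bounded, absorption applies.\<close>

lemma u_lipschitz_exists: "\<exists>L. \<forall>x y. \<bar>u x - u y\<bar> \<le> L * \<bar>x - y\<bar>"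
proof -
  obtain C where C: "0 \<le> C" "\<And>\<phi> B E h x. \<phi> \<in> borel_measurable borel \<Longrightarrow> (\<And>x. \<bar>\<phi> x\<bar> \<le> B) \<Longrightarrow> (\<And>x. \<bar>\<phi> (x + h) - \<phi> x\<bar> \<le> E) \<Longrightarrow>
     \<bar>conv G \<phi> (x + h) - conv G \<phi> x\<bar> \<le> 1 / (4 * \<mu>) * E + C * B * \<bar>h\<bar>"
    using conv_smoothing[OF G half_mu(2)] by blast
  have *: "\<bar>u (x + h) - u x\<bar> \<le> 2 * (C * (2 * \<mu>) * \<bar>h\<bar>)" for x h
  proof (rule uniform_bound_contraction[where q="\<lambda>x. u (x + h) - u x"])
    show "\<bar>u (x + h) - u x\<bar> \<le> 2" for x using u_abs[of x] u_abs[of "x + h"] by linarith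
    fix E x assume E: "\<And>x. \<bar>u (x + h) - u x\<bar> \<le> E"
    have "\<bar>F (u (x + h)) - F (u x)\<bar> \<le> 2 * \<mu> * E" for x
    proof -
      have "\<bar>F (u (x + h)) - F (u x)\<bar> \<le> 2 * \<mu> * \<bar>u (x + h) - u x\<bar>"
        using u_abs[of x] u_abs[of "x + h"] by (intro F_lipschitz) auto
      also have "\<dots> \<le> 2 * \<mu> * E" using E[of x] mu_pos by (intro mult_left_mono) auto
      finally show ?thesis .
    qed
    from C(2)[OF Fu_meas Fu_bound this] show "\<bar>u (x + h) - u x\<bar> \<le> E / 2 + C * (2 * \<mu>) * \<bar>h\<bar>"
      unfolding half_mu u_conv[symmetric] .
  qed
  have "\<bar>u x - u y\<bar> \<le> 4 * C * \<mu> * \<bar>x - y\<bar>" for x y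
    using *[of y "x - y"] by simp
  then show ?thesis by blast
qed

definition L where "L = (SOME L. \<forall>x y. \<bar>u x - u y\<bar> \<le> L * \<bar>x - y\<bar>)"

lemma u_lipschitz: "\<bar>u x - u y\<bar> \<le> L * \<bar>x - y\<bar>"
  using someI_ex[OF u_lipschitz_exists] unfolding L_def by blast

lemma L_nonneg: "0 \<le> L" using u_lipschitz[of 1 0] by simp

lemma u1_abs: "\<bar>u1 x\<bar> \<le> L"
  by (rule derivative_bound_of_lipschitz[OF u u_lipschitz])

lemma u1_meas [measurable]: "u1 \<in> borel_measurable borel" by (rule derivative_measurable[OF u])

lemma u1_even: "u1 (- x) = u1 x"
proof -
  have "((\<lambda>x. u (- x)) has_real_derivative u1 (- x) * - 1) (at x)"
    by (rule DERIV_chain2[OF u]) (auto intro!: derivative_eq_intros)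
  moreover have "((\<lambda>x. u (- x)) has_real_derivative - u1 x) (at x)"
    unfolding u_odd by (intro DERIV_minus u)
  ultimately show ?thesis using DERIV_unique by force
qed

text \<open>The derivative of \<open>F (u x)\<close>, so that differentiating the convolution
  identity once gives \<open>u1 = conv G \<psi>\<close>.\<close>

definition \<psi> where "\<psi> x = p x * u1 x"

lemma psi_abs: "\<bar>\<psi> x\<bar> \<le> 2 * \<mu> * L"
  unfolding \<psi>_def abs_mult using p_abs u1_abs mu_pos by (intro mult_mono) auto

lemma p_cont: "continuous_on UNIV p"
proof -
  have "continuous_on UNIV f1" using f1 by (meson DERIV_isCont continuous_at_imp_continuous_on)
  then have "continuous_on UNIV (\<lambda>x. f1 (u x))" by (rule continuous_on_compose2[OF _ u_cont]) simp
  then show ?thesis unfolding p_def[abs_def] by (intro continuous_intros)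
qed

lemma p_meas [measurable]: "p \<in> borel_measurable borel" by (rule borel_measurable_continuous_onI[OF p_cont])
lemma psi_meas [measurable]: "\<psi> \<in> borel_measurable borel" unfolding \<psi>_def[abs_def] by measurable

lemma Fu_lipschitz: "\<bar>F (u x) - F (u y)\<bar> \<le> 2 * \<mu> * L * \<bar>x - y\<bar>"
  by (rule lipschitz_of_derivative_bound[OF Fu_deriv]) (use psi_abs in \<open>auto simp: \<psi>_def\<close>)

lemma u1_conv: "u1 = conv G \<psi>"
proof
  fix x
  have "(conv G (\<lambda>x. F (u x)) has_real_derivative conv G \<psi> x) (at x)"
    by (rule conv_derivative[OF GD(3) Fu_bound Fu_lipschitz]) (use Fu_deriv in \<open>simp add: \<psi>_def\<close>)
  then show "u1 x = conv G \<psi> x" unfolding u_conv[symmetric] by (rule DERIV_unique[OF u])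
qed

lemma u1_uc: "0 < e \<Longrightarrow> \<exists>d>0. \<forall>x y. \<bar>x - y\<bar> \<le> d \<longrightarrow> \<bar>u1 x - u1 y\<bar> \<le> e"
  using conv_uniformly_continuous[OF G psi_meas psi_abs] unfolding u1_conv[symmetric] .

lemma u1_top: "(u1 \<longlongrightarrow> 0) at_top"
  by (rule barbalat[OF u u_top u1_uc])

lemma u1_bot: "(u1 \<longlongrightarrow> 0) at_bot"
  unfolding filterlim_at_bot_mirror u1_even by (rule u1_top)

lemma u1_cont: "continuous_on UNIV u1"
  by (rule continuous_on_of_modulus[OF u1_uc])

section \<open>Second derivative of the layer and its limits at infinity\<close>

definition p1 where "p1 x = f2 (u x) * u1 x"

lemma p_deriv: "(p has_real_derivative p1 x) (at x)"
  unfolding p_def[abs_def] p1_def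
  using DERIV_add[OF DERIV_chain2[OF f1 u, of x] DERIV_const[of \<mu>]] by simp

lemma p1_cont: "continuous_on UNIV p1"
  unfolding p1_def[abs_def] by (intro continuous_on_mult u1_cont continuous_on_compose2[OF f2 u_cont]) simp

lemma f2u_bound: "\<exists>M. \<forall>x. \<bar>f2 (u x)\<bar> \<le> M"
proof -
  have "bounded (f2 ` {-1..1})"
    by (intro compact_imp_bounded compact_continuous_image continuous_on_subset[OF f2]) auto
  then obtain M where M: "\<forall>s\<in>{-1..1}. \<bar>f2 s\<bar> \<le> M" unfolding bounded_iff by auto
  have "u x \<in> {-1..1}" for x using u_abs[of x] by auto
  then show ?thesis using M by blast
qed

lemma p1_lim: "(p1 \<longlongrightarrow> 0) at_top" "(p1 \<longlongrightarrow> 0) at_bot"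
proof -
  obtain M where M: "\<And>x. \<bar>f2 (u x)\<bar> \<le> M" using f2u_bound by blast
  have le: "\<forall>\<^sub>F x in F. norm (p1 x) \<le> M * \<bar>u1 x\<bar>" for F
    unfolding p1_def real_norm_def abs_mult using M by (intro always_eventually allI mult_right_mono) auto
  have lim: "((\<lambda>x. M * \<bar>u1 x\<bar>) \<longlongrightarrow> 0) at_top" "((\<lambda>x. M * \<bar>u1 x\<bar>) \<longlongrightarrow> 0) at_bot"
    using tendsto_mult[OF tendsto_const tendsto_rabs[OF u1_top], of M]
      tendsto_mult[OF tendsto_const tendsto_rabs[OF u1_bot], of M] by simp_all
  show "(p1 \<longlongrightarrow> 0) at_top" by (rule Lim_null_comparison[OF le lim(1)])
  show "(p1 \<longlongrightarrow> 0) at_bot" by (rule Lim_null_comparison[OF le lim(2)])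
qed

lemma p1_bound: "\<exists>P. \<forall>x. \<bar>p1 x\<bar> \<le> P"
proof -
  obtain M where M: "\<And>x. \<bar>f2 (u x)\<bar> \<le> M" using f2u_bound by blast
  have "0 \<le> M" using M[of 0] by linarith
  then have "\<bar>p1 x\<bar> \<le> M * L" for x unfolding p1_def abs_mult using M u1_abs by (intro mult_mono) auto
  then show ?thesis by blast
qed

text \<open>The absorption argument once more, now for \<open>u1 = conv G \<psi>\<close>: the
  increment of \<open>p * u1\<close> splits into \<open>p\<close> times an increment of
  \<open>u1\<close>, which is halved, and an increment of \<open>p\<close>, which is linear in
  \<open>h\<close> because \<open>p1\<close> is bounded.\<close>

lemma u1_lipschitz_exists: "\<exists>L. \<forall>x y. \<bar>u1 x - u1 y\<bar> \<le> L * \<bar>x - y\<bar>"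
proof -
  obtain P where P: "\<And>x. \<bar>p1 x\<bar> \<le> P" using p1_bound by blast
  note p_lip = lipschitz_of_derivative_bound[OF p_deriv P]
  have P0: "0 \<le> P" using P[of 0] by linarith
  obtain C where C: "0 \<le> C" "\<And>\<phi> B E h x. \<phi> \<in> borel_measurable borel \<Longrightarrow> (\<And>x. \<bar>\<phi> x\<bar> \<le> B) \<Longrightarrow> (\<And>x. \<bar>\<phi> (x + h) - \<phi> x\<bar> \<le> E) \<Longrightarrow>
     \<bar>conv G \<phi> (x + h) - conv G \<phi> x\<bar> \<le> 1 / (4 * \<mu>) * E + C * B * \<bar>h\<bar>"
    using conv_smoothing[OF G half_mu(2)] by blast
  define c where "c = 1 / (4 * \<mu>) * (L * P) + C * (2 * \<mu> * L)"
  have *: "\<bar>u1 (x + h) - u1 x\<bar> \<le> 2 * (c * \<bar>h\<bar>)" for x h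
  proof (rule uniform_bound_contraction[where q="\<lambda>x. u1 (x + h) - u1 x"])
    show "\<bar>u1 (x + h) - u1 x\<bar> \<le> 2 * L" for x using u1_abs[of x] u1_abs[of "x + h"] by linarith
    fix E x assume E: "\<And>x. \<bar>u1 (x + h) - u1 x\<bar> \<le> E"
    have "\<bar>\<psi> (x + h) - \<psi> x\<bar> \<le> 2 * \<mu> * E + L * (P * \<bar>h\<bar>)" for x
    proof -
      have "\<psi> (x + h) - \<psi> x = p (x + h) * (u1 (x + h) - u1 x) + u1 x * (p (x + h) - p x)"
        unfolding \<psi>_def by (simp add: algebra_simps)
      also have "\<bar>\<dots>\<bar> \<le> 2 * \<mu> * E + L * (P * \<bar>h\<bar>)"
        using p_lip[of "x + h" x]
        by (intro order_trans[OF abs_triangle_ineq add_mono] abs_mult_le p_abs E u1_abs) simp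
      finally show ?thesis .
    qed
    from C(2)[OF psi_meas psi_abs this]
    have "\<bar>u1 (x + h) - u1 x\<bar> \<le> 1 / (4 * \<mu>) * (2 * \<mu> * E + L * (P * \<bar>h\<bar>)) + C * (2 * \<mu> * L) * \<bar>h\<bar>"
      unfolding u1_conv[symmetric] .
    also have "\<dots> = 1 / (4 * \<mu>) * (2 * \<mu> * E) + c * \<bar>h\<bar>" unfolding c_def by (simp add: algebra_simps)
    finally show "\<bar>u1 (x + h) - u1 x\<bar> \<le> E / 2 + c * \<bar>h\<bar>" unfolding half_mu .
  qed
  have "\<bar>u1 x - u1 y\<bar> \<le> (2 * c) * \<bar>x - y\<bar>" for x y
    using *[of y "x - y"] by simp
  then show ?thesis by blast
qed

definition L1 where "L1 = (SOME L. \<forall>x y. \<bar>u1 x - u1 y\<bar> \<le> L * \<bar>x - y\<bar>)"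

lemma u1_lipschitz: "\<bar>u1 x - u1 y\<bar> \<le> L1 * \<bar>x - y\<bar>"
  using someI_ex[OF u1_lipschitz_exists] unfolding L1_def by blast

lemma psi_lipschitz_exists: "\<exists>C. \<forall>x y. \<bar>\<psi> x - \<psi> y\<bar> \<le> C * \<bar>x - y\<bar>"
proof -
  obtain P where P: "\<And>x. \<bar>p1 x\<bar> \<le> P" using p1_bound by blast
  note p_lip = lipschitz_of_derivative_bound[OF p_deriv P]
  have "\<bar>\<psi> x - \<psi> y\<bar> \<le> (2 * \<mu> * L1 + L * P) * \<bar>x - y\<bar>" for x y
  proof -
    have "\<psi> x - \<psi> y = p x * (u1 x - u1 y) + u1 y * (p x - p y)"
      unfolding \<psi>_def by (simp add: algebra_simps)
    also have "\<bar>\<dots>\<bar> \<le> 2 * \<mu> * (L1 * \<bar>x - y\<bar>) + L * (P * \<bar>x - y\<bar>)"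
      by (intro order_trans[OF abs_triangle_ineq add_mono] abs_mult_le p_abs u1_lipschitz u1_abs p_lip)
    finally show ?thesis by (simp add: algebra_simps)
  qed
  then show ?thesis by blast
qed

text \<open>Quotients of \<open>p\<close> are nearby values of \<open>p1\<close>, and
  \<open>p1\<close> is uniformly continuous on the whole line because it is continuous and tends to
  0 at both ends.\<close>

lemma dq_p_cauchy:
  assumes e: "0 < e"
  shows "\<exists>d>0. \<forall>h k x. h \<noteq> 0 \<longrightarrow> k \<noteq> 0 \<longrightarrow> \<bar>h\<bar> \<le> d \<longrightarrow> \<bar>k\<bar> \<le> d \<longrightarrow> \<bar>dq h p x - dq k p x\<bar> \<le> e"
proof -
  obtain d where d: "0 < d" "\<And>x y. \<bar>x - y\<bar> \<le> d \<Longrightarrow> \<bar>p1 x - p1 y\<bar> \<le> e"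
    using uniformly_continuous_of_limits[OF p1_cont p1_lim e] by blast
  have "\<bar>dq h p x - dq k p x\<bar> \<le> e" if hk: "h \<noteq> 0" "k \<noteq> 0" "\<bar>h\<bar> \<le> d / 2" "\<bar>k\<bar> \<le> d / 2" for h k x
  proof -
    obtain y z where yz: "\<bar>y - x\<bar> \<le> \<bar>h\<bar>" "dq h p x = p1 y" "\<bar>z - x\<bar> \<le> \<bar>k\<bar>" "dq k p x = p1 z"
      using dq_MVT[OF p_deriv] hk by meson
    then show ?thesis using d(2)[of y z] hk by simp
  qed
  then show ?thesis using d(1) by (intro exI[of _ "d / 2"]) auto
qed

text \<open>For two fixed steps the difference of the quotients of \<open>u1\<close> is bounded by
  the Lipschitz constant and halves itself through the equation, up to errors that vanish with the
  steps. Absorption makes the quotients uniformly Cauchy, so \<open>u''\<close> exists.\<close>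

lemma u1_dq_cauchy:
  assumes e: "0 < e"
  shows "\<exists>d>0. \<forall>h k x. h \<noteq> 0 \<longrightarrow> k \<noteq> 0 \<longrightarrow> \<bar>h\<bar> \<le> d \<longrightarrow> \<bar>k\<bar> \<le> d \<longrightarrow> \<bar>dq h u1 x - dq k u1 x\<bar> \<le> e"
proof -
  obtain P where P: "\<And>x. \<bar>p1 x\<bar> \<le> P" using p1_bound by blast
  have P0: "0 \<le> P" using P[of 0] by linarith
  have dqp: "\<bar>dq h p x\<bar> \<le> P" if h: "h \<noteq> 0" for h x
  proof -
    obtain z where "dq h p x = p1 z" using dq_MVT[OF p_deriv h] by blast
    then show ?thesis using P by simp
  qed
  have L10: "0 \<le> L1" using u1_lipschitz[of 1 0] by simp
  obtain C where C: "\<And>x y. \<bar>\<psi> x - \<psi> y\<bar> \<le> C * \<bar>x - y\<bar>" using psi_lipschitz_exists by blast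
  \<comment> \<open>The error allowed for the quotients of \<open>\<psi>\<close>; after
    multiplication by the mass \<open>1 / (4 * \<mu>)\<close> it becomes
    \<open>e / 4\<close>.\<close>
  define r where "r = e * \<mu>"
  have r: "0 < r" unfolding r_def using e mu_pos by simp
  have e4: "0 < e / 4" using e by simp
  obtain d1 where d1: "0 < d1" "\<And>h k E x. h \<noteq> 0 \<Longrightarrow> k \<noteq> 0 \<Longrightarrow> \<bar>h\<bar> \<le> d1 \<Longrightarrow> \<bar>k\<bar> \<le> d1 \<Longrightarrow>
      (\<And>x. \<bar>dq h \<psi> x - dq k \<psi> x\<bar> \<le> E) \<Longrightarrow> \<bar>dq h u1 x - dq k u1 x\<bar> \<le> 1 / (4 * \<mu>) * E + e / 4"
    using conv_dq_cauchy[OF G half_mu(2) e4 psi_abs C, folded u1_conv] by blast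
  have "0 < r / (2 * (L + 1))" using r L_nonneg by simp
  from dq_p_cauchy[OF this] obtain d2 where d2: "0 < d2"
    "\<And>h k x. h \<noteq> 0 \<Longrightarrow> k \<noteq> 0 \<Longrightarrow> \<bar>h\<bar> \<le> d2 \<Longrightarrow> \<bar>k\<bar> \<le> d2 \<Longrightarrow> \<bar>dq h p x - dq k p x\<bar> \<le> r / (2 * (L + 1))" by blast
  define d3 where "d3 = r / (4 * (L1 * P + 1))"
  have LP: "0 \<le> L1 * P" using L10 P0 by simp
  have d3: "0 < d3" unfolding d3_def using r LP by simp
  have d3': "L1 * P * (2 * d3) \<le> r / 2"
  proof -
    have "d3 * (L1 * P + 1) = r / 4" unfolding d3_def using LP by (simp add: field_simps)
    then show ?thesis using d3 by (simp add: algebra_simps)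
  qed
  define d where "d = min d1 (min d2 d3)"
  have "\<bar>dq h u1 x - dq k u1 x\<bar> \<le> e" if hk: "h \<noteq> 0" "k \<noteq> 0" "\<bar>h\<bar> \<le> d" "\<bar>k\<bar> \<le> d" for h k x
  proof -
    have hk': "\<bar>h\<bar> \<le> d1" "\<bar>k\<bar> \<le> d1" "\<bar>h\<bar> \<le> d2" "\<bar>k\<bar> \<le> d2" "\<bar>h\<bar> \<le> d3" "\<bar>k\<bar> \<le> d3"
      using hk unfolding d_def by auto
    have "\<bar>dq h u1 x - dq k u1 x\<bar> \<le> 2 * (e / 2)" for x
    proof (rule uniform_bound_contraction[where q="\<lambda>x. dq h u1 x - dq k u1 x"])
      show "\<bar>dq h u1 x - dq k u1 x\<bar> \<le> 2 * L1" for x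
        using dq_lipschitz[OF u1_lipschitz hk(1), of x] dq_lipschitz[OF u1_lipschitz hk(2), of x] by linarith
      fix E x assume E: "\<And>x. \<bar>dq h u1 x - dq k u1 x\<bar> \<le> E"
      have "\<bar>dq h \<psi> x - dq k \<psi> x\<bar> \<le> 2 * \<mu> * E + r" for x
      proof -
        have eq: "dq h \<psi> x = p x * dq h u1 x + u1 (x + h) * dq h p x" for h
        proof -
          have "p (x + h) * u1 (x + h) - p x * u1 x = p x * (u1 (x + h) - u1 x) + u1 (x + h) * (p (x + h) - p x)"
            by (simp add: algebra_simps)
          then show ?thesis unfolding \<psi>_def dq_def by (simp add: add_divide_distrib)
        qed
        \<comment> \<open>The first term is the one to be absorbed. The second is small because
          \<open>u1\<close> is Lipschitz and quotients of \<open>p\<close> are bounded, the third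
          because quotients of \<open>p\<close> are Cauchy.\<close>
        have diff: "dq h \<psi> x - dq k \<psi> x = p x * (dq h u1 x - dq k u1 x) + (u1 (x + h) - u1 (x + k)) * dq h p x
             + u1 (x + k) * (dq h p x - dq k p x)"
          unfolding eq by (simp add: algebra_simps)
        have "\<bar>dq h \<psi> x - dq k \<psi> x\<bar> \<le> 2 * \<mu> * E + (L1 * (2 * d3)) * P + L * (r / (2 * (L + 1)))"
          unfolding diff
        proof (intro order_trans[OF abs_triangle_ineq add_mono] abs_mult_le p_abs E u1_abs dqp[OF hk(1)])
          have "\<bar>u1 (x + h) - u1 (x + k)\<bar> \<le> L1 * \<bar>h - k\<bar>" using u1_lipschitz[of "x + h" "x + k"] by simp
          also have "\<dots> \<le> L1 * (2 * d3)" using hk' L10 by (intro mult_left_mono) auto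
          finally show "\<bar>u1 (x + h) - u1 (x + k)\<bar> \<le> L1 * (2 * d3)" .
          show "\<bar>dq h p x - dq k p x\<bar> \<le> r / (2 * (L + 1))" by (rule d2(2)[OF hk(1,2) hk'(3,4)])
        qed
        moreover have "L * (r / (2 * (L + 1))) \<le> r / 2"
        proof -
          define q where "q = r / (2 * (L + 1))"
          have "q * (2 * (L + 1)) = r" unfolding q_def using L_nonneg by simp
          moreover have "0 \<le> q" unfolding q_def using L_nonneg r by simp
          ultimately show ?thesis unfolding q_def[symmetric] by (simp add: algebra_simps)
        qed
        moreover have "(L1 * (2 * d3)) * P \<le> r / 2" using d3' by (simp add: mult_ac)
        ultimately show ?thesis by linarith
      qed
      from d1(2)[OF hk(1,2) hk'(1,2) this, of x]
      have "\<bar>dq h u1 x - dq k u1 x\<bar> \<le> 1 / (4 * \<mu>) * (2 * \<mu> * E) + 1 / (4 * \<mu>) * r + e / 4"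
        by (simp add: distrib_left)
      moreover have "1 / (4 * \<mu>) * r = e / 4" unfolding r_def using mu_pos by simp
      ultimately show "\<bar>dq h u1 x - dq k u1 x\<bar> \<le> E / 2 + e / 2" unfolding half_mu by linarith
    qed
    then show ?thesis by simp
  qed
  moreover have "0 < d" unfolding d_def using d1 d2 d3 by simp
  ultimately show ?thesis by blast
qed

definition u2 where "u2 x = (SOME q. (u1 has_real_derivative q) (at x))"

lemma u1_deriv: "(u1 has_real_derivative u2 x) (at x)"
proof -
  have "\<exists>q. (u1 has_real_derivative q) (at x)"
  proof (rule derivative_of_uniformly_cauchy)
    fix e :: real assume "0 < e"
    from u1_dq_cauchy[OF this] show "\<exists>d>0. \<forall>h k. h \<noteq> 0 \<longrightarrow> k \<noteq> 0 \<longrightarrow> \<bar>h\<bar> \<le> d \<longrightarrow> \<bar>k\<bar> \<le> d \<longrightarrow> \<bar>dq h u1 x - dq k u1 x\<bar> \<le> e"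
      by blast
  qed
  then show ?thesis unfolding u2_def by (rule someI_ex)
qed

lemma u2_odd: "u2 (- x) = - u2 x"
proof -
  have "((\<lambda>x. u1 (- x)) has_real_derivative u2 (- x) * - 1) (at x)"
    by (rule DERIV_chain2[OF u1_deriv]) (auto intro!: derivative_eq_intros)
  then have "(u1 has_real_derivative - u2 (- x)) (at x)" unfolding u1_even by simp
  then show ?thesis using DERIV_unique[OF u1_deriv] by force
qed

definition \<omega> where "\<omega> x = p1 x * u1 x + p x * u2 x"

lemma psi_deriv: "(\<psi> has_real_derivative \<omega> x) (at x)"
  unfolding \<psi>_def[abs_def] \<omega>_def using DERIV_mult[OF p_deriv u1_deriv, of x] by (simp add: algebra_simps)

lemma omega_bound: "\<exists>W. \<forall>x. \<bar>\<omega> x\<bar> \<le> W"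
proof -
  obtain C where C: "\<And>x y. \<bar>\<psi> x - \<psi> y\<bar> \<le> C * \<bar>x - y\<bar>" using psi_lipschitz_exists by blast
  show ?thesis by (rule exI[of _ C], rule allI, rule derivative_bound_of_lipschitz[OF psi_deriv C])
qed

lemma u2_conv: "u2 = conv G \<omega>"
proof
  fix x
  obtain C where C: "\<And>x y. \<bar>\<psi> x - \<psi> y\<bar> \<le> C * \<bar>x - y\<bar>" using psi_lipschitz_exists by blast
  have "(conv G \<psi> has_real_derivative conv G \<omega> x) (at x)"
    by (rule conv_derivative[OF GD(3) psi_abs C psi_deriv])
  then show "u2 x = conv G \<omega> x" unfolding u1_conv[symmetric] by (rule DERIV_unique[OF u1_deriv])
qed

lemma omega_meas [measurable]: "\<omega> \<in> borel_measurable borel"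
  by (rule derivative_measurable[OF psi_deriv])

text \<open>Boundedness and measurability of \<open>\<omega>\<close> are enough, since convolution
  with \<open>G\<close> supplies the modulus of continuity. This modulus is what lets
  \<open>u1 \<longlongrightarrow> 0\<close> imply \<open>u2 \<longlongrightarrow> 0\<close>.\<close>

lemma u2_uc:
  assumes "0 < e" shows "\<exists>d>0. \<forall>x y. \<bar>x - y\<bar> \<le> d \<longrightarrow> \<bar>u2 x - u2 y\<bar> \<le> e"
proof -
  obtain W where W: "\<And>x. \<bar>\<omega> x\<bar> \<le> W" using omega_bound by blast
  show ?thesis using conv_uniformly_continuous[OF G omega_meas W assms] unfolding u2_conv[symmetric] .
qed

lemma u2_top: "(u2 \<longlongrightarrow> 0) at_top"
  by (rule barbalat[OF u1_deriv u1_top u2_uc])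

lemma u2_bot: "(u2 \<longlongrightarrow> 0) at_bot"
  unfolding filterlim_at_bot_mirror u2_odd using tendsto_minus[OF u2_top] by simp

lemma u2_cont: "continuous_on UNIV u2"
  by (rule continuous_on_of_modulus[OF u2_uc])

end

section \<open>Concavity of the layer\<close>

context odd_layer
begin

lemma f1_strict_antimono: "0 < s \<Longrightarrow> s < t \<Longrightarrow> t < 1 \<Longrightarrow> f1 t < f1 s"
  by (rule strictly_concave_derivative_less[OF concave _ _ _ f f]) auto

text \<open>Concavity is given on the open interval; the mean value theorem, whose intermediate
  points are interior, carries the tangent inequality to \<open>t = 0\<close>.\<close>

lemma F_tangent:
  assumes "0 \<le> t" "t < 1" "0 < c" "c < 1"
  shows "F t \<le> F c + (f1 c + \<mu>) * (t - c)"
proof (cases t c rule: linorder_cases)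
  case less
  obtain z where z: "t < z" "z < c" "F c - F t = (c - t) * (f1 z + \<mu>)" using MVT2[OF less F_deriv] by blast
  have "(c - t) * (f1 c + \<mu>) \<le> (c - t) * (f1 z + \<mu>)"
    using f1_strict_antimono[of z c] z assms less by (intro mult_left_mono) auto
  then show ?thesis using z(3) by (simp add: algebra_simps)
next
  case greater
  obtain z where z: "c < z" "z < t" "F t - F c = (t - c) * (f1 z + \<mu>)" using MVT2[OF greater F_deriv] by blast
  have "(t - c) * (f1 z + \<mu>) \<le> (t - c) * (f1 c + \<mu>)"
    using f1_strict_antimono[of c z] z assms greater by (intro mult_left_mono) auto
  then show ?thesis using z(3) by (simp add: algebra_simps)
qed simp

text \<open>The intercept at 0 of the tangent to \<open>F\<close> at \<open>u x\<close>. Since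
  \<open>u = conv G (p u) + conv G r\<close>, its positivity on the right half-line is what makes
  \<open>u\<close> a strict supersolution of the linearized equation.\<close>

definition r where "r x = F (u x) - p x * u x"

lemma r_pos: "0 < x \<Longrightarrow> 0 < r x"
proof -
  assume x: "0 < x"
  obtain z where z: "0 < z" "z < u x" "f (u x) - f 0 = (u x - 0) * f1 z" using MVT2[OF u_pos[OF x] f] by blast
  have "u x * f1 (u x) < u x * f1 z"
    using f1_strict_antimono[of z "u x"] z u_less_1[of x] u_pos[OF x] by (intro mult_strict_left_mono) auto
  moreover have "f 0 = 0" using f_odd[of 0] by simp
  ultimately show ?thesis using z(3) unfolding r_def F_def p_def by (simp add: algebra_simps)
qed

lemma p_even: "p (- x) = p x"
  unfolding p_def u_odd f1_even ..

lemma r_odd: "r (- x) = - r x"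
  unfolding r_def u_odd F_odd p_even by simp

text \<open>Where \<open>u (x - h)\<close> is negative, oddness moves it to the concave branch of \<open>F\<close>.\<close>

lemma second_difference_F:
  assumes x: "0 < x" and h: "0 < h"
  shows "F (u (x + h)) + F (u (x - h)) - 2 * F (u x) \<le> p x * (u (x + h) + u (x - h) - 2 * u x)"
proof -
  define a b c m where "a = u (x + h)" and "b = u (x - h)" and "c = u x" and "m = f1 c + \<mu>"
  have c: "0 < c" "c < 1" using u_pos[OF x] u_less_1 by (auto simp: c_def)
  have a: "c < a" "a < 1" using u_mono[of x "x + h"] u_less_1 h by (auto simp: a_def c_def)
  have b: "b < c" "-1 < b" using u_mono[of "x - h" x] u_abs[of "x - h"] h by (auto simp: b_def c_def)
  have Ta: "F a \<le> F c + m * (a - c)" unfolding m_def using a c by (intro F_tangent) auto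
  \<comment> \<open>This says that \<open>m * c\<close> is at most \<open>F c\<close>. It pays for
    the discrepancy when \<open>b\<close> is negative and the tangent inequality cannot be used at
    \<open>b\<close>.\<close>
  have T0: "0 \<le> F c + m * (0 - c)" unfolding m_def using F_tangent[of 0 c] F_0 c by simp
  have "F a + F b - 2 * F c \<le> m * (a + b - 2 * c)"
  proof (cases "0 \<le> b")
    case True
    then have "F b \<le> F c + m * (b - c)" unfolding m_def using b c by (intro F_tangent) auto
    then show ?thesis using Ta by (simp add: algebra_simps)
  next
    case False
    define t where "t = - b"
    have t: "0 < t" "t < 1" using False b by (auto simp: t_def)
    have Fb: "F b = - F t" unfolding t_def F_odd by simp
    show ?thesis
    proof (cases "t \<le> c")
      case True
      obtain z where z: "0 < z" "z < t" "F t - F 0 = (t - 0) * (f1 z + \<mu>)" using MVT2[OF t(1) F_deriv] by blast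
      have "t * m \<le> t * (f1 z + \<mu>)" unfolding m_def
        using f1_strict_antimono[of z c] z True c t by (intro mult_left_mono) auto
      then have "t * m \<le> F t" using z(3) F_0 by simp
      then show ?thesis using Ta T0 unfolding Fb t_def by (simp add: algebra_simps)
    next
      case False
      \<comment> \<open>When \<open>t > c\<close>, the value at \<open>t\<close> is compared with
        that at \<open>a\<close>: beyond \<open>c\<close> the slope of \<open>F\<close> is at most
        \<open>m\<close>, and \<open>t < a\<close> because \<open>h - x < x + h\<close>.\<close>
      have "t < a" using u_odd[of "x - h"] u_mono[of "h - x" "x + h"] x unfolding t_def a_def b_def by simp
      then obtain z where z: "t < z" "z < a" "F a - F t = (a - t) * (f1 z + \<mu>)" using MVT2[OF _ F_deriv] by blast
      have "(a - t) * (f1 z + \<mu>) \<le> (a - t) * m" unfolding m_def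
        using f1_strict_antimono[of c z] z False c a \<open>t < a\<close> by (intro mult_left_mono) auto
      then show ?thesis using z(3) T0 unfolding Fb t_def by (simp add: algebra_simps)
    qed
  qed
  then show ?thesis unfolding a_def b_def c_def m_def p_def .
qed

text \<open>The increment is the derivative of the window integral of \<open>u\<close>, which tends
  to \<open>2 * h\<close> and \<open>- 2 * h\<close> at the two ends. Being nonnegative, it is
  integrable by the fundamental theorem; it dominates the second differences.\<close>

lemma increment_integrable:
  assumes h: "0 < h"
  shows "integrable lborel (\<lambda>x. u (x + h) - u (x - h))"
proof -
  obtain U where U: "\<And>x. (U has_real_derivative u x) (at x)" using antiderivative_exists[OF u_cont] by blast
  define \<Phi> where "\<Phi> x = U (x + h) - U (x - h)" for x
  have d: "(\<Phi> has_real_derivative u (x + h) - u (x - h)) (at x)" for x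
  proof -
    have "((\<lambda>x. U (x + h)) has_real_derivative u (x + h) * 1) (at x)"
      by (rule DERIV_chain2[OF U]) (auto intro!: derivative_eq_intros)
    moreover have "((\<lambda>x. U (x - h)) has_real_derivative u (x - h) * 1) (at x)"
      by (rule DERIV_chain2[OF U]) (auto intro!: derivative_eq_intros)
    ultimately show ?thesis unfolding \<Phi>_def[abs_def] using DERIV_diff by fastforce
  qed
  have bounds: "2 * h * u (x - h) \<le> \<Phi> x" "\<Phi> x \<le> 2 * h * u (x + h)" for x
  proof -
    have "x - h < x + h" using h by simp
    from MVT2[OF this U] obtain z where z: "x - h < z" "z < x + h" "U (x + h) - U (x - h) = (x + h - (x - h)) * u z" by blast
    have "\<Phi> x = 2 * h * u z" using z(3) by (simp add: \<Phi>_def)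
    moreover have "2 * h * u (x - h) \<le> 2 * h * u z" "2 * h * u z \<le> 2 * h * u (x + h)"
      using u_mono[OF z(1)] u_mono[OF z(2)] h by simp_all
    ultimately show "2 * h * u (x - h) \<le> \<Phi> x" "\<Phi> x \<le> 2 * h * u (x + h)" by simp_all
  qed
  have sh: "filterlim (\<lambda>x. x + c) at_top at_top" "filterlim (\<lambda>x. x + c) at_bot at_bot" for c :: real
    using filterlim_tendsto_add_at_top[OF tendsto_const[of c] filterlim_ident]
      filterlim_tendsto_add_at_bot_iff[OF tendsto_const[of c], of "\<lambda>x. x"]
    by (auto simp: add.commute filterlim_ident)
  have top: "(\<Phi> \<longlongrightarrow> 2 * h * 1) at_top"
  proof (rule tendsto_sandwich)
    show "((\<lambda>x. 2 * h * u (x - h)) \<longlongrightarrow> 2 * h * 1) at_top"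
      using filterlim_compose[OF u_top sh(1)[of "-h"]] by (intro tendsto_intros) simp
    show "((\<lambda>x. 2 * h * u (x + h)) \<longlongrightarrow> 2 * h * 1) at_top"
      using filterlim_compose[OF u_top sh(1)[of h]] by (intro tendsto_intros) simp
  qed (use bounds in auto)
  have bot: "(\<Phi> \<longlongrightarrow> 2 * h * - 1) at_bot"
  proof (rule tendsto_sandwich)
    show "((\<lambda>x. 2 * h * u (x - h)) \<longlongrightarrow> 2 * h * - 1) at_bot"
      using filterlim_compose[OF u_bot sh(2)[of "-h"]] by (intro tendsto_intros) simp
    show "((\<lambda>x. 2 * h * u (x + h)) \<longlongrightarrow> 2 * h * - 1) at_bot"
      using filterlim_compose[OF u_bot sh(2)[of h]] by (intro tendsto_intros) simp
  qed (use bounds in auto)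
  have "set_integrable lborel (einterval (- \<infinity>) \<infinity>) (\<lambda>x. u (x + h) - u (x - h))"
  proof (rule interval_integral_FTC_nonneg[where F=\<Phi> and A="2 * h * - 1" and B="2 * h * 1"])
    have "continuous_on UNIV (\<lambda>x. u (x + h) - u (x - h))"
      by (intro continuous_on_diff continuous_on_compose2[OF u_cont] continuous_intros) auto
    then show "isCont (\<lambda>x. u (x + h) - u (x - h)) x" for x by (simp add: continuous_on_eq_continuous_at)
    show "AE x in lborel. - \<infinity> < ereal x \<longrightarrow> ereal x < \<infinity> \<longrightarrow> 0 \<le> u (x + h) - u (x - h)"
      using h by (intro AE_I2) (auto intro!: less_imp_le[OF u_mono])
  qed (use d top bot in \<open>auto simp: ereal_tendsto_simps\<close>)
  then show ?thesis by (simp add: set_integrable_def)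
qed

lemma G_nontrivial: "\<exists>t. t \<noteq> 0 \<and> 0 < G t"
proof (rule ccontr)
  assume "\<not> ?thesis"
  then have z: "G t = 0" if "t \<noteq> 0" for t using GD(1)[of t] that by force
  have "conv G (\<lambda>x. F (u x)) 1 = (\<integral>y. 0 \<partial>(lborel :: real measure))"
    unfolding conv_def
  proof (rule integral_cong_AE)
    show "AE y in lborel. G y * F (u (1 - y)) = 0"
      using AE_lborel_singleton[of "0::real"] by eventually_elim (simp add: z)
    show "(\<lambda>y. G y * F (u (1 - y))) \<in> borel_measurable lborel"
      using GD(4) measurable_compose[OF _ Fu_meas, of "\<lambda>y. 1 - y" borel] by simp
  qed simp
  then show False using u_pos[of 1] fun_cong[OF u_conv, of 1] by simp
qed

lemma r_cont: "continuous_on UNIV r"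
proof -
  have "continuous_on UNIV (\<lambda>x. F (u x))" using Fu_deriv by (meson DERIV_isCont continuous_at_imp_continuous_on)
  then show ?thesis unfolding r_def[abs_def] by (intro continuous_intros p_cont u_cont)
qed

lemma pu_abs: "\<bar>p x * u x\<bar> \<le> 2 * \<mu>"
  using abs_mult_le[OF p_abs[of x] less_imp_le[OF u_abs[of x]]] by simp

lemma r_abs: "\<bar>r x\<bar> \<le> 4 * \<mu>"
  unfolding r_def using Fu_bound[of x] pu_abs[of x] by linarith

lemma r_meas [measurable]: "r \<in> borel_measurable borel"
  by (rule borel_measurable_continuous_onI[OF r_cont])

lemma conv_r_pos:
  assumes x: "0 < x" shows "0 < conv G r x"
proof -
  obtain t where t: "t \<noteq> 0" "0 < G t" using G_nontrivial by blast
  have "0 \<le> conv G r x" by (rule conv_odd_nonneg[OF G r_meas r_abs r_odd less_imp_le[OF r_pos] x])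
  moreover have "conv G r x \<noteq> 0"
  proof
    assume "conv G r x = 0"
    from conv_odd_eq_0[OF G t r_cont r_abs r_odd less_imp_le[OF r_pos] x this]
    obtain a b where "0 \<le> a" "a < b" "\<And>y. a < y \<Longrightarrow> y < b \<Longrightarrow> r y = 0" by blast
    then show False using r_pos[of "(a + b) / 2"] by simp
  qed
  ultimately show ?thesis by simp
qed

lemma conv_pu: "conv G (\<lambda>x. p x * u x) x = u x - conv G r x"
proof -
  have m: "(\<lambda>x. p x * u x) \<in> borel_measurable borel" by measurable
  have "conv G (\<lambda>x. F (u x)) x = conv G (\<lambda>x. p x * u x + r x) x" by (simp add: r_def)
  also have "\<dots> = conv G (\<lambda>x. p x * u x) x + conv G r x"
    by (rule conv_add[OF GD(3) m r_meas pu_abs r_abs])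
  finally show ?thesis using fun_cong[OF u_conv, of x] by simp
qed

text \<open>The linearized operator \<open>z \<mapsto> z - G * (p z)\<close> has the odd strict supersolution \<open>u\<close>; pairing the positive
  part of the second difference with \<open>p u\<close> forces that positive part to vanish.\<close>

lemma second_difference_nonpos:
  assumes x0: "0 < x0" and h: "0 < h"
  shows "u (x0 + h) + u (x0 - h) - 2 * u x0 \<le> 0"
proof -
  define s where "s x = u (x + h) + u (x - h) - 2 * u x" for x
  define \<beta> where "\<beta> x = F (u (x + h)) + F (u (x - h)) - 2 * F (u x)" for x
  \<comment> \<open>The odd extension of the positive part of \<open>s\<close> on the right
    half-line: oddness is what the positivity of convolution with \<open>G\<close> requires.\<close>
  define z where "z x = (if 0 \<le> x then max 0 (s x) else min 0 (s x))" for x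
  have refl: "- x + h = - (x - h)" "- x - h = - (x + h)" for x by simp_all
  have s_odd: "s (- x) = - s x" for x unfolding s_def refl u_odd by simp
  have b_odd: "\<beta> (- x) = - \<beta> x" for x unfolding \<beta>_def refl u_odd F_odd by simp
  have s0: "s 0 = 0" using s_odd[of 0] by simp
  have z_odd: "z (- x) = - z x" for x unfolding z_def s_odd using s0 by (auto simp: max_def min_def)
  have s_cont: "continuous_on UNIV s" unfolding s_def[abs_def]
    by (intro continuous_on_diff continuous_on_add continuous_on_mult continuous_on_compose2[OF u_cont] continuous_intros) auto
  have sm [measurable]: "s \<in> borel_measurable borel" by (rule borel_measurable_continuous_onI[OF s_cont])
  have zm [measurable]: "z \<in> borel_measurable borel" unfolding z_def[abs_def] by measurable
  have bm [measurable]: "\<beta> \<in> borel_measurable borel"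
    unfolding \<beta>_def[abs_def] using measurable_compose[OF _ Fu_meas, of "\<lambda>x. x + h" borel]
      measurable_compose[OF _ Fu_meas, of "\<lambda>x. x - h" borel] by simp
  have b_abs: "\<bar>\<beta> x\<bar> \<le> 8 * \<mu>" for x
    unfolding \<beta>_def using Fu_bound[of "x + h"] Fu_bound[of "x - h"] Fu_bound[of x] by linarith
  \<comment> \<open>Monotonicity of \<open>u\<close> bounds the second difference by the integrable
    increment, which makes the pairing finite although \<open>p * u\<close> does not decay.\<close>
  have s_abs: "\<bar>s x\<bar> \<le> u (x + h) - u (x - h)" for x
    unfolding s_def using u_mono[of x "x + h"] u_mono[of "x - h" x] h by simp
  have z_s: "\<bar>z x\<bar> \<le> \<bar>s x\<bar>" for x unfolding z_def by auto
  have z_abs: "\<bar>z x\<bar> \<le> 2" for x using z_s[of x] s_abs[of x] u_abs[of "x + h"] u_abs[of "x - h"] by linarith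
  have zi: "integrable lborel z"
    by (rule Bochner_Integration.integrable_bound[OF increment_integrable[OF h]])
      (use order_trans[OF z_s s_abs] in \<open>auto intro!: AE_I2 order_trans[OF _ abs_ge_self]\<close>)
  have s_conv: "s x = conv G \<beta> x" for x
  proof -
    have m: "(\<lambda>x. F (u (x + h))) \<in> borel_measurable borel" "(\<lambda>x. F (u (x - h))) \<in> borel_measurable borel"
      using measurable_compose[OF _ Fu_meas, of "\<lambda>x. x + h" borel] measurable_compose[OF _ Fu_meas, of "\<lambda>x. x - h" borel]
      by simp_all
    have b2: "\<bar>2 * F (u x)\<bar> \<le> 4 * \<mu>" "\<bar>F (u (x + h)) + F (u (x - h))\<bar> \<le> 4 * \<mu>" for x
      using Fu_bound[of x] Fu_bound[of "x + h"] Fu_bound[of "x - h"] by linarith+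
    have "conv G \<beta> x = conv G (\<lambda>x. F (u (x + h)) + F (u (x - h))) x - conv G (\<lambda>x. 2 * F (u x)) x"
      unfolding \<beta>_def by (rule conv_diff[OF GD(3) _ _ b2(2,1)]) (use m in measurable)
    also have "conv G (\<lambda>x. F (u (x + h)) + F (u (x - h))) x = conv G (\<lambda>x. F (u (x + h))) x + conv G (\<lambda>x. F (u (x - h))) x"
      by (rule conv_add[OF GD(3) m Fu_bound Fu_bound])
    also have "conv G (\<lambda>x. F (u (x + h))) x = u (x + h)"
      using conv_translate[of G "\<lambda>x. F (u x)" h x] fun_cong[OF u_conv, of "x + h"] by simp
    also have "conv G (\<lambda>x. F (u (x - h))) x = u (x - h)"
      using conv_translate[of G "\<lambda>x. F (u x)" "- h" x] fun_cong[OF u_conv, of "x - h"] by simp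
    also have "conv G (\<lambda>x. 2 * F (u x)) x = 2 * u x"
      unfolding conv_cmult using fun_cong[OF u_conv, of x] by simp
    finally show ?thesis by (simp add: s_def)
  qed
  have pz_abs: "\<bar>p x * z x\<bar> \<le> 2 * \<mu> * 2" for x by (rule abs_mult_le[OF p_abs z_abs])
  have pzm: "(\<lambda>x. p x * z x) \<in> borel_measurable borel" by measurable
  have pz_odd: "p (- x) * z (- x) = - (p x * z x)" for x unfolding p_even z_odd by simp
  have z_nonneg: "0 \<le> z x" if "0 < x" for x unfolding z_def using that by simp
  have pz_nonneg: "0 \<le> p x * z x" if "0 < x" for x using z_nonneg[OF that] p_pos[of x] by simp
  \<comment> \<open>On the right half-line \<open>\<beta> \<le> p * s \<le> p * z\<close>, so
    \<open>s\<close> lies below the convolution of \<open>p * z\<close>. This convolution is also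
    nonnegative, hence it bounds the positive part as well.\<close>
  have sub: "z x \<le> conv G (\<lambda>x. p x * z x) x" if x: "0 < x" for x
  proof -
    have "0 \<le> conv G (\<lambda>x. p x * z x - \<beta> x) x"
    proof (rule conv_odd_nonneg[OF G _ _ _ _ x])
      show "\<bar>p x * z x - \<beta> x\<bar> \<le> 12 * \<mu>" for x using pz_abs[of x] b_abs[of x] by linarith
      show "p (- x) * z (- x) - \<beta> (- x) = - (p x * z x - \<beta> x)" for x unfolding pz_odd b_odd by simp
      fix y :: real assume y: "0 < y"
      have "\<beta> y \<le> p y * s y" unfolding \<beta>_def s_def by (rule second_difference_F[OF y h])
      also have "\<dots> \<le> p y * z y" unfolding z_def using p_pos[of y] y by (intro mult_left_mono) auto
      finally show "0 \<le> p y * z y - \<beta> y" by simp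
    qed measurable
    then have "s x \<le> conv G (\<lambda>x. p x * z x) x"
      unfolding conv_diff[OF GD(3) pzm bm pz_abs b_abs] s_conv by simp
    moreover have "0 \<le> conv G (\<lambda>x. p x * z x) x"
      by (rule conv_odd_nonneg[OF G pzm pz_abs pz_odd pz_nonneg x])
    ultimately show ?thesis unfolding z_def using x by simp
  qed
  have pzi: "integrable lborel (\<lambda>x. p x * z x)"
    using integrable_mult_bounded[OF zi _ p_abs] by (simp add: mult.commute)
  have Ge: "G (- x) = G x" for x using GD(5)[of x] by (cases "x = 0") auto
  have cr_odd: "conv G r (- x) = - conv G r x" for x
    by (rule conv_odd) (simp_all add: Ge r_odd)
  have cz_odd: "conv G (\<lambda>x. p x * z x) (- x) = - conv G (\<lambda>x. p x * z x) x" for x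
    by (rule conv_odd) (use Ge pz_odd in simp_all)
  have even_nonneg: "0 \<le> e x" if "\<And>x. e (- x) = e x" "e 0 = 0" "\<And>x. 0 < x \<Longrightarrow> 0 \<le> e x" for e :: "real \<Rightarrow> real" and x
    using that(1)[of x] that(2) that(3)[of x] that(3)[of "- x"] by (cases x "0 :: real" rule: linorder_cases) auto
  \<comment> \<open>The loss caused by the strictness of the supersolution \<open>u\<close>,
    weighted by \<open>p * z\<close>. As a product of two odd functions that are nonnegative on the
    right, it is nonnegative everywhere.\<close>
  define D where "D x = p x * z x * conv G r x" for x
  have D_nonneg: "0 \<le> D x" for x
  proof (rule even_nonneg[where e=D])
    show "D (- x) = D x" for x unfolding D_def cr_odd pz_odd by simp
    show "D 0 = 0" unfolding D_def z_def using s0 by simp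
    show "0 \<le> D x" if "0 < x" for x
      unfolding D_def using pz_nonneg[OF that] conv_r_pos[OF that] by simp
  qed
  \<comment> \<open>The gap in the subsolution inequality for \<open>z\<close>, weighted by
    \<open>p * u\<close>; nonnegative everywhere by the same parity argument.\<close>
  define E where "E x = p x * u x * (conv G (\<lambda>x. p x * z x) x - z x)" for x
  have E_nonneg: "0 \<le> E x" for x
  proof (rule even_nonneg[where e=E])
    show "E (- x) = E x" for x unfolding E_def cz_odd z_odd p_even u_odd by (simp add: algebra_simps)
    show "E 0 = 0" unfolding E_def u_0 by simp
    show "0 \<le> E x" if "0 < x" for x
      unfolding E_def using p_pos[of x] u_pos[OF that] sub[OF that] by simp
  qed
  have pum: "(\<lambda>x. p x * u x) \<in> borel_measurable borel" by measurable
  have crm: "conv G r \<in> borel_measurable borel" using GD(4) by measurable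
  have i1: "integrable lborel (\<lambda>x. p x * z x * u x)"
    by (rule integrable_mult_bounded[OF pzi _ less_imp_le[OF u_abs]]) simp
  have i2: "integrable lborel D"
    unfolding D_def[abs_def] by (rule integrable_mult_bounded[OF pzi _ conv_le[OF GD(3,1) r_meas r_abs]]) (use crm in simp)
  have i3: "integrable lborel (\<lambda>x. p x * u x * conv G (\<lambda>x. p x * z x) x)"
    using integrable_mult_bounded[OF conv_integrable(1)[OF GD(3) pzi] _ pu_abs] pum by (simp add: mult.commute)
  \<comment> \<open>Symmetry of \<open>G\<close> moves the convolution from \<open>p * z\<close> to
    \<open>p * u\<close>, where it equals \<open>u - conv G r\<close>. The terms
    \<open>p * z * u\<close> cancel and the integral of \<open>E\<close> is minus that of
    \<open>D\<close>, which forces both to be 0.\<close>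
  have "integral\<^sup>L lborel E = (LBINT x. p x * u x * conv G (\<lambda>x. p x * z x) x - p x * z x * u x)"
    unfolding E_def by (intro Bochner_Integration.integral_cong) (auto simp: algebra_simps)
  also have "\<dots> = (LBINT x. p x * u x * conv G (\<lambda>x. p x * z x) x) - (LBINT x. p x * z x * u x)"
    by (rule Bochner_Integration.integral_diff[OF i3 i1])
  also have "(LBINT x. p x * u x * conv G (\<lambda>x. p x * z x) x) = (LBINT x. p x * z x * conv G (\<lambda>x. p x * u x) x)"
    by (rule conv_symmetric[OF pzi GD(3) _ pum pu_abs]) (rule Ge)
  also have "\<dots> = (LBINT x. p x * z x * u x - D x)"
    unfolding conv_pu D_def by (simp add: right_diff_distrib)
  also have "\<dots> = (LBINT x. p x * z x * u x) - integral\<^sup>L lborel D"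
    by (rule Bochner_Integration.integral_diff[OF i1 i2])
  finally have "integral\<^sup>L lborel E = - integral\<^sup>L lborel D" by simp
  moreover have "0 \<le> integral\<^sup>L lborel E" "0 \<le> integral\<^sup>L lborel D" using E_nonneg D_nonneg by simp_all
  ultimately have "integral\<^sup>L lborel D = 0" by linarith
  then have AE0: "AE x in lborel. D x = 0"
    using integral_nonneg_eq_0_iff_AE[OF i2] D_nonneg by simp
  \<comment> \<open>Vanishing of \<open>D\<close> almost everywhere makes \<open>z\<close> vanish
    almost everywhere on the right, as \<open>p\<close> and \<open>conv G r\<close> are positive
    there; continuity of \<open>s\<close> then excludes a positive value at
    \<open>x0\<close>.\<close>
  have "s x0 \<le> 0"
  proof (rule ccontr)
    assume "\<not> s x0 \<le> 0"
    then have "\<forall>\<^sub>F t in at x0. 0 < s t"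
      using s_cont by (intro order_tendstoD(1)[of _ "s x0"]) (auto simp: continuous_on_eq_continuous_at isCont_def)
    then obtain e where e: "0 < e" "\<And>t. t \<noteq> x0 \<Longrightarrow> dist t x0 < e \<Longrightarrow> 0 < s t" unfolding eventually_at by blast
    have "x0 < x0 + e" using e(1) by simp
    from AE_lborel_dense[OF AE0 this] obtain t where t: "x0 < t" "t < x0 + e" "D t = 0" by blast
    have "0 < z t" using e(2)[of t] t x0 by (simp add: z_def dist_real_def)
    then show False using t(3) p_pos[of t] conv_r_pos[of t] t(1) x0 unfolding D_def by simp
  qed
  then show ?thesis by (simp add: s_def)
qed

section \<open>From concavity to a strictly negative second derivative\<close>

lemma u2_nonpos:
  assumes x: "0 < x" shows "u2 x \<le> 0"
proof (rule ccontr)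
  assume "\<not> u2 x \<le> 0"
  then have "\<forall>\<^sub>F t in at x. 0 < u2 t"
    using u2_cont by (intro order_tendstoD(1)[of _ "u2 x"]) (auto simp: continuous_on_eq_continuous_at isCont_def)
  then obtain e where e: "0 < e" "\<And>t. t \<noteq> x \<Longrightarrow> dist t x < e \<Longrightarrow> 0 < u2 t" unfolding eventually_at by blast
  define h where "h = e / 2"
  have h: "0 < h" "h < e" using e(1) by (auto simp: h_def)
  obtain t where t: "\<bar>t - x\<bar> \<le> \<bar>h\<bar>" "u (x + h) + u (x - h) - 2 * u x = h\<^sup>2 * u2 t"
    using second_difference_MVT[OF u u1_deriv, of x h] by blast
  have "0 < u2 t" using e(2)[of t] t(1) h \<open>\<not> u2 x \<le> 0\<close> by (cases "t = x") (auto simp: dist_real_def)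
  then have "0 < h\<^sup>2 * u2 t" using h by simp
  then show False using second_difference_nonpos[OF x h(1)] t(2) by simp
qed

lemma f2_nonpos:
  assumes "0 < s" "s < 1" shows "f2 s \<le> 0"
proof (rule ccontr)
  assume "\<not> f2 s \<le> 0"
  then obtain d where d: "d > 0" "\<forall>h>0. h < d \<longrightarrow> f1 s < f1 (s + h)"
    using DERIV_pos_inc_right[OF f1, of s] by auto
  define h where "h = min (d / 2) ((1 - s) / 2)"
  have "0 < h" "h < d" "s + h < 1" using d(1) assms unfolding h_def min_def by (auto simp: field_simps)
  then show False using d(2) f1_strict_antimono[of s "s + h"] assms by force
qed

text \<open>\<open>- \<omega>\<close> is odd and, on the right, a sum of two nonnegative terms. If
  \<open>u2 = conv G \<omega>\<close> vanishes at a positive point, the strong maximum principle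
  makes \<open>\<omega>\<close>, and hence each term, vanish on an interval. As
  \<open>u1 > 0\<close>, this gives \<open>f2 = 0\<close> along the values of \<open>u\<close>
  there, so \<open>f1\<close> is constant on an interval, against strict concavity.\<close>

theorem u2_neg:
  assumes x: "0 < x" shows "u2 x < 0"
proof (rule ccontr)
  assume "\<not> u2 x < 0"
  then have z: "u2 x = 0" using u2_nonpos[OF x] by simp
  obtain t where t: "t \<noteq> 0" "0 < G t" using G_nontrivial by blast
  obtain W where W: "\<And>x. \<bar>\<omega> x\<bar> \<le> W" using omega_bound by blast
  have w_cont: "continuous_on UNIV \<omega>" unfolding \<omega>_def[abs_def]
    by (intro continuous_intros p1_cont u1_cont p_cont u2_cont)
  have f2u: "f2 (- s) = - f2 s" for s
  proof -
    have "((\<lambda>s. f1 (- s)) has_real_derivative f2 (- s) * - 1) (at s)"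
      by (rule DERIV_chain2[OF f1]) (auto intro!: derivative_eq_intros)
    then have "(f1 has_real_derivative - f2 (- s)) (at s)" unfolding f1_even by simp
    then show ?thesis using DERIV_unique[OF f1] by force
  qed
  have p1_odd: "p1 (- x) = - p1 x" for x unfolding p1_def u_odd f2u u1_even by simp
  have w_odd: "- \<omega> (- x) = - (- \<omega> x)" for x
    unfolding \<omega>_def p1_odd u1_even p_even u2_odd by simp
  have terms: "p1 x * u1 x \<le> 0" "p x * u2 x \<le> 0" if "0 < x" for x
  proof -
    have "f2 (u x) * u1 x \<le> 0"
      using f2_nonpos[of "u x"] u_pos[OF that] u_less_1[of x] u1_pos[of x] by (intro mult_nonpos_nonneg) auto
    then show "p1 x * u1 x \<le> 0" unfolding p1_def using u1_pos[of x]
      by (intro mult_nonpos_nonneg[of "f2 (u x) * u1 x"]) auto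
    show "p x * u2 x \<le> 0" using p_pos[of x] u2_nonpos[OF that] by (intro mult_nonneg_nonpos) auto
  qed
  have nn: "0 \<le> - \<omega> x" if "0 < x" for x using terms[OF that] by (simp add: \<omega>_def)
  have "\<exists>a b. 0 \<le> a \<and> a < b \<and> (\<forall>y. a < y \<longrightarrow> y < b \<longrightarrow> - \<omega> y = 0)"
  proof (rule conv_odd_eq_0[OF G t, where x=x])
    show "continuous_on UNIV (\<lambda>x. - \<omega> x)" by (intro continuous_on_minus w_cont)
    show "\<bar>- \<omega> x\<bar> \<le> W" for x using W by simp
    show "conv G (\<lambda>x. - \<omega> x) x = 0" using fun_cong[OF u2_conv, of x] z by (simp add: conv_uminus)
  qed (use w_odd nn x in auto)
  then obtain a b where ab: "0 \<le> a" "a < b" "\<And>y. a < y \<Longrightarrow> y < b \<Longrightarrow> \<omega> y = 0" by auto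
  have f2_0: "f2 (u y) = 0" if y: "a < y" "y < b" for y
  proof -
    have "p1 y * u1 y = 0" using ab(3)[OF y] terms[of y] ab(1) y unfolding \<omega>_def by linarith
    then show ?thesis using u1_pos[of y] by (simp add: p1_def)
  qed
  \<comment> \<open>Interior points of the interval, so that \<open>f2 (u y) = 0\<close> holds
    between them and \<open>u c\<close> is positive even when \<open>a = 0\<close>.\<close>
  define c d where "c = a + (b - a) / 3" and "d = a + 2 * (b - a) / 3"
  have cd: "a < c" "c < d" "d < b" using ab(2) by (auto simp: c_def d_def field_simps)
  have "((\<lambda>x. f1 (u x)) has_real_derivative f2 (u y) * u1 y) (at y)" for y
    by (rule DERIV_chain2[OF f1 u])
  from MVT2[OF cd(2) this] obtain y where y: "c < y" "y < d" "f1 (u d) - f1 (u c) = (d - c) * (f2 (u y) * u1 y)" by blast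
  have "f1 (u d) = f1 (u c)" using y f2_0[of y] cd by simp
  moreover have "f1 (u d) < f1 (u c)"
    using u_mono[OF cd(2)] u_pos[of c] u_less_1[of d] ab(1) cd by (intro f1_strict_antimono) auto
  ultimately show False by simp
qed

end

section \<open>The kernel of the theorem\<close>

lemma c1_pos: "0 < \<gamma> \<Longrightarrow> \<gamma> < 1 \<Longrightarrow> 0 < c1 \<gamma>"
  unfolding c1_def by (intro divide_pos_pos mult_pos_pos Gamma_real_pos) auto

lemma integrable_powr_near_0:
  assumes "b > (-1 :: real)" shows "integrable lborel (\<lambda>x. indicator {0..1} x * x powr b)"
proof -
  have "(\<lambda>x. x powr b) absolutely_integrable_on {0..1::real}"
    by (intro nonnegative_absolutely_integrable_1 integrable_on_powr_from_0) (use assms in auto)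
  then have "integrable lebesgue (\<lambda>x. indicator {0..1} x * x powr b)" unfolding set_integrable_def by simp
  then show ?thesis by (subst (asm) integrable_completion) auto
qed

lemma integrable_powr_tail:
  assumes "a < (-1 :: real)" "0 < e" shows "integrable lborel (\<lambda>x. indicator {e..} x * x powr a)"
proof -
  have "(\<lambda>x. x powr a) integrable_on {e..}" using has_integral_powr_to_inf[OF assms] by blast
  then have "(\<lambda>x. x powr a) absolutely_integrable_on {e..}"
    by (intro nonnegative_absolutely_integrable_1) auto
  then have "integrable lebesgue (\<lambda>x. indicator {e..} x * x powr a)" unfolding set_integrable_def by simp
  then show ?thesis by (subst (asm) integrable_completion) auto
qed

text \<open>\<open>\<gamma> > 0\<close> gives integrability at infinity, \<open>\<gamma> < 1\<close>
  gives the second moment at 0 with integrand of order \<open>x powr (1 - 2 * \<gamma>)\<close>, and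
  the lower bound makes \<open>r * K r\<close> at least a positive multiple of
  \<open>r powr (- 2 * \<gamma>)\<close>.\<close>

lemma layer_kernel_imp_levy_kernel:
  assumes K: "layer_kernel \<gamma> lam Lam K" and g: "0 < \<gamma>" "\<gamma> < 1" and lam: "0 < lam"
  shows "levy_kernel K"
proof -
  have pos: "0 < K x" if "x \<noteq> 0" for x using K that unfolding layer_kernel_def by blast
  have even: "K (- x) = K x" if "x \<noteq> 0" for x using K that unfolding layer_kernel_def by blast
  have lo: "lam * (c1 \<gamma> / \<bar>x\<bar> powr (1 + 2 * \<gamma>)) \<le> K x" if "x \<noteq> 0" for x
    using K that unfolding layer_kernel_def by blast
  have up: "K x \<le> Lam * (c1 \<gamma> / \<bar>x\<bar> powr (1 + 2 * \<gamma>))" if "x \<noteq> 0" for x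
    using K that unfolding layer_kernel_def by blast
  have abs: "K \<bar>x\<bar> = K x" if "x \<noteq> 0" for x using even[OF that] by (auto simp: abs_if)
  have dec: "K y \<le> K x" if "x \<noteq> 0" "\<bar>x\<bar> \<le> \<bar>y\<bar>" for x y
  proof -
    have "antimono_on {0<..} K" using K by (simp add: layer_kernel_def)
    then have "K \<bar>y\<bar> \<le> K \<bar>x\<bar>" using that by (intro monotone_onD[of "{0<..}" "(\<le>)" "(\<ge>)" K]) auto
    then show ?thesis using abs[of x] abs[of y] that by auto
  qed
  define C where "C = Lam * c1 \<gamma>"
  have up': "K x \<le> C * \<bar>x\<bar> powr (- (1 + 2 * \<gamma>))" if "x \<noteq> 0" for x
    using up[OF that] unfolding C_def powr_minus by (simp add: divide_inverse)
  have C0: "0 < C" using up'[of 1] pos[of 1] by simp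
  have trunc_m: "(\<lambda>x. K (max \<bar>x\<bar> e)) \<in> borel_measurable borel" if "0 < e" for e
    by (rule unimodal_measurable) (use that in \<open>auto simp: unimodal_def intro!: dec\<close>)
  show ?thesis
  proof
    show "0 \<le> K x" if "x \<noteq> 0" for x using pos[OF that] by simp
    show "K y \<le> K x" if "x \<noteq> 0" "\<bar>x\<bar> \<le> \<bar>y\<bar>" for x y by (rule dec[OF that])
    show "integrable lborel (\<lambda>x. K (max \<bar>x\<bar> e))" if e: "0 < e" for e
    proof -
      define q where "q x = indicator {e..} x * x powr (- (1 + 2 * \<gamma>))" for x :: real
      have qi: "integrable lborel q"
        unfolding q_def[abs_def] by (rule integrable_powr_tail) (use g e in auto)
      have q'i: "integrable lborel (\<lambda>x. q (- x))" using integrable_reflect[of q 0] qi by simp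
      have "integrable lborel (\<lambda>x. C * (e powr (- (1 + 2 * \<gamma>)) * indicator {-e..e} x + q x + q (- x)))"
        by (intro integrable_mult_right Bochner_Integration.integrable_add qi q'i integrable_real_indicator) (use e in auto)
      then show ?thesis
      proof (rule Bochner_Integration.integrable_bound)
        show "AE x in lborel. norm (K (max \<bar>x\<bar> e)) \<le> norm (C * (e powr (- (1 + 2 * \<gamma>)) * indicator {-e..e} x + q x + q (- x)))"
        proof (rule AE_I2)
          fix x
          have q0: "0 \<le> q x" "0 \<le> q (- x)" by (auto simp: q_def)
          have Kp: "0 < K (max \<bar>x\<bar> e)" using e by (intro pos) auto
          have "K (max \<bar>x\<bar> e) \<le> C * \<bar>max \<bar>x\<bar> e\<bar> powr (- (1 + 2 * \<gamma>))" using e by (intro up') auto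
          also have "\<dots> \<le> C * (e powr (- (1 + 2 * \<gamma>)) * indicator {-e..e} x + q x + q (- x))"
          proof (intro mult_left_mono)
            show "\<bar>max \<bar>x\<bar> e\<bar> powr (- (1 + 2 * \<gamma>)) \<le> e powr (- (1 + 2 * \<gamma>)) * indicator {-e..e} x + q x + q (- x)"
            proof (cases "\<bar>x\<bar> \<le> e")
              case True
              then have "x \<in> {-e..e}" "\<bar>max \<bar>x\<bar> e\<bar> = e" using e by auto
              then show ?thesis using q0 by simp
            next
              case False
              then have "\<bar>max \<bar>x\<bar> e\<bar> = \<bar>x\<bar>" "x \<notin> {-e..e}" by auto
              moreover have "\<bar>x\<bar> powr (- (1 + 2 * \<gamma>)) = q x + q (- x)"
                using False e by (cases "x > 0") (auto simp: q_def indicator_def)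
              ultimately show ?thesis by simp
            qed
          qed (use C0 in simp)
          finally show "norm (K (max \<bar>x\<bar> e)) \<le> norm (C * (e powr (- (1 + 2 * \<gamma>)) * indicator {-e..e} x + q x + q (- x)))"
            unfolding real_norm_def using Kp by linarith
        qed
      qed (use trunc_m[OF e] in simp)
    qed
    show "integrable lborel (\<lambda>x. x\<^sup>2 * K x * indicator {-1..1} x)"
    proof -
      define q where "q x = indicator {0..1} x * x powr (1 - 2 * \<gamma>)" for x :: real
      have qi: "integrable lborel q"
        unfolding q_def[abs_def] by (rule integrable_powr_near_0) (use g in auto)
      have q'i: "integrable lborel (\<lambda>x. q (- x))" using integrable_reflect[of q 0] qi by simp
      have "integrable lborel (\<lambda>x. C * (q x + q (- x)))"
        by (intro integrable_mult_right Bochner_Integration.integrable_add qi q'i)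
      then show ?thesis
      proof (rule Bochner_Integration.integrable_bound)
        \<comment> \<open>Measurability is obtained as a limit of the unimodal truncations; the
          factor \<open>x\<^sup>2\<close> removes the arbitrary value of \<open>K\<close> at
          0.\<close>
        have "(\<lambda>x. x\<^sup>2 * K x) \<in> borel_measurable borel"
        proof (rule borel_measurable_LIMSEQ_real)
          show "(\<lambda>x. x\<^sup>2 * K (max \<bar>x\<bar> (inverse (real (Suc n))))) \<in> borel_measurable borel" for n
            using trunc_m[of "inverse (real (Suc n))"] by simp
          fix x :: real
          show "(\<lambda>n. x\<^sup>2 * K (max \<bar>x\<bar> (inverse (real (Suc n))))) \<longlonglongrightarrow> x\<^sup>2 * K x"
          proof (cases "x = 0")
            case False
            then have "\<forall>\<^sub>F n in sequentially. inverse (real (Suc n)) < \<bar>x\<bar>"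
              by (intro order_tendstoD(2)[OF LIMSEQ_inverse_real_of_nat]) simp
            then have "\<forall>\<^sub>F n in sequentially. x\<^sup>2 * K (max \<bar>x\<bar> (inverse (real (Suc n)))) = x\<^sup>2 * K x"
              by eventually_elim (use abs[OF False] in \<open>simp add: max_def\<close>)
            then show ?thesis by (rule tendsto_eventually)
          qed simp
        qed
        then show "(\<lambda>x. x\<^sup>2 * K x * indicator {-1..1} x) \<in> borel_measurable lborel" by simp
        show "AE x in lborel. norm (x\<^sup>2 * K x * indicator {-1..1} x) \<le> norm (C * (q x + q (- x)))"
        proof (rule AE_I2)
          fix x :: real
          have q0: "0 \<le> q x" "0 \<le> q (- x)" by (auto simp: q_def)
          show "norm (x\<^sup>2 * K x * indicator {-1..1} x) \<le> norm (C * (q x + q (- x)))"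
          proof (cases "x = 0 \<or> \<bar>x\<bar> > 1")
            case True
            then show ?thesis by (auto simp: indicator_def)
          next
            case False
            then have x: "x \<noteq> 0" "\<bar>x\<bar> \<le> 1" by auto
            have "x\<^sup>2 * K x \<le> x\<^sup>2 * (C * \<bar>x\<bar> powr (- (1 + 2 * \<gamma>)))" by (intro mult_left_mono up' x) simp
            also have "\<dots> = C * (\<bar>x\<bar> powr 2 * \<bar>x\<bar> powr (- (1 + 2 * \<gamma>)))" using x by (simp add: powr_numeral)
            also have "\<dots> = C * \<bar>x\<bar> powr (1 - 2 * \<gamma>)" unfolding powr_add[symmetric] by simp
            also have "\<bar>x\<bar> powr (1 - 2 * \<gamma>) = q x + q (- x)"
              using x by (cases "x > 0") (auto simp: q_def indicator_def)
            finally have "x\<^sup>2 * K x \<le> C * (q x + q (- x))" .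
            moreover have "0 \<le> x\<^sup>2 * K x" using pos[OF x(1)] by simp
            moreover have "x \<in> {-1..1}" using x by auto
            ultimately show ?thesis using q0 C0 by (simp add: abs_mult)
          qed
        qed
      qed
    qed
    show "filterlim (\<lambda>r. r * K r) at_top (at_right 0)"
    proof (rule filterlim_at_top_mono)
      have c: "0 < lam * c1 \<gamma>" using lam c1_pos[OF g] by simp
      have "filterlim (\<lambda>r::real. - ln r) at_top (at_right 0)"
        using ln_at_0 by (simp add: filterlim_uminus_at_top)
      then have "filterlim (\<lambda>r::real. (2 * \<gamma>) * - ln r) at_top (at_right 0)"
        by (intro filterlim_tendsto_pos_mult_at_top[OF tendsto_const]) (use g in auto)
      then have "filterlim (\<lambda>r::real. exp ((2 * \<gamma>) * - ln r)) at_top (at_right 0)"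
        by (rule filterlim_compose[OF exp_at_top])
      then show "filterlim (\<lambda>r::real. lam * c1 \<gamma> * exp ((2 * \<gamma>) * - ln r)) at_top (at_right 0)"
        by (intro filterlim_tendsto_pos_mult_at_top[OF tendsto_const c])
      show "\<forall>\<^sub>F r in at_right 0. lam * c1 \<gamma> * exp ((2 * \<gamma>) * - ln r) \<le> r * K r"
      proof (rule eventually_at_rightI[of 0 1])
        fix r :: real assume "r \<in> {0<..<1}"
        then have r: "0 < r" by simp
        have "r / r powr (1 + 2 * \<gamma>) = r powr (- (2 * \<gamma>))"
          using r powr_diff[of r 1 "1 + 2 * \<gamma>"] by simp
        also have "\<dots> = exp ((2 * \<gamma>) * - ln r)" using r by (simp add: powr_def)
        finally have "lam * c1 \<gamma> * exp ((2 * \<gamma>) * - ln r) = r * (lam * (c1 \<gamma> / \<bar>r\<bar> powr (1 + 2 * \<gamma>)))"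
          using r by (simp add: field_simps)
        also have "\<dots> \<le> r * K r" using lo[of r] r by (intro mult_left_mono) auto
        finally show "lam * c1 \<gamma> * exp ((2 * \<gamma>) * - ln r) \<le> r * K r" .
      qed simp
    qed
  qed
qed

theorem lemma5p2:
  fixes f K\<^sub>1 u\<^sub>0 :: "real \<Rightarrow> real" and \<gamma> lam Lam :: real
  assumes "C2_real f"
    and "\<forall>x. f (- x) = - f x"
    and "f 1 = 0" and "f (- 1) = 0"
    and "strictly_concave_on {0<..<1} f"
    and "0 < \<gamma>" and "\<gamma> < 1"
    and "0 < lam" and "lam \<le> Lam"
    and "layer_kernel \<gamma> lam Lam K\<^sub>1"
    and "layer_solution K\<^sub>1 f u\<^sub>0"
  shows "(\<forall>x. deriv u\<^sub>0 differentiable (at x)) \<and>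
         ((deriv (deriv u\<^sub>0) \<longlongrightarrow> 0) at_top \<and> (deriv (deriv u\<^sub>0) \<longlongrightarrow> 0) at_bot) \<and>
         (\<forall>x>0. deriv (deriv u\<^sub>0) x < 0)"
proof -
  define f1 f2 u1 where "f1 = deriv f" and "f2 = deriv f1" and "u1 = deriv u\<^sub>0"
  have f: "(f has_real_derivative f1 x) (at x)" and f1: "(f1 has_real_derivative f2 x) (at x)" for x
    using assms(1) unfolding C2_real_def f1_def f2_def by (auto simp: DERIV_deriv_iff_real_differentiable)
  have f2: "continuous_on UNIV f2" using assms(1) unfolding C2_real_def f1_def f2_def by blast
  have f_odd: "f (- x) = - f x" for x using assms(2) by blast
  have u: "(u\<^sub>0 has_real_derivative u1 x) (at x)" and u1: "0 < u1 x" and u_odd: "u\<^sub>0 (- x) = - u\<^sub>0 x"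
    and L: "has_L K\<^sub>1 u\<^sub>0 x (f (u\<^sub>0 x))" for x
  proof -
    have "u\<^sub>0 x = - u\<^sub>0 (- x)" using assms(11) unfolding layer_solution_def by blast
    then show "u\<^sub>0 (- x) = - u\<^sub>0 x" by simp
    have "u\<^sub>0 differentiable (at x)" using assms(11) unfolding layer_solution_def by blast
    then show "(u\<^sub>0 has_real_derivative u1 x) (at x)" unfolding u1_def DERIV_deriv_iff_real_differentiable .
    show "0 < u1 x" "has_L K\<^sub>1 u\<^sub>0 x (f (u\<^sub>0 x))"
      using assms(11) unfolding layer_solution_def u1_def by blast+
  qed
  have u_top: "(u\<^sub>0 \<longlongrightarrow> 1) at_top" and u_bot: "(u\<^sub>0 \<longlongrightarrow> - 1) at_bot"
    using assms(11) unfolding layer_solution_def by blast+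
  have u_cont: "continuous_on UNIV u\<^sub>0" using u by (meson DERIV_isCont continuous_at_imp_continuous_on)
  have u_abs: "\<bar>u\<^sub>0 x\<bar> < 1" for x
  proof -
    have "u\<^sub>0 x < 1" for x by (rule less_limit_of_increasing[OF increasing_of_pos_derivative[OF u u1] u_top])
    from this[of x] this[of "- x"] show ?thesis unfolding u_odd by linarith
  qed
  have f_cont: "continuous_on UNIV f" and f1_cont: "continuous_on UNIV f1"
    using f f1 by (meson DERIV_isCont continuous_at_imp_continuous_on)+
  have bounded_on: "\<exists>M. \<forall>s. \<bar>s\<bar> \<le> 1 \<longrightarrow> \<bar>h s\<bar> \<le> M" if "continuous_on UNIV h" for h :: "real \<Rightarrow> real"
  proof -
    have "bounded (h ` {-1..1})"
      by (intro compact_imp_bounded compact_continuous_image continuous_on_subset[OF that]) auto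
    then obtain M where "\<forall>s\<in>{-1..1}. \<bar>h s\<bar> \<le> M" unfolding bounded_iff by auto
    then show ?thesis by (intro exI[of _ M]) (auto simp: abs_le_iff)
  qed
  obtain M where M: "\<And>s. \<bar>s\<bar> \<le> 1 \<Longrightarrow> \<bar>f1 s\<bar> \<le> M" using bounded_on[OF f1_cont] by blast
  obtain B where B: "\<And>s. \<bar>s\<bar> \<le> 1 \<Longrightarrow> \<bar>f s\<bar> \<le> B" using bounded_on[OF f_cont] by blast
  \<comment> \<open>Adding 1 makes the bound on \<open>f1\<close> strict, hence \<open>F\<close>
    strictly increasing on the range of the layer.\<close>
  define \<mu> where "\<mu> = M + 1"
  have mu: "\<bar>f1 s\<bar> < \<mu>" if "\<bar>s\<bar> \<le> 1" for s using M[OF that] by (simp add: \<mu>_def)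
  have mu0: "0 < \<mu>" using mu[of 0] by simp
  interpret levy_kernel K\<^sub>1 by (rule layer_kernel_imp_levy_kernel[OF assms(10,6,7,8)])
  have "\<exists>G. unimodal_kernel G \<and> (\<forall>x. u\<^sub>0 x = conv G (\<lambda>x. f (u\<^sub>0 x) + \<mu> * u\<^sub>0 x) x)"
  proof (rule green_function[OF mu0 u_cont u_top u_bot])
    have fu: "continuous_on UNIV (\<lambda>x. f (u\<^sub>0 x))" by (rule continuous_on_compose2[OF f_cont u_cont]) simp
    show "continuous_on UNIV (\<lambda>x. f (u\<^sub>0 x) + \<mu> * u\<^sub>0 x)" by (intro continuous_intros fu u_cont)
    have "((\<lambda>x. f (u\<^sub>0 x)) \<longlongrightarrow> f 1) at_top"
      by (rule isCont_tendsto_compose[OF DERIV_isCont[OF f] u_top])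
    then have "((\<lambda>x. f (u\<^sub>0 x) + \<mu> * u\<^sub>0 x) \<longlongrightarrow> f 1 + \<mu> * 1) at_top" by (intro tendsto_intros u_top)
    \<comment> \<open>Because \<open>f 1 = 0\<close>, the right-hand side tends to
      \<open>\<mu>\<close> times the limit of the layer, so that the resolvents have the same limit
      as the layer.\<close>
    then show "((\<lambda>x. f (u\<^sub>0 x) + \<mu> * u\<^sub>0 x) \<longlongrightarrow> \<mu> * 1) at_top" using assms(3) by simp
    show "\<bar>f (u\<^sub>0 x) + \<mu> * u\<^sub>0 x\<bar> \<le> B + \<mu> * 1" for x
      using B[of "u\<^sub>0 x"] u_abs[of x] abs_mult_le[of \<mu> \<mu> "u\<^sub>0 x" 1] mu0 by linarith
    show "f (u\<^sub>0 (- x)) + \<mu> * u\<^sub>0 (- x) = - (f (u\<^sub>0 x) + \<mu> * u\<^sub>0 x)" for x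
      unfolding u_odd f_odd by simp
    show "has_L K\<^sub>1 u\<^sub>0 x (f (u\<^sub>0 x) + \<mu> * u\<^sub>0 x - \<mu> * u\<^sub>0 x)" for x using L by simp
  qed
  then obtain G where G: "unimodal_kernel G" "\<And>x. u\<^sub>0 x = conv G (\<lambda>x. f (u\<^sub>0 x) + \<mu> * u\<^sub>0 x) x" by blast
  interpret layer: odd_layer f f1 f2 u\<^sub>0 u1 G \<mu>
    by unfold_locales (fact f f1 f2 f_odd assms(5) u u1 u_odd u_top G(1) G(2) | rule mu)+
  have "deriv (deriv u\<^sub>0) = layer.u2"
    unfolding u1_def[symmetric] using layer.u1_deriv by (intro ext DERIV_imp_deriv)
  moreover have "deriv u\<^sub>0 differentiable (at x)" for x
    unfolding u1_def[symmetric] using layer.u1_deriv real_differentiable_def by blast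
  ultimately show ?thesis using layer.u2_top layer.u2_bot layer.u2_neg by simp
qed

end
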